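(* Let $\mu$ be a partition of $n$, let $\lambda$ be a composition of $n$, and let $1\le l<m$ be integers. Let $\tilde\mu$ be the partition $(\mu_l,\mu_{l+1},\dots,\mu_m,0,0,\dots)$. Suppose $A_1,\dots,A_r$ are row-standard $\mu$-tableaux of type $\lambda$ which are identical outside rows $l,l+1,\dots,m$, and let $\tilde A_1,\dots,\tilde A_r$ be the $\tilde\mu$-tableaux obtained by deleting rows $1,\dots,l-1$ and $m+1,m+2,\dots$ of $A_1,\dots,A_r$. If $c_1,\dots,c_r\in\mathbb F$ are such that $\sum_{i=1}^rc_i\hat\phi_{\tilde A_i}=0$, then $\sum_{i=1}^rc_i\hat\phi_{A_i}=0$.
   Context: $\mathbb F$ is an arbitrary field and $q\in\mathbb F$ is a fixed non-zero element. $\mathfrak S_n$ is the symmetric group on $\{1,\dots,n\}$, acting on the right (in a product $uv$, $u$ is applied first), with Coxeter length function $l(\cdot)$ and simple transpositions $s_i=(i\ i{+}1)$. $\mathcal H_n$ is the unital associative $\mathbb F$-algebra with generators $T_1,\dots,T_{n-1}$ and relations $(T_i-q)(T_i+1)=0$, $T_iT_j=T_jT_i$ for $i\le j-2$, and $T_iT_{i+1}T_i=T_{i+1}T_iT_{i+1}$ (so $\mathcal H_0=\mathcal H_1=\mathbb F$). For $w\in\mathfrak S_n$ with reduced expression $w=s_{i_1}\cdots s_{i_k}$, put $T_w=T_{i_1}\cdots T_{i_k}$. Modules are right modules and maps are written on the right. A composition of $n$ is a sequence of non-negative integers (zeros allowed, trailing zeros ignored) with sum $n$; a partition is a weakly decreasing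 composition; $\mu'$ is the conjugate of a partition $\mu$. For a composition $\lambda$ of $n$, $W_\lambda\le\mathfrak S_n$ is the standard Young subgroup, $x_\lambda=\sum_{w\in W_\lambda}T_w$, $y_\lambda=\sum_{w\in W_\lambda}(-q)^{-l(w)}T_w$ and $M^\lambda=x_\lambda\mathcal H_n$. $\mathfrak t^\lambda$ is the $\lambda$-tableau with $1,\dots,n$ in order along successive rows; for a partition $\mu$, $\mathfrak t_\mu$ is the $\mu$-tableau with $1,\dots,n$ in order down successive columns, $w_\mu$ is the permutation with $\mathfrak t^\mu w_\mu=\mathfrak t_\mu$ (permutations act on entries), and $S^\mu=x_\mu T_{w_\mu}y_{\mu'}\mathcal H_n\subseteq M^\mu$ is the Specht module. For compositions $\mu,\lambda$ of $n$, a $\mu$-tableau of type $\lambda$ is a filling of the Young diagram of $\mu$ with positive integers in which each $i$ occurs $\lambda_i$ times; it is row-standard if entries weakly increase along rows. For a row-standard $\mu$-tableau $A$ of type $\lambda$, $1_A\in\mathfrak S_n$ is the permutation such that $\mathfrak t^\lambda1_A$ is the $\lambda$-tableau with entries $1,\dots,n$, increasing along rows, in which $i$ lies in row $r$ if the position occupied by $i$ in $\mathfrak t^\mu$ is occupied by $r$ in $A$. The homomorphism $\phi_A:M^\mu\to M^\lambda$ of $\mathcal H_n$-modules is given by $x_\mu\phi_A=\sum_{w\in W_\lambda1_AW_\mu}T_w$. If $\mu$ is a partition, $\hat\phi_A$ is the restriction of $\phi_A$ to $S^\mu$. The homomorphisms $\hat\phi_{\tilde A_i}$ are defined in the same way over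 $\mathcal H_{\tilde n}$, where $\tilde n=|\tilde\mu|$. *)

theory Defs
  imports
    "HOL-Library.Poly_Mapping"
    "HOL-Library.FuncSet"
    "HOL-Combinatorics.Permutations"
    "HOL-Algebra.QuotRing"
begin

section \<open>The Iwahori--Hecke algebra of the symmetric group\<close>

datatype word = Word "nat list"

primrec letters :: "word \<Rightarrow> nat list" where
  "letters (Word is) = is"

text \<open>
  Words in the generators form a free monoid, written additively because the convolution
  product of \<^theory>\<open>HOL-Library.Poly_Mapping\<close> asks for a \<^class>\<open>monoid_add\<close> index type.
  Thus \<^typ>\<open>word \<Rightarrow>\<^sub>0 'a\<close> is the free unital associative algebra on generators
  indexed by the natural numbers.
\<close>

instantiation word :: monoid_add
begin

definition zero_word :: word where
  "0 = Word []"

definition plus_word :: "word \<Rightarrow> word \<Rightarrow> word" where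
  "u + v = Word (letters u @ letters v)"

instance
proof
  fix a b c :: word
  show "a + b + c = a + (b + c)" "0 + a = a" "a + 0 = a"
    by (cases a; simp add: plus_word_def zero_word_def)+
qed

end

text \<open>The free algebra on the generators with indices \<open>1, \<dots>, n - 1\<close>.\<close>

definition free_algebra :: "nat \<Rightarrow> (word \<Rightarrow>\<^sub>0 'a::field) ring" where
  "free_algebra n =
    \<lparr>carrier = {p. \<forall>u \<in> Poly_Mapping.keys p. set (letters u) \<subseteq> {1..<n}},
     mult = (*), one = 1, zero = 0, add = (+)\<rparr>"

definition gen :: "nat \<Rightarrow> (word \<Rightarrow>\<^sub>0 'a::field)" where
  "gen i = Poly_Mapping.single (Word [i]) 1"

definition const :: "'a \<Rightarrow> (word \<Rightarrow>\<^sub>0 'a::field)" where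
  "const c = Poly_Mapping.single 0 c"

definition hecke_relators :: "nat \<Rightarrow> 'a::field \<Rightarrow> (word \<Rightarrow>\<^sub>0 'a) set" where
  "hecke_relators n q =
     {(gen i - const q) * (gen i + 1) | i. 1 \<le> i \<and> i < n} \<union>
     {gen i * gen j - gen j * gen i | i j. 1 \<le> i \<and> i + 2 \<le> j \<and> j < n} \<union>
     {gen i * gen (i + 1) * gen i - gen (i + 1) * gen i * gen (i + 1) | i. 1 \<le> i \<and> i + 1 < n}"

definition hecke_ideal :: "nat \<Rightarrow> 'a::field \<Rightarrow> (word \<Rightarrow>\<^sub>0 'a) set" where
  "hecke_ideal n q = Idl\<^bsub>free_algebra n\<^esub> (hecke_relators n q)"

definition hecke :: "nat \<Rightarrow> 'a::field \<Rightarrow> (word \<Rightarrow>\<^sub>0 'a) set ring" where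
  "hecke n q = free_algebra n Quot hecke_ideal n q"

definition hclass :: "nat \<Rightarrow> 'a::field \<Rightarrow> (word \<Rightarrow>\<^sub>0 'a) \<Rightarrow> (word \<Rightarrow>\<^sub>0 'a) set" where
  "hclass n q p = hecke_ideal n q +>\<^bsub>free_algebra n\<^esub> p"

text \<open>The \<open>'a\<close>-algebra structure on \<^term>\<open>hecke n q\<close>.\<close>

definition hscale :: "nat \<Rightarrow> 'a::field \<Rightarrow> 'a \<Rightarrow> (word \<Rightarrow>\<^sub>0 'a) set \<Rightarrow> (word \<Rightarrow>\<^sub>0 'a) set" where
  "hscale n q c x = hclass n q (const c) \<otimes>\<^bsub>hecke n q\<^esub> x"


lemma ring_free_algebra: "ring (free_algebra n :: (word \<Rightarrow>\<^sub>0 'a::field) ring)"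
proof (rule ringI)
  let ?F = "free_algebra n :: (word \<Rightarrow>\<^sub>0 'a) ring"
  show "abelian_group ?F"
  proof (rule abelian_groupI)
    fix x y assume "x \<in> carrier ?F" "y \<in> carrier ?F"
    then show "x \<oplus>\<^bsub>?F\<^esub> y \<in> carrier ?F"
      using Poly_Mapping.keys_add[of x y] by (auto simp: free_algebra_def)
  next
    fix x assume "x \<in> carrier ?F"
    then show "\<exists>y\<in>carrier ?F. y \<oplus>\<^bsub>?F\<^esub> x = \<zero>\<^bsub>?F\<^esub>"
      by (intro bexI[of _ "- x"]) (auto simp: free_algebra_def)
  qed (auto simp: free_algebra_def algebra_simps)
  show "monoid ?F"
  proof (rule monoidI)
    fix x y assume "x \<in> carrier ?F" "y \<in> carrier ?F"
    then show "x \<otimes>\<^bsub>?F\<^esub> y \<in> carrier ?F"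
      using Poly_Mapping.keys_mult[of x y]
      by (fastforce simp: free_algebra_def plus_word_def)
  qed (auto simp: free_algebra_def algebra_simps zero_word_def)
qed (auto simp: free_algebra_def algebra_simps)

lemma gen_carrier: "1 \<le> i \<Longrightarrow> i < n \<Longrightarrow> gen i \<in> carrier (free_algebra n)"
  by (auto simp: gen_def free_algebra_def)

lemma const_carrier: "const c \<in> carrier (free_algebra n)"
  by (auto simp: const_def free_algebra_def zero_word_def)

lemma hecke_relators_carrier: "hecke_relators n q \<subseteq> carrier (free_algebra n)"
proof -
  interpret ring "free_algebra n" by (rule ring_free_algebra)
  have m: "x * y \<in> carrier (free_algebra n)"
    if "x \<in> carrier (free_algebra n)" "y \<in> carrier (free_algebra n)" for x y :: "word \<Rightarrow>\<^sub>0 'a"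
    using m_closed[OF that] by (simp add: free_algebra_def)
  have p: "x + y \<in> carrier (free_algebra n)"
    if "x \<in> carrier (free_algebra n)" "y \<in> carrier (free_algebra n)" for x y :: "word \<Rightarrow>\<^sub>0 'a"
    using a_closed[OF that] by (simp add: free_algebra_def)
  have u: "- y \<in> carrier (free_algebra n)"
    if "y \<in> carrier (free_algebra n)" for y :: "word \<Rightarrow>\<^sub>0 'a"
    using that by (simp add: free_algebra_def)
  have s: "x - y \<in> carrier (free_algebra n)"
    if "x \<in> carrier (free_algebra n)" "y \<in> carrier (free_algebra n)" for x y :: "word \<Rightarrow>\<^sub>0 'a"
    using p[OF that(1) u[OF that(2)]] by simp
  have o: "1 \<in> carrier (free_algebra n)"
    using one_closed by (simp add: free_algebra_def)
  show ?thesis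
    by (auto simp: hecke_relators_def intro!: m p s o gen_carrier const_carrier)
qed

lemma ideal_hecke_ideal: "ideal (hecke_ideal n q) (free_algebra n)"
  unfolding hecke_ideal_def
  by (rule ring.genideal_ideal[OF ring_free_algebra hecke_relators_carrier])

lemma ring_hecke: "ring (hecke n q)"
  unfolding hecke_def by (rule ideal.quotient_is_ring[OF ideal_hecke_ideal])


section \<open>The symmetric group and the elements \<open>T\<^sub>w\<close>\<close>

text \<open>
  Permutations act on the right, so the product \<open>u v\<close> (first \<open>u\<close>, then \<open>v\<close>) is the function
  \<^term>\<open>v \<circ> u\<close>.
\<close>

primrec perm_of_word :: "nat list \<Rightarrow> nat \<Rightarrow> nat" where
  "perm_of_word [] = id"
| "perm_of_word (i # is) = perm_of_word is \<circ> transpose i (i + 1)"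

definition expression :: "nat \<Rightarrow> (nat \<Rightarrow> nat) \<Rightarrow> nat list \<Rightarrow> bool" where
  "expression n w is \<longleftrightarrow> set is \<subseteq> {1..<n} \<and> perm_of_word is = w"

definition coxeter_length :: "nat \<Rightarrow> (nat \<Rightarrow> nat) \<Rightarrow> nat" where
  "coxeter_length n w = (LEAST k. \<exists>is. expression n w is \<and> length is = k)"

definition reduced_expression :: "nat \<Rightarrow> (nat \<Rightarrow> nat) \<Rightarrow> nat list \<Rightarrow> bool" where
  "reduced_expression n w is \<longleftrightarrow> expression n w is \<and> length is = coxeter_length n w"

definition T_word :: "nat \<Rightarrow> 'a::field \<Rightarrow> nat list \<Rightarrow> (word \<Rightarrow>\<^sub>0 'a) set" where
  "T_word n q is =
     foldr (\<lambda>i x. hclass n q (gen i) \<otimes>\<^bsub>hecke n q\<^esub> x) is \<one>\<^bsub>hecke n q\<^esub>"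

text \<open>By Matsumoto's theorem the choice of the reduced expression is immaterial.\<close>

definition T :: "nat \<Rightarrow> 'a::field \<Rightarrow> (nat \<Rightarrow> nat) \<Rightarrow> (word \<Rightarrow>\<^sub>0 'a) set" where
  "T n q w = T_word n q (SOME is. reduced_expression n w is)"


section \<open>Compositions, diagrams and tableaux\<close>

text \<open>
  A composition is a function whose values at \<open>1, 2, \<dots>\<close> are its parts; the value at \<open>0\<close> is
  not a part and is normalised to \<open>0\<close>. Rows and columns of diagrams are numbered from \<open>1\<close>.
\<close>

definition comp_size :: "(nat \<Rightarrow> nat) \<Rightarrow> nat" where
  "comp_size \<nu> = (\<Sum>i | \<nu> i \<noteq> 0. \<nu> i)"

definition composition :: "nat \<Rightarrow> (nat \<Rightarrow> nat) \<Rightarrow> bool" where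
  "composition n \<nu> \<longleftrightarrow> \<nu> 0 = 0 \<and> finite {i. \<nu> i \<noteq> 0} \<and> comp_size \<nu> = n"

definition is_partition :: "nat \<Rightarrow> (nat \<Rightarrow> nat) \<Rightarrow> bool" where
  "is_partition n \<nu> \<longleftrightarrow> composition n \<nu> \<and> (\<forall>i\<ge>1. \<nu> (i + 1) \<le> \<nu> i)"

definition conjugate :: "(nat \<Rightarrow> nat) \<Rightarrow> nat \<Rightarrow> nat" where
  "conjugate \<nu> j = (if j = 0 then 0 else card {i. 1 \<le> i \<and> j \<le> \<nu> i})"

definition diagram :: "(nat \<Rightarrow> nat) \<Rightarrow> (nat \<times> nat) set" where
  "diagram \<nu> = {(i, j). 1 \<le> i \<and> 1 \<le> j \<and> j \<le> \<nu> i}"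

text \<open>
  Fillings are functions on \<^typ>\<open>nat \<times> nat\<close>; only their values on the diagram matter.
  Below, \<open>row_tableau \<nu>\<close> and \<open>column_tableau \<nu>\<close> are the tableaux with superscript and
  subscript \<open>\<nu>\<close>, filled along rows and down columns respectively.
\<close>

definition row_tableau :: "(nat \<Rightarrow> nat) \<Rightarrow> nat \<times> nat \<Rightarrow> nat" where
  "row_tableau \<nu> = (\<lambda>(i, j). (\<Sum>k = 1..<i. \<nu> k) + j)"

definition column_tableau :: "(nat \<Rightarrow> nat) \<Rightarrow> nat \<times> nat \<Rightarrow> nat" where
  "column_tableau \<nu> = (\<lambda>(i, j). (\<Sum>k = 1..<j. conjugate \<nu> k) + i)"

definition young_subgroup :: "nat \<Rightarrow> (nat \<Rightarrow> nat) \<Rightarrow> (nat \<Rightarrow> nat) set" where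
  "young_subgroup n \<nu> = {w. w permutes {1..n} \<and>
     (\<forall>i\<ge>1. w ` (row_tableau \<nu> ` {(i, j) | j. (i, j) \<in> diagram \<nu>}) =
             row_tableau \<nu> ` {(i, j) | j. (i, j) \<in> diagram \<nu>})}"

definition perm_w :: "nat \<Rightarrow> (nat \<Rightarrow> nat) \<Rightarrow> nat \<Rightarrow> nat" where
  "perm_w n \<mu> = (THE w. w permutes {1..n} \<and>
     (\<forall>x\<in>diagram \<mu>. w (row_tableau \<mu> x) = column_tableau \<mu> x))"

definition content :: "(nat \<Rightarrow> nat) \<Rightarrow> (nat \<times> nat \<Rightarrow> nat) \<Rightarrow> nat \<Rightarrow> nat" where
  "content \<mu> A r = card {x \<in> diagram \<mu>. A x = r}"

definition tableau_of_type ::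
    "(nat \<Rightarrow> nat) \<Rightarrow> (nat \<Rightarrow> nat) \<Rightarrow> (nat \<times> nat \<Rightarrow> nat) \<Rightarrow> bool" where
  "tableau_of_type \<mu> \<nu> A \<longleftrightarrow> (\<forall>x\<in>diagram \<mu>. 1 \<le> A x) \<and> (\<forall>r\<ge>1. content \<mu> A r = \<nu> r)"

definition row_standard :: "(nat \<Rightarrow> nat) \<Rightarrow> (nat \<times> nat \<Rightarrow> nat) \<Rightarrow> bool" where
  "row_standard \<mu> A \<longleftrightarrow>
     (\<forall>i j k. (i, j) \<in> diagram \<mu> \<and> (i, k) \<in> diagram \<mu> \<and> j \<le> k \<longrightarrow> A (i, j) \<le> A (i, k))"

text \<open>
  For a \<open>\<mu>\<close>-tableau \<open>A\<close> of type \<open>\<nu>\<close>, \<open>perm_1 n \<mu> \<nu> A\<close> is the permutation \<open>1\<^sub>A\<close>: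
  the entry \<open>row_tableau \<mu> x\<close> lies in row \<open>A x\<close> of the \<open>\<nu>\<close>-tableau \<open>w \<circ> row_tableau \<nu>\<close>.
\<close>

definition perm_1 ::
    "nat \<Rightarrow> (nat \<Rightarrow> nat) \<Rightarrow> (nat \<Rightarrow> nat) \<Rightarrow> (nat \<times> nat \<Rightarrow> nat) \<Rightarrow> nat \<Rightarrow> nat" where
  "perm_1 n \<mu> \<nu> A = (THE w. w permutes {1..n} \<and>
     (\<forall>i j k. (i, j) \<in> diagram \<nu> \<and> (i, k) \<in> diagram \<nu> \<and> j < k \<longrightarrow>
        w (row_tableau \<nu> (i, j)) < w (row_tableau \<nu> (i, k))) \<and>
     (\<forall>x\<in>diagram \<mu>. \<exists>j. (A x, j) \<in> diagram \<nu> \<and> w (row_tableau \<nu> (A x, j)) = row_tableau \<mu> x))"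

definition rows_from_to :: "nat \<Rightarrow> nat \<Rightarrow> (nat \<Rightarrow> nat) \<Rightarrow> nat \<Rightarrow> nat" where
  "rows_from_to l m \<mu> i = (if 1 \<le> i \<and> l + i - 1 \<le> m then \<mu> (l + i - 1) else 0)"

definition tableau_from_row :: "nat \<Rightarrow> (nat \<times> nat \<Rightarrow> nat) \<Rightarrow> nat \<times> nat \<Rightarrow> nat" where
  "tableau_from_row l A = (\<lambda>(i, j). A (l + i - 1, j))"


section \<open>Permutation modules, Specht modules and homomorphisms\<close>

definition x_elt :: "nat \<Rightarrow> 'a::field \<Rightarrow> (nat \<Rightarrow> nat) \<Rightarrow> (word \<Rightarrow>\<^sub>0 'a) set" where
  "x_elt n q \<nu> = (\<Oplus>\<^bsub>hecke n q\<^esub> w \<in> young_subgroup n \<nu>. T n q w)"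

definition y_elt :: "nat \<Rightarrow> 'a::field \<Rightarrow> (nat \<Rightarrow> nat) \<Rightarrow> (word \<Rightarrow>\<^sub>0 'a) set" where
  "y_elt n q \<nu> = (\<Oplus>\<^bsub>hecke n q\<^esub> w \<in> young_subgroup n \<nu>.
     hscale n q ((- q) powi (- int (coxeter_length n w))) (T n q w))"

definition perm_module :: "nat \<Rightarrow> 'a::field \<Rightarrow> (nat \<Rightarrow> nat) \<Rightarrow> (word \<Rightarrow>\<^sub>0 'a) set set" where
  "perm_module n q \<nu> = x_elt n q \<nu> <#\<^bsub>hecke n q\<^esub> carrier (hecke n q)"

definition specht_module :: "nat \<Rightarrow> 'a::field \<Rightarrow> (nat \<Rightarrow> nat) \<Rightarrow> (word \<Rightarrow>\<^sub>0 'a) set set" where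
  "specht_module n q \<mu> =
     (x_elt n q \<mu> \<otimes>\<^bsub>hecke n q\<^esub> T n q (perm_w n \<mu>) \<otimes>\<^bsub>hecke n q\<^esub> y_elt n q (conjugate \<mu>))
       <#\<^bsub>hecke n q\<^esub> carrier (hecke n q)"

text \<open>
  Homomorphisms between right ideals of \<^term>\<open>hecke n q\<close>, viewed as right modules;
  linearity over the field is the case where \<open>h\<close> is a scalar.
\<close>

definition right_hom :: "nat \<Rightarrow> 'a::field \<Rightarrow> (word \<Rightarrow>\<^sub>0 'a) set set \<Rightarrow> (word \<Rightarrow>\<^sub>0 'a) set set \<Rightarrow>
    ((word \<Rightarrow>\<^sub>0 'a) set \<Rightarrow> (word \<Rightarrow>\<^sub>0 'a) set) set" where
  "right_hom n q M N = {f \<in> M \<rightarrow>\<^sub>E N.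
     (\<forall>x\<in>M. \<forall>y\<in>M. f (x \<oplus>\<^bsub>hecke n q\<^esub> y) = f x \<oplus>\<^bsub>hecke n q\<^esub> f y) \<and>
     (\<forall>x\<in>M. \<forall>h\<in>carrier (hecke n q). f (x \<otimes>\<^bsub>hecke n q\<^esub> h) = f x \<otimes>\<^bsub>hecke n q\<^esub> h)}"

definition double_coset ::
    "nat \<Rightarrow> (nat \<Rightarrow> nat) \<Rightarrow> (nat \<Rightarrow> nat) \<Rightarrow> (nat \<Rightarrow> nat) \<Rightarrow> (nat \<Rightarrow> nat) set" where
  "double_coset n \<nu> d \<mu> = {v \<circ> d \<circ> u | u v. u \<in> young_subgroup n \<nu> \<and> v \<in> young_subgroup n \<mu>}"

definition phi :: "nat \<Rightarrow> 'a::field \<Rightarrow> (nat \<Rightarrow> nat) \<Rightarrow> (nat \<Rightarrow> nat) \<Rightarrow> (nat \<times> nat \<Rightarrow> nat) \<Rightarrow>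
    (word \<Rightarrow>\<^sub>0 'a) set \<Rightarrow> (word \<Rightarrow>\<^sub>0 'a) set" where
  "phi n q \<mu> \<nu> A = (THE f. f \<in> right_hom n q (perm_module n q \<mu>) (perm_module n q \<nu>) \<and>
     f (x_elt n q \<mu>) = (\<Oplus>\<^bsub>hecke n q\<^esub> w \<in> double_coset n \<nu> (perm_1 n \<mu> \<nu> A) \<mu>. T n q w))"

definition phi_hat :: "nat \<Rightarrow> 'a::field \<Rightarrow> (nat \<Rightarrow> nat) \<Rightarrow> (nat \<Rightarrow> nat) \<Rightarrow> (nat \<times> nat \<Rightarrow> nat) \<Rightarrow>
    (word \<Rightarrow>\<^sub>0 'a) set \<Rightarrow> (word \<Rightarrow>\<^sub>0 'a) set" where
  "phi_hat n q \<mu> \<nu> A = restrict (phi n q \<mu> \<nu> A) (specht_module n q \<mu>)"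

end

theory Submission
  imports Defs
begin

text \<open>
  The element \<open>x\<^sub>\<mu> \<phi>\<^sub>A\<close> is the sum of the \<open>T\<^sub>w\<close> over those \<open>w\<close> for which each row of the
  superscript tableau of \<open>\<mu>\<close> meets each row of that of \<open>\<lambda>\<close>, moved by \<open>w\<close>, in as many entries as \<open>A\<close>
  prescribes. Let \<open>H\<close> be the symmetric group on the entries in rows \<open>l, \<dots>, m\<close> of the former.
  Writing such a \<open>w\<close> as \<open>d z\<close> with \<open>z \<in> H\<close> and \<open>d\<close> of minimal length in its coset, the part of the
  condition that concerns the rows outside \<open>l, \<dots>, m\<close> involves \<open>d\<close> only, and the rest says exactly that
  \<open>z\<close> satisfies the condition for the shortened tableau. Hence
  \<open>x\<^sub>\<mu> \<phi>\<^sub>A = \<Theta> \<cdot> \<sigma>(x \<phi>)\<close> where \<open>\<sigma>\<close> shifts the generators, \<open>x \<phi>\<close> belongs to the shortened tableau and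
  \<open>\<Theta>\<close> depends only on the rows of \<open>A\<close> outside \<open>l, \<dots>, m\<close>. In the same way
  \<open>T\<^bsub>w\<^sub>\<mu>\<^esub> y\<^bsub>\<mu>'\<^esub> = \<sigma>(T y) g\<close>, with \<open>T y\<close> the corresponding element for the shortened partition,
  because the remaining factor of \<open>w\<^sub>\<mu>\<close> is increasing on the entries in rows \<open>l, \<dots>, m\<close> and so carries
  column stabilizers to column stabilizers. A linear relation between the shortened
  homomorphisms is therefore mapped to the required one by \<open>\<sigma>\<close> and multiplication by \<open>\<Theta>\<close> and \<open>g\<close>.
\<close>

section \<open>Inversions and reduced expressions\<close>

text \<open>The two sums are factored on opposite sides: the image of x_mu keeps the block factor on
  its right, the Specht generator on its left. The block factors then meet in the middle, where the
  given relation applies. The factor \<Theta> can be taken out of the linear combination only if it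
  is common to all A_i; this holds because the A_i have one type and agree outside the block, so
  that the shortened tableaux have one type too. The column group does not split over blocks of
  rows. From y one therefore first splits off, on the left, the sum over the permutations that
  preserve each column piece in rows l, ..., m and fix everything else; only this sum is moved past
  the T of the remaining factor of w_mu. Products of elements T_w can be merged only when lengths
  add, and each such step is an instance of one inversion count for shortest coset representatives.
  Equalities in the Hecke algebra are handled as congruences of noncommutative polynomials, on which
  the shift is a substitution of indices.\<close>

text \<open>The syntax of the library's \<open>inv\<close> is taken over by the inverse in a group.\<close>

abbreviation pinv :: "(nat \<Rightarrow> nat) \<Rightarrow> nat \<Rightarrow> nat" where
  "pinv w \<equiv> inv_into UNIV w"

definition invs :: "(nat \<Rightarrow> nat) \<Rightarrow> (nat \<times> nat) set" where
  "invs w = {(i, j). i < j \<and> w j < w i}"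

lemma invs_id [simp]: "invs id = {}" "invs (\<lambda>x. x) = {}"
  by (auto simp: invs_def)

lemma invs_subset:
  assumes "w permutes {1..n}"
  shows "invs w \<subseteq> {1..n} \<times> {1..n}"
proof clarify
  fix i j assume ij: "(i, j) \<in> invs w"
  have out: "w k = k" if "k \<notin> {1..n}" for k
    using assms that by (rule permutes_not_in)
  have ins: "w k \<in> {1..n}" if "k \<in> {1..n}" for k
    using assms that by (simp only: permutes_in_image)
  show "i \<in> {1..n} \<and> j \<in> {1..n}"
    using ij out[of i] out[of j] ins[of i] ins[of j] unfolding invs_def by fastforce
qed

lemma finite_invs: "w permutes {1..n} \<Longrightarrow> finite (invs w)"
  by (rule finite_subset[OF invs_subset]) auto

text \<open>An adjacent transposition reverses the order of just one pair of positions. It carries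
  the old inversions bijectively onto the new ones other than \<open>(i, Suc i)\<close>, and that
  pair becomes inverted because \<open>w\<close> was ascending there.\<close>

lemma card_invs_transpose_asc:
  assumes "finite (invs w)" "w i < w (Suc i)"
  shows "card (invs (w \<circ> transpose i (Suc i))) = Suc (card (invs w))"
proof -
  let ?s = "transpose i (Suc i)"
  have sl: "?s a < ?s b" if "a < b" "(a, b) \<noteq> (i, Suc i)" for a b
    using that by (auto simp: transpose_def)
  have eq: "invs (w \<circ> ?s) = insert (i, Suc i) (map_prod ?s ?s ` invs w)"
  proof (intro Set.set_eqI iffI)
    fix p assume p: "p \<in> invs (w \<circ> ?s)"
    obtain a b where ab: "p = (a, b)" by force
    show "p \<in> insert (i, Suc i) (map_prod ?s ?s ` invs w)"
    proof (cases "p = (i, Suc i)")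
      case False
      then have "(?s a, ?s b) \<in> invs w" using p sl[of a b] by (auto simp: invs_def ab)
      then have "map_prod ?s ?s (?s a, ?s b) \<in> map_prod ?s ?s ` invs w" by (rule imageI)
      then show ?thesis by (simp add: ab)
    qed auto
  next
    fix p assume "p \<in> insert (i, Suc i) (map_prod ?s ?s ` invs w)"
    then show "p \<in> invs (w \<circ> ?s)"
    proof
      assume "p = (i, Suc i)"
      then show ?thesis using assms(2) by (simp add: invs_def)
    next
      assume "p \<in> map_prod ?s ?s ` invs w"
      then obtain a b where ab: "(a, b) \<in> invs w" "p = (?s a, ?s b)" by auto
      then have "(a, b) \<noteq> (i, Suc i)" using assms(2) by (auto simp: invs_def)
      then show ?thesis using ab sl[of a b] by (auto simp: invs_def)
    qed
  qed
  have notin: "(i, Suc i) \<notin> map_prod ?s ?s ` invs w"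
  proof
    assume "(i, Suc i) \<in> map_prod ?s ?s ` invs w"
    then obtain a b where ab: "(a, b) \<in> invs w" "i = ?s a" "Suc i = ?s b" by auto
    then have "a = Suc i" "b = i" by (auto simp: transpose_def split: if_splits)
    then show False using ab(1) by (simp add: invs_def)
  qed
  have "inj_on (map_prod ?s ?s) (invs w)"
    using inj_on_subset[OF map_prod_inj_on[OF inj_transpose inj_transpose]] by auto
  then show ?thesis unfolding eq using notin assms(1) by (simp add: card_image)
qed

lemma permutes_transpose_Suc:
  assumes "i \<in> {1..<n}"
  shows "transpose i (Suc i) permutes {1..n}"
  using assms by (intro permutes_swap_id) auto

lemma permutes_comp_transpose_Suc:
  assumes "w permutes {1..n}" "i \<in> {1..<n}"
  shows "w \<circ> transpose i (Suc i) permutes {1..n}"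
  by (intro permutes_compose permutes_transpose_Suc assms)

lemma card_invs_transpose_desc:
  assumes "w permutes {1..n}" "i \<in> {1..<n}" "w (Suc i) < w i"
  shows "card (invs w) = Suc (card (invs (w \<circ> transpose i (Suc i))))"
proof -
  let ?v = "w \<circ> transpose i (Suc i)"
  have "finite (invs ?v)" by (rule finite_invs[OF permutes_comp_transpose_Suc[OF assms(1,2)]])
  moreover have "?v i < ?v (Suc i)" using assms(3) by simp
  ultimately have "card (invs (?v \<circ> transpose i (Suc i))) = Suc (card (invs ?v))"
    by (rule card_invs_transpose_asc)
  then show ?thesis by (simp add: comp_assoc)
qed

lemma permutes_comp_transpose_cases:
  assumes "w permutes {1..n}" "i \<in> {1..<n}"
  obtains (asc) "w i < w (Suc i)" "card (invs (w \<circ> transpose i (Suc i))) = Suc (card (invs w))"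
    | (desc) "w (Suc i) < w i" "card (invs w) = Suc (card (invs (w \<circ> transpose i (Suc i))))"
proof -
  have "w i \<noteq> w (Suc i)" using permutes_inj[OF assms(1)] by (metis injD n_not_Suc_n)
  then consider "w i < w (Suc i)" | "w (Suc i) < w i" by linarith
  then show ?thesis
  proof cases
    case 1
    then show ?thesis by (intro asc card_invs_transpose_asc finite_invs[OF assms(1)])
  next
    case 2
    show ?thesis by (rule desc[OF 2 card_invs_transpose_desc[OF assms 2]])
  qed
qed

section \<open>Words in adjacent transpositions and their lengths\<close>

lemma perm_of_word_append: "perm_of_word (u @ v) = perm_of_word v \<circ> perm_of_word u"
  by (induction u) (simp_all add: comp_assoc)

lemma perm_of_word_permutes:
  "set is \<subseteq> {1..<n} \<Longrightarrow> perm_of_word is permutes {1..n}"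
proof (induction "is")
  case (Cons i "is")
  then show ?case using permutes_comp_transpose_Suc[of "perm_of_word is" n i] by (simp add: o_def)
qed (simp add: permutes_id)

lemma card_invs_perm_of_word: "set is \<subseteq> {1..<n} \<Longrightarrow> card (invs (perm_of_word is)) \<le> length is"
proof (induction "is")
  case Nil
  then show ?case by simp
next
  case (Cons i "is")
  have "perm_of_word is permutes {1..n}" "i \<in> {1..<n}"
    using Cons.prems perm_of_word_permutes[of "is" n] by auto
  then show ?case
    by (cases rule: permutes_comp_transpose_cases) (use Cons in \<open>auto simp: o_def\<close>)
qed

text \<open>The list of values is strictly increasing with the same elements as
  \<open>[1..<Suc n]\<close>, and a finite set has only one strictly increasing enumeration.\<close>

lemma permutes_no_invs:
  assumes "w permutes {1..n}" "\<And>i. i \<in> {1..<n} \<Longrightarrow> w i < w (Suc i)"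
  shows "w = id"
proof -
  have mono: "w i < w j" if "1 \<le> i" "i < j" "j \<le> n" for i j
    using that(2,3)
  proof (induction j)
    case (Suc j)
    then show ?case using assms(2)[of j] that(1) by (cases "i = j") (auto intro: less_trans)
  qed simp
  have "sorted_wrt (<) (map w [1..<Suc n])"
    by (auto simp: sorted_wrt_iff_nth_less nth_append intro!: mono simp del: upt_Suc)
  moreover have "sorted_wrt (<) [1..<Suc n]" by (simp del: upt_Suc)
  moreover have "set (map w [1..<Suc n]) = set [1..<Suc n]"
    using permutes_image[OF assms(1)] by (auto simp: atLeastLessThanSuc_atLeastAtMost simp del: upt_Suc)
  ultimately have "map w [1..<Suc n] = [1..<Suc n]"
    using strict_sorted_equal by metis
  then have "w i = i" if "i \<in> {1..n}" for i
    using that map_eq_conv[of w "[1..<Suc n]" id] by (auto simp del: upt_Suc)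
  moreover have "w i = i" if "i \<notin> {1..n}" for i using permutes_not_in[OF assms(1) that] .
  ultimately show ?thesis by (metis eq_id_iff)
qed

text \<open>Bubble sort: as long as \<open>w\<close> is not the identity it has a descent, and
  composing with that transposition lowers the inversion count by one at the cost of one
  letter.\<close>

lemma ex_expression_card_invs:
  assumes "w permutes {1..n}"
  shows "\<exists>is. expression n w is \<and> length is = card (invs w)"
  using assms
proof (induction "card (invs w)" arbitrary: w)
  case 0
  then have e: "invs w = {}" using finite_invs by simp
  have "w = id"
  proof (rule permutes_no_invs[OF "0.prems"])
    fix i assume i: "i \<in> {1..<n}"
    have "w i \<noteq> w (Suc i)" using permutes_inj[OF "0.prems"] by (metis injD n_not_Suc_n)
    moreover have "(i, Suc i) \<notin> invs w" using e by simp
    ultimately show "w i < w (Suc i)" by (simp add: invs_def)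
  qed
  then show ?case using e by (intro exI[of _ "[]"]) (auto simp: expression_def)
next
  case (Suc k)
  have "\<exists>i\<in>{1..<n}. \<not> w i < w (Suc i)"
  proof (rule ccontr)
    assume "\<not> ?thesis"
    then have "w = id" by (intro permutes_no_invs[OF Suc.prems]) auto
    then show False using Suc.hyps(2) by simp
  qed
  then obtain i where i: "i \<in> {1..<n}" "\<not> w i < w (Suc i)" by auto
  then have c: "card (invs w) = Suc (card (invs (w \<circ> transpose i (Suc i))))"
    using permutes_comp_transpose_cases[OF Suc.prems i(1)] by blast
  then obtain "is" where is1: "expression n (w \<circ> transpose i (Suc i)) is"
      and is2: "length is = card (invs (w \<circ> transpose i (Suc i)))"
    using Suc.hyps(1)[OF _ permutes_comp_transpose_Suc[OF Suc.prems i(1)]] Suc.hyps(2) by auto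
  then show ?case using i(1) c
    by (intro exI[of _ "i # is"]) (auto simp: expression_def comp_assoc)
qed

lemma coxeter_length_eq:
  assumes "w permutes {1..n}"
  shows "coxeter_length n w = card (invs w)"
  unfolding coxeter_length_def
  using ex_expression_card_invs[OF assms] card_invs_perm_of_word[of _ n]
  by (intro Least_equality) (force simp: expression_def simp del: One_nat_def)+

text \<open>Replaces the minimum in the Coxeter length by the inversion count. That \<open>w\<close>
  permutes \<open>{1..n}\<close> is implicit on both sides, since \<open>w\<close> is the value of a
  word in the permitted letters.\<close>

lemma reduced_expression_iff:
  "reduced_expression n w is \<longleftrightarrow>
     set is \<subseteq> {1..<n} \<and> perm_of_word is = w \<and> length is = card (invs w)"
  using coxeter_length_eq perm_of_word_permutes
  by (auto simp: reduced_expression_def expression_def)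

lemma ex_reduced_expression:
  "w permutes {1..n} \<Longrightarrow> \<exists>is. reduced_expression n w is"
  using ex_expression_card_invs by (auto simp: reduced_expression_iff expression_def)

text \<open>If the first letter were an ascent of \<open>w\<close>, removing it would raise the
  inversion count, and the remaining letters would be too few to express the result.\<close>

lemma reduced_expression_ConsD:
  assumes "reduced_expression n w (i # is)"
  shows "i \<in> {1..<n}" "w permutes {1..n}" "w (Suc i) < w i"
    "reduced_expression n (w \<circ> transpose i (Suc i)) is"
proof -
  show i: "i \<in> {1..<n}" using assms by (auto simp: reduced_expression_iff)
  show w: "w permutes {1..n}" using assms perm_of_word_permutes unfolding reduced_expression_iff by blast
  have e: "perm_of_word is = w \<circ> transpose i (Suc i)"
    using assms by (auto simp: reduced_expression_iff comp_assoc)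
  have le: "card (invs (w \<circ> transpose i (Suc i))) \<le> length is"
    using card_invs_perm_of_word[of "is" n] assms unfolding e by (auto simp: reduced_expression_iff)
  have len: "Suc (length is) = card (invs w)" using assms by (auto simp: reduced_expression_iff)
  have "w (Suc i) < w i \<and> length is = card (invs (w \<circ> transpose i (Suc i)))"
    using w i by (cases rule: permutes_comp_transpose_cases) (use le len in auto)
  then show "w (Suc i) < w i" "reduced_expression n (w \<circ> transpose i (Suc i)) is"
    using assms e by (auto simp: reduced_expression_iff)
qed

lemma reduced_expression_ConsI:
  assumes "w permutes {1..n}" "i \<in> {1..<n}" "w (Suc i) < w i"
    "reduced_expression n (w \<circ> transpose i (Suc i)) is"
  shows "reduced_expression n w (i # is)"
  using assms card_invs_transpose_desc[OF assms(1-3)]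
  by (auto simp: reduced_expression_iff comp_assoc)

text \<open>
  Two distinct first letters of reduced words are descents of the permutation; hence it also has
  a reduced word starting with their commutation or braid relation, to which induction applies.
\<close>

lemma matsumoto:
  fixes f :: "nat list \<Rightarrow> 'b"
  assumes cons: "\<And>i u v. \<lbrakk>i \<in> {1..<n}; set u \<subseteq> {1..<n}; set v \<subseteq> {1..<n}; f u = f v\<rbrakk>
      \<Longrightarrow> f (i # u) = f (i # v)"
    and comm: "\<And>i j u. \<lbrakk>i \<in> {1..<n}; j \<in> {1..<n}; i + 2 \<le> j; set u \<subseteq> {1..<n}\<rbrakk>
      \<Longrightarrow> f (i # j # u) = f (j # i # u)"
    and braid: "\<And>i u. \<lbrakk>i \<in> {1..<n}; Suc i \<in> {1..<n}; set u \<subseteq> {1..<n}\<rbrakk>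
      \<Longrightarrow> f (i # Suc i # i # u) = f (Suc i # i # Suc i # u)"
    and "reduced_expression n w u" "reduced_expression n w v"
  shows "f u = f v"
  using assms(4,5)
proof (induction "length u" arbitrary: w u v)
  case 0
  then show ?case by (auto simp: reduced_expression_iff)
next
  case (Suc k)
  have IH: "f x = f y" if "reduced_expression n w' x" "reduced_expression n w' y" "length x = k"
    for w' x y using Suc.hyps(1) that by blast
  have red_set: "set x \<subseteq> {1..<n}" if "reduced_expression n w' x" for w' x
    using that by (simp add: reduced_expression_iff)
  have red_len: "length x = length y" if "reduced_expression n w' x" "reduced_expression n w' y"
    for w' x y using that by (simp add: reduced_expression_iff)
  have main: "f (i # x) = f (j # y)"
    if red: "reduced_expression n w (i # x)" "reduced_expression n w (j # y)"
      and len: "length x = k" and "i \<le> j" for i j x y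
  proof -
    let ?si = "transpose i (Suc i)" and ?sj = "transpose j (Suc j)"
    note R = reduced_expression_ConsD[OF red(1)] reduced_expression_ConsD[OF red(2)]
    have len': "length y = k" using red_len[OF red] len by simp
    have sets: "set x \<subseteq> {1..<n}" "set y \<subseteq> {1..<n}" using R(4,8) red_set by auto
    note wp = permutes_comp_transpose_Suc[OF R(2)]
    consider "i = j" | "i + 2 \<le> j" | "j = Suc i" using \<open>i \<le> j\<close> by linarith
    then show ?thesis
    proof cases
      case 1
      then have "f x = f y" using IH[OF R(4) _ len, of y] R(8) by simp
      then show ?thesis unfolding 1 using R(5) sets by (intro cons)
    next
      case 2
      have c: "?si \<circ> ?sj = ?sj \<circ> ?si"
        using 2 by (auto simp: fun_eq_iff transpose_def)
      obtain u where u: "reduced_expression n (w \<circ> ?si \<circ> ?sj) u"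
        using ex_reduced_expression permutes_comp_transpose_Suc[OF wp[OF R(1)] R(5)] by blast
      have jx: "reduced_expression n (w \<circ> ?si) (j # u)"
        using 2 R(1,3,5,7) u by (intro reduced_expression_ConsI wp) auto
      have iy: "reduced_expression n (w \<circ> ?sj) (i # u)"
        using 2 R(1,3,5,7) u c by (intro reduced_expression_ConsI wp) (auto simp: comp_assoc)
      have "f (i # x) = f (i # j # u)"
        using IH[OF R(4) jx len] R(1,5) sets red_set[OF u] by (intro cons) auto
      also have "\<dots> = f (j # i # u)" using R(1,5) 2 red_set[OF u] by (intro comm)
      also have "\<dots> = f (j # y)"
        using IH[OF R(8) iy len'] R(1,5) sets red_set[OF u] by (intro cons) auto
      finally show ?thesis .
    next
      case 3
      have c: "?si \<circ> ?sj \<circ> ?si = ?sj \<circ> ?si \<circ> ?sj"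
        using 3 by (auto simp: fun_eq_iff transpose_def)
      obtain u where u: "reduced_expression n (w \<circ> ?si \<circ> ?sj \<circ> ?si) u"
        using ex_reduced_expression
          permutes_comp_transpose_Suc[OF permutes_comp_transpose_Suc[OF wp[OF R(1)] R(5)] R(1)]
        by blast
      have u': "reduced_expression n (w \<circ> ?sj \<circ> ?si \<circ> ?sj) u"
        using u c by (metis comp_assoc)
      have jx: "reduced_expression n (w \<circ> ?si) (j # i # u)"
        using 3 R(1,3,5,7) u
        by (intro reduced_expression_ConsI wp permutes_comp_transpose_Suc) (auto simp: transpose_def)
      have iy: "reduced_expression n (w \<circ> ?sj) (i # j # u)"
        using 3 R(1,3,5,7) u'
        by (intro reduced_expression_ConsI wp permutes_comp_transpose_Suc) (auto simp: transpose_def)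
      have "f (i # x) = f (i # j # i # u)"
        using IH[OF R(4) jx len] R(1,5) sets red_set[OF u] by (intro cons) auto
      also have "\<dots> = f (j # i # j # u)" using R(1,5) 3 red_set[OF u] braid by simp
      also have "\<dots> = f (j # y)"
        using IH[OF R(8) iy len'] R(1,5) sets red_set[OF u] by (intro cons) auto
      finally show ?thesis .
    qed
  qed
  obtain i x where u: "u = i # x" using Suc.hyps(2) by (cases u) auto
  have "length u = length v" by (rule red_len) (use Suc.prems in auto)
  then obtain j y where v: "v = j # y" using u by (cases v) auto
  show ?case
  proof (cases "i \<le> j")
    case True
    show ?thesis unfolding u v
      by (rule main) (use True Suc.prems Suc.hyps(2) u v in simp_all)
  next
    case False
    have "f v = f u" unfolding u v
      by (rule main) (use False Suc.prems Suc.hyps(2) u v \<open>length u = length v\<close> in simp_all)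
    then show ?thesis by simp
  qed
qed

text \<open>An inversion of \<open>z \<circ> d\<close> is either one of \<open>d\<close> or a pair
  whose images under \<open>d\<close> form an inversion of \<open>z\<close>. By hypothesis the
  preimages under \<open>d\<close> of an inversion of \<open>z\<close> keep their order, so all of
  these occur and \<open>z\<close> undoes no inversion of \<open>d\<close>.\<close>

lemma card_invs_comp:
  assumes d: "d permutes {1..n}" and z: "z permutes {1..n}"
    and mono: "\<And>x y. (x, y) \<in> invs z \<Longrightarrow> pinv d x < pinv d y"
  shows "card (invs (z \<circ> d)) = card (invs d) + card (invs z)"
proof -
  let ?g = "map_prod (pinv d) (pinv d)"
  have dd: "pinv d (d x) = x" "d (pinv d x) = x" for x using permutes_inverses[OF d] by auto
  have eq: "invs (z \<circ> d) = invs d \<union> ?g ` invs z"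
  proof (intro Set.set_eqI iffI)
    fix p assume p: "p \<in> invs (z \<circ> d)"
    obtain i j where ij: "p = (i, j)" by force
    have le: "i < j" "z (d j) < z (d i)" using p by (auto simp: invs_def ij)
    have "d i \<noteq> d j" using le permutes_inj[OF d] by (metis injD less_irrefl)
    show "p \<in> invs d \<union> ?g ` invs z"
    proof (cases "d j < d i")
      case False
      then have "(d i, d j) \<in> invs z" using le \<open>d i \<noteq> d j\<close> by (auto simp: invs_def)
      then have "?g (d i, d j) \<in> ?g ` invs z" by (rule imageI)
      then show ?thesis by (simp add: dd ij)
    qed (use le ij in \<open>auto simp: invs_def\<close>)
  next
    fix p assume "p \<in> invs d \<union> ?g ` invs z"
    then show "p \<in> invs (z \<circ> d)"
    proof
      assume p: "p \<in> invs d"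
      obtain i j where ij: "p = (i, j)" by force
      have le: "i < j" "d j < d i" using p by (auto simp: invs_def ij)
      have "\<not> z (d i) < z (d j)"
      proof
        assume "z (d i) < z (d j)"
        then have "(d j, d i) \<in> invs z" using le by (simp add: invs_def)
        from mono[OF this] show False using le by (simp add: dd)
      qed
      moreover have "z (d i) \<noteq> z (d j)" using le permutes_inj[OF z] by (metis injD less_irrefl)
      ultimately show ?thesis using le by (auto simp: invs_def ij)
    next
      assume "p \<in> ?g ` invs z"
      then obtain x y where "p = (pinv d x, pinv d y)" "(x, y) \<in> invs z" by auto
      then show ?thesis using mono[of x y] by (auto simp: invs_def dd)
    qed
  qed
  have disj: "invs d \<inter> ?g ` invs z = {}"
    by (auto simp: invs_def dd)
  have "inj_on ?g (invs z)"
    using inj_on_subset[OF map_prod_inj_on[OF permutes_inj[OF permutes_inv[OF d]]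
        permutes_inj[OF permutes_inv[OF d]]]] by auto
  then show ?thesis
    unfolding eq using disj finite_invs[OF d] finite_invs[OF z]
    by (simp add: card_Un_disjoint card_image)
qed

section \<open>Convex colourings and coset representatives\<close>

text \<open>
  A colouring of \<open>{1..n}\<close> whose colour classes are intervals encodes a standard Young subgroup,
  including the trivial factors needed for blocks of rows and truncated columns.
\<close>

definition convex_col :: "nat \<Rightarrow> (nat \<Rightarrow> 'b) \<Rightarrow> bool" where
  "convex_col n c \<longleftrightarrow> (\<forall>x\<in>{1..n}. \<forall>y\<in>{1..n}. \<forall>z\<in>{1..n}. x \<le> y \<and> y \<le> z \<and> c x = c z \<longrightarrow> c y = c x)"

definition col_group :: "nat \<Rightarrow> (nat \<Rightarrow> 'b) \<Rightarrow> (nat \<Rightarrow> nat) set" where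
  "col_group n c = {z. z permutes {1..n} \<and> (\<forall>p\<in>{1..n}. c (z p) = c p)}"

text \<open>For a convex colouring these are the shortest elements of the cosets formed by the
  \<open>d \<circ> z\<close> with \<open>z\<close> in \<open>col_group n c\<close>.\<close>

definition col_increasing :: "nat \<Rightarrow> (nat \<Rightarrow> 'b) \<Rightarrow> (nat \<Rightarrow> nat) \<Rightarrow> bool" where
  "col_increasing n c d \<longleftrightarrow> (\<forall>x\<in>{1..n}. \<forall>y\<in>{1..n}. x < y \<and> c x = c y \<longrightarrow> d x < d y)"

lemma col_group_permutes: "z \<in> col_group n c \<Longrightarrow> z permutes {1..n}"
  by (simp add: col_group_def)

lemma col_group_col: "z \<in> col_group n c \<Longrightarrow> p \<in> {1..n} \<Longrightarrow> c (z p) = c p"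
  by (simp add: col_group_def)

lemma id_col_group: "id \<in> col_group n c"
  by (simp add: col_group_def permutes_id)

lemma comp_col_group: "z \<in> col_group n c \<Longrightarrow> u \<in> col_group n c \<Longrightarrow> z \<circ> u \<in> col_group n c"
  unfolding col_group_def using permutes_in_image[of u "{1..n}"]
  by (auto simp only: mem_Collect_eq o_apply permutes_compose)

lemma inv_col_group: assumes "z \<in> col_group n c" shows "pinv z \<in> col_group n c"
proof -
  have z: "z permutes {1..n}" using assms by (rule col_group_permutes)
  have "c (pinv z p) = c p" if "p \<in> {1..n}" for p
    using col_group_col[OF assms, of "pinv z p"] that permutes_in_image[OF permutes_inv[OF z], of p]
      permutes_inverses(1)[OF z, of p] by auto
  then show ?thesis using permutes_inv[OF z] by (auto simp: col_group_def)
qed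

text \<open>The group moves points only inside intervals of one colour. If \<open>x < y\<close> are
  inverted, then \<open>y\<close> lies between \<open>x\<close> and \<open>z x\<close>, or else
  \<open>z x\<close> lies between \<open>z y\<close> and \<open>y\<close>; either way convexity
  identifies the colours.\<close>

lemma col_group_invs:
  assumes "convex_col n c" "z \<in> col_group n c" "(x, y) \<in> invs z"
  shows "c x = c y" "x \<in> {1..n}" "y \<in> {1..n}"
proof -
  have z: "z permutes {1..n}" using assms(2) by (rule col_group_permutes)
  have mem: "x \<in> {1..n}" "y \<in> {1..n}" using invs_subset[OF z] assms(3) by auto
  have zmem: "z x \<in> {1..n}" "z y \<in> {1..n}" using mem permutes_in_image[OF z] by auto
  have col: "c (z x) = c x" "c (z y) = c y" using col_group_col[OF assms(2)] mem by auto
  have lt: "x < y" "z y < z x" using assms(3) by (auto simp: invs_def)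
  have cv: "c b = c a" if "a \<in> {1..n}" "b \<in> {1..n}" "e \<in> {1..n}" "a \<le> b" "b \<le> e" "c a = c e" for a b e
    using assms(1) that unfolding convex_col_def by blast
  show "c x = c y"
  proof (cases "y \<le> z x")
    case True
    then show ?thesis using cv[of x y "z x"] mem zmem lt col by auto
  next
    case False
    then show ?thesis using cv[of "z y" "z x" y] mem zmem lt col by auto
  qed
  show "x \<in> {1..n}" "y \<in> {1..n}" by fact+
qed

text \<open>The order hypothesis of \<open>card_invs_comp\<close> for \<open>z \<circ> d\<close>: an
  inversion of \<open>z\<close> joins points of one colour, and on those \<open>pinv d\<close> is
  increasing.\<close>

lemma col_group_invs_right:
  assumes "convex_col n c" "z \<in> col_group n c" "col_increasing n c (pinv d)" "(x, y) \<in> invs z"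
  shows "pinv d x < pinv d y"
  using col_group_invs[OF assms(1,2,4)] assms(3,4) by (auto simp: col_increasing_def invs_def)

text \<open>Here the roles are exchanged: an inversion of \<open>d\<close> must join different
  colours, and the colour group never inverts such a pair.\<close>

lemma col_group_invs_left:
  assumes c: "convex_col n c" and z: "z \<in> col_group n c" and d: "d permutes {1..n}"
    and inc: "col_increasing n c d" and xy: "(x, y) \<in> invs d"
  shows "pinv z x < pinv z y"
proof -
  have mem: "x \<in> {1..n}" "y \<in> {1..n}" using invs_subset[OF d] xy by auto
  have lt: "x < y" "d y < d x" using xy by (auto simp: invs_def)
  have ne: "c x \<noteq> c y" using inc mem lt unfolding col_increasing_def by fastforce
  have "\<not> pinv z y < pinv z x"
  proof
    assume "pinv z y < pinv z x"
    then have "(x, y) \<in> invs (pinv z)" using lt by (simp add: invs_def)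
    from col_group_invs(1)[OF c inv_col_group[OF z] this] ne show False by simp
  qed
  moreover have "pinv z x \<noteq> pinv z y"
    using lt permutes_inj[OF permutes_inv[OF col_group_permutes[OF z]]] by (metis injD less_irrefl)
  ultimately show ?thesis by linarith
qed

text \<open>Take an element with fewest inversions in the coset. A descent between neighbours of one
  colour could be removed by a transposition from the group, so there are only ascents, and
  convexity chains them along each colour class.\<close>

lemma ex_col_increasing:
  assumes c: "convex_col n c" and w: "w permutes {1..n}"
  obtains d z where "d permutes {1..n}" "col_increasing n c d" "z \<in> col_group n c" "w = d \<circ> z"
proof -
  define P where "P z \<longleftrightarrow> z \<in> col_group n c" for z
  define f where "f z = card (invs (w \<circ> z))" for z
  obtain z where z: "P z" and min: "\<And>u. P u \<Longrightarrow> f z \<le> f u"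
    using ex_has_least_nat[of P id f] id_col_group[of n c] by (auto simp: P_def)
  have zg: "z \<in> col_group n c" using z by (simp add: P_def)
  define d where "d = w \<circ> z"
  have d: "d permutes {1..n}"
    unfolding d_def by (intro permutes_compose col_group_permutes[OF zg] w)
  have adj: "d x < d (Suc x)" if x: "x \<in> {1..<n}" "c x = c (Suc x)" for x
    using d x(1)
  proof (cases rule: permutes_comp_transpose_cases)
    case desc
    have "transpose x (Suc x) \<in> col_group n c"
      using x permutes_transpose_Suc[OF x(1)] by (auto simp: col_group_def transpose_def)
    then have "P (z \<circ> transpose x (Suc x))" using zg by (simp add: P_def comp_col_group)
    from min[OF this] desc show ?thesis by (simp add: f_def d_def comp_assoc)
  qed simp
  have "d x < d y" if "x < y" "x \<in> {1..n}" "y \<in> {1..n}" "c x = c y" for x y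
    using that
  proof (induction y)
    case (Suc y)
    show ?case
    proof (cases "x = y")
      case True
      then show ?thesis using adj[of x] Suc.prems by auto
    next
      case False
      have "y \<in> {1..n}" "x \<le> y" "y \<le> Suc y" using False Suc.prems by auto
      then have "c y = c x" using c Suc.prems unfolding convex_col_def by blast
      then show ?thesis using Suc.IH adj[of y] Suc.prems False by auto
    qed
  qed simp
  then have inc: "col_increasing n c d" by (auto simp: col_increasing_def)
  have "w = d \<circ> pinv z"
    using permutes_inv_o(1)[OF col_group_permutes[OF zg]] by (simp add: d_def comp_assoc)
  with d inc inv_col_group[OF zg] show ?thesis by (rule that)
qed

text \<open>Two decompositions differ by an element \<open>u\<close> of the group with
  \<open>d = d' \<circ> u\<close>. A descent of \<open>u\<close> would join equal colours, on which
  \<open>d\<close> and \<open>d'\<close> are both increasing, a contradiction; so \<open>u\<close>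
  is the identity.\<close>

lemma col_increasing_unique:
  assumes c: "convex_col n c" and "d permutes {1..n}" "d' permutes {1..n}"
    "col_increasing n c d" "col_increasing n c d'"
    and "z \<in> col_group n c" "z' \<in> col_group n c" "d \<circ> z = d' \<circ> z'"
  shows "d = d'" "z = z'"
proof -
  note zp = col_group_permutes[OF assms(6)] col_group_permutes[OF assms(7)]
  define u where "u = z' \<circ> pinv z"
  have ug: "u \<in> col_group n c"
    unfolding u_def by (intro comp_col_group inv_col_group assms(6,7))
  have up: "u permutes {1..n}" using ug by (rule col_group_permutes)
  have du: "d = d' \<circ> u"
    using assms(8) permutes_inv_o(1)[OF zp(1)] by (metis u_def comp_assoc comp_id)
  have "u = id"
  proof (rule permutes_no_invs[OF up])
    fix i assume i: "i \<in> {1..<n}"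
    show "u i < u (Suc i)"
      using up i
    proof (cases rule: permutes_comp_transpose_cases)
      case desc
      then have iv: "(i, Suc i) \<in> invs u" by (simp add: invs_def)
      note C = col_group_invs[OF c ug iv]
      have m: "u i \<in> {1..n}" "u (Suc i) \<in> {1..n}" using C permutes_in_image[OF up] by auto
      have "d i < d (Suc i)" using assms(4) C by (auto simp: col_increasing_def)
      moreover have "d' (u (Suc i)) < d' (u i)"
        using assms(5) C desc(1) m col_group_col[OF ug] by (auto simp: col_increasing_def)
      ultimately show ?thesis by (simp add: du)
    qed simp
  qed
  then show "d = d'" using du by simp
  have "u \<circ> z = z'" unfolding u_def using permutes_inv_o(2)[OF zp(1)] by (simp add: comp_assoc)
  then show "z = z'" using \<open>u = id\<close> by simp
qed

declare One_nat_def [simp del]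

section \<open>Congruence in the free algebra\<close>

abbreviation fcarrier :: "nat \<Rightarrow> (word \<Rightarrow>\<^sub>0 'a::field) set" where
  "fcarrier n \<equiv> carrier (free_algebra n)"

lemma free_algebra_ops:
  "x \<otimes>\<^bsub>free_algebra n\<^esub> y = x * y" "x \<oplus>\<^bsub>free_algebra n\<^esub> y = x + y"
  "\<one>\<^bsub>free_algebra n\<^esub> = 1" "\<zero>\<^bsub>free_algebra n\<^esub> = 0"
  by (simp_all add: free_algebra_def)

lemma mult_fcarrier [intro]: "x \<in> fcarrier n \<Longrightarrow> y \<in> fcarrier n \<Longrightarrow> x * y \<in> fcarrier n"
  using ring.ring_simprules(5)[OF ring_free_algebra, of x n y] by (simp add: free_algebra_ops)

lemma add_fcarrier [intro]: "x \<in> fcarrier n \<Longrightarrow> y \<in> fcarrier n \<Longrightarrow> x + y \<in> fcarrier n"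
  using ring.ring_simprules(1)[OF ring_free_algebra, of x n y] by (simp add: free_algebra_ops)

lemma uminus_fcarrier [intro]: "x \<in> fcarrier n \<Longrightarrow> - x \<in> fcarrier n"
  by (simp add: free_algebra_def)

lemma one_fcarrier [intro, simp]: "1 \<in> fcarrier n"
  using ring.ring_simprules(6)[OF ring_free_algebra] by (metis free_algebra_ops(3))

lemma zero_fcarrier [intro, simp]: "0 \<in> fcarrier n"
  by (simp add: free_algebra_def)

lemma sum_fcarrier [intro]: "(\<And>i. i \<in> S \<Longrightarrow> f i \<in> fcarrier n) \<Longrightarrow> sum f S \<in> fcarrier n"
  by (induction S rule: infinite_finite_induct) auto

lemma free_algebra_minus:
  assumes "x \<in> fcarrier n" "y \<in> fcarrier n"
  shows "x \<ominus>\<^bsub>free_algebra n\<^esub> y = x - y"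
proof -
  interpret R: ring "free_algebra n :: (word \<Rightarrow>\<^sub>0 'a) ring" by (rule ring_free_algebra)
  have "\<ominus>\<^bsub>free_algebra n\<^esub> y = - y"
    using R.minus_equality[of "- y" y] assms(2) by (auto simp: free_algebra_ops)
  then show ?thesis by (simp add: R.minus_eq free_algebra_ops)
qed

lemma const_fcarrier [intro, simp]: "const c \<in> fcarrier n"
  by (rule const_carrier)

lemma const_mult: "const (a * b) = const a * const b"
  by (simp add: const_def mult_single)

lemma const_1 [simp]: "const 1 = 1"
  by (simp add: const_def)

text \<open>Additive statements can thus be checked on monomials. An update at a key outside the
  support is the addition of a monomial.\<close>

lemma poly_mapping_add_induct [case_names single add]:
  assumes single: "\<And>k v. P (Poly_Mapping.single k v)"
    and add: "\<And>p p'. P p \<Longrightarrow> P p' \<Longrightarrow> P (p + p')"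
  shows "P (p :: 'b \<Rightarrow>\<^sub>0 'c::comm_monoid_add)"
proof (induction p rule: Poly_Mapping.update_induct)
  case const
  show ?case using single[of undefined 0] by simp
next
  case (update f a b)
  have "Poly_Mapping.update a b f = f + Poly_Mapping.single a b"
    using update(1) by (intro poly_mapping_eqI)
      (auto simp: lookup_add lookup_single lookup_update in_keys_iff when_def)
  then show ?case using add[OF update(3) single] by simp
qed

text \<open>A scalar sits on the empty word, the unit for concatenation, and coefficients
  commute.\<close>

lemma const_commute: "const c * p = p * const c"
proof (induction p rule: poly_mapping_add_induct)
  case (single k v)
  then show ?case by (simp add: const_def mult_single mult.commute)
next
  case (add p1 p2)
  then show ?case by (simp add: algebra_simps)
qed

definition wp :: "nat list \<Rightarrow> (word \<Rightarrow>\<^sub>0 'a::field)" where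
  "wp u = Poly_Mapping.single (Word u) 1"

lemma wp_Nil [simp]: "wp [] = 1"
  by (simp add: wp_def flip: zero_word_def)

lemma wp_append: "wp (u @ v) = wp u * wp v"
  by (simp add: wp_def mult_single plus_word_def)

lemma wp_Cons: "wp (i # u) = gen i * wp u"
  using wp_append[of "[i]" u] by (simp add: wp_def gen_def)

lemma wp_fcarrier [intro]: "set u \<subseteq> {1..<n} \<Longrightarrow> wp u \<in> fcarrier n"
  by (auto simp: wp_def free_algebra_def)

lemma gen_fcarrier [intro]: "i \<in> {1..<n} \<Longrightarrow> gen i \<in> fcarrier n"
  by (rule gen_carrier) auto

text \<open>Working with representatives keeps the type class ring operations available;
  \<open>hclass_eq_iff\<close> translates back to the quotient for elements of the carrier.\<close>

definition hcong :: "nat \<Rightarrow> 'a::field \<Rightarrow> (word \<Rightarrow>\<^sub>0 'a) \<Rightarrow> (word \<Rightarrow>\<^sub>0 'a) \<Rightarrow> bool" where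
  "hcong n q p p' \<longleftrightarrow> p - p' \<in> hecke_ideal n q"

lemma hecke_ideal_props:
  shows "0 \<in> hecke_ideal n q"
    and "x \<in> hecke_ideal n q \<Longrightarrow> y \<in> hecke_ideal n q \<Longrightarrow> x + y \<in> hecke_ideal n q"
    and "x \<in> hecke_ideal n q \<Longrightarrow> - x \<in> hecke_ideal n q"
    and "x \<in> hecke_ideal n q \<Longrightarrow> a \<in> fcarrier n \<Longrightarrow> a * x \<in> hecke_ideal n q"
    and "x \<in> hecke_ideal n q \<Longrightarrow> a \<in> fcarrier n \<Longrightarrow> x * a \<in> hecke_ideal n q"
proof -
  interpret I: ideal "hecke_ideal n q" "free_algebra n" by (rule ideal_hecke_ideal)
  show "0 \<in> hecke_ideal n q" 
    using additive_subgroup.zero_closed[OF ideal.axioms(1)[OF ideal_hecke_ideal[of n q]]]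
    unfolding free_algebra_ops .
  show "x + y \<in> hecke_ideal n q" if "x \<in> hecke_ideal n q" "y \<in> hecke_ideal n q"
    using additive_subgroup.a_closed[OF ideal.axioms(1)[OF ideal_hecke_ideal] that] by (simp add: free_algebra_ops)
  show l: "a * x \<in> hecke_ideal n q" if "x \<in> hecke_ideal n q" "a \<in> fcarrier n" for a
    using I.I_l_closed[OF that] by (simp add: free_algebra_ops)
  show "x * a \<in> hecke_ideal n q" if "x \<in> hecke_ideal n q" "a \<in> fcarrier n"
    using I.I_r_closed[OF that] by (simp add: free_algebra_ops)
  show "- x \<in> hecke_ideal n q" if "x \<in> hecke_ideal n q"
    using l[OF that, of "-1"] by (simp add: uminus_fcarrier)
qed

lemma hcong_refl [intro, simp]: "hcong n q p p"
  by (simp add: hcong_def hecke_ideal_props(1))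

lemma hcong_sym: "hcong n q p p' \<Longrightarrow> hcong n q p' p"
  using hecke_ideal_props(3)[of "p - p'" n q] by (simp add: hcong_def)

lemma hcong_trans [trans]: "hcong n q p p' \<Longrightarrow> hcong n q p' p'' \<Longrightarrow> hcong n q p p''"
  using hecke_ideal_props(2)[of "p - p'" n q "p' - p''"] by (simp add: hcong_def)

lemma hcong_add: "hcong n q a b \<Longrightarrow> hcong n q a' b' \<Longrightarrow> hcong n q (a + a') (b + b')"
  using hecke_ideal_props(2)[of "a - b" n q "a' - b'"] by (simp add: hcong_def algebra_simps)

lemma hcong_sum: "(\<And>i. i \<in> S \<Longrightarrow> hcong n q (f i) (g i)) \<Longrightarrow> hcong n q (sum f S) (sum g S)"
  by (induction S rule: infinite_finite_induct) (auto intro: hcong_add)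

text \<open>From a a' - b b' = (a - b) a' + b (a' - b'); this explains why it is \<open>b\<close>
  and \<open>a'\<close> that have to lie in the carrier.\<close>

lemma hcong_mult:
  assumes "hcong n q a b" "hcong n q a' b'" "b \<in> fcarrier n" "a' \<in> fcarrier n"
  shows "hcong n q (a * a') (b * b')"
proof -
  have "(a - b) * a' + b * (a' - b') \<in> hecke_ideal n q"
    using assms by (intro hecke_ideal_props) (auto simp: hcong_def)
  then show ?thesis by (simp add: hcong_def algebra_simps)
qed

lemma hcong_mult_left:
  "hcong n q a b \<Longrightarrow> x \<in> fcarrier n \<Longrightarrow> hcong n q (x * a) (x * b)"
  using hecke_ideal_props(4)[of "a - b" n q x] by (simp add: hcong_def algebra_simps)

lemma hcong_mult_right:
  "hcong n q a b \<Longrightarrow> x \<in> fcarrier n \<Longrightarrow> hcong n q (a * x) (b * x)"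
  using hecke_ideal_props(5)[of "a - b" n q x] by (simp add: hcong_def algebra_simps)

lemma hecke_relator_cong: "p - p' \<in> hecke_relators n q \<Longrightarrow> hcong n q p p'"
  unfolding hcong_def hecke_ideal_def
  using ring.genideal_self[OF ring_free_algebra hecke_relators_carrier] by blast

lemma hclass_eq_iff:
  assumes "p \<in> fcarrier n" "p' \<in> fcarrier n"
  shows "hclass n q p = hclass n q p' \<longleftrightarrow> hcong n q p p'"
  using ring.quotient_eq_iff_same_a_r_cos[OF ring_free_algebra ideal_hecke_ideal[of n q] assms]
  by (simp add: hclass_def hcong_def free_algebra_minus[OF assms])

lemma hclass_carrier [intro]: "p \<in> fcarrier n \<Longrightarrow> hclass n q p \<in> carrier (hecke n q)"
  using ring_hom_closed[OF ideal.rcos_ring_hom[OF ideal_hecke_ideal]]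
  by (simp add: hecke_def hclass_def)

lemma hecke_carrierE:
  assumes "x \<in> carrier (hecke n q)"
  obtains p where "p \<in> fcarrier n" "x = hclass n q p"
  using assms by (auto simp: hecke_def hclass_def FactRing_def A_RCOSETS_def')

lemma hclass_mult:
  "x \<in> fcarrier n \<Longrightarrow> y \<in> fcarrier n \<Longrightarrow>
    hclass n q (x * y) = hclass n q x \<otimes>\<^bsub>hecke n q\<^esub> hclass n q y"
  using ring_hom_mult[OF ideal.rcos_ring_hom[OF ideal_hecke_ideal[of n q]], of x y]
  by (simp add: hecke_def hclass_def free_algebra_ops)

lemma hclass_add:
  "x \<in> fcarrier n \<Longrightarrow> y \<in> fcarrier n \<Longrightarrow>
    hclass n q (x + y) = hclass n q x \<oplus>\<^bsub>hecke n q\<^esub> hclass n q y"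
  using ring_hom_add[OF ideal.rcos_ring_hom[OF ideal_hecke_ideal[of n q]], of x y]
  by (simp add: hecke_def hclass_def free_algebra_ops)

lemma hclass_one: "hclass n q 1 = \<one>\<^bsub>hecke n q\<^esub>"
  using ring_hom_one[OF ideal.rcos_ring_hom[OF ideal_hecke_ideal[of n q]]]
  by (simp add: hecke_def hclass_def free_algebra_ops)

lemma hclass_zero: "hclass n q 0 = \<zero>\<^bsub>hecke n q\<^esub>"
  using ring_hom_zero[OF ideal.rcos_ring_hom[OF ideal_hecke_ideal[of n q]] ring_free_algebra]
    ring_hecke[of n q]
  by (simp add: hecke_def hclass_def free_algebra_ops)

lemma hclass_sum:
  assumes "\<And>i. i \<in> S \<Longrightarrow> f i \<in> fcarrier n"
  shows "hclass n q (sum f S) = (\<Oplus>\<^bsub>hecke n q\<^esub> i \<in> S. hclass n q (f i))"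
proof -
  interpret R: ring "hecke n q" by (rule ring_hecke)
  show ?thesis using assms
  proof (induction S rule: infinite_finite_induct)
    case (insert x S)
    have "sum f S \<in> fcarrier n" using insert by (intro sum_fcarrier) auto
    then show ?case using insert by (simp add: hclass_add R.finsum_insert Pi_def hclass_carrier)
  qed (simp_all add: hclass_zero R.finsum_infinite)
qed

lemma hscale_hclass: "p \<in> fcarrier n \<Longrightarrow> hscale n q c (hclass n q p) = hclass n q (const c * p)"
  by (simp add: hscale_def hclass_mult)

section \<open>The elements \<open>T\<^sub>w\<close>\<close>

lemma reduced_expression_set: "reduced_expression n w u \<Longrightarrow> set u \<subseteq> {1..<n}"
  by (simp add: reduced_expression_iff)

text \<open>The word chosen here is the one chosen in \<open>T\<close>, so \<open>T_eq\<close> holds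
  by construction.\<close>

definition Tp :: "nat \<Rightarrow> (nat \<Rightarrow> nat) \<Rightarrow> (word \<Rightarrow>\<^sub>0 'a::field)" where
  "Tp n w = wp (SOME u. reduced_expression n w u)"

lemma some_reduced_expression:
  "w permutes {1..n} \<Longrightarrow> reduced_expression n w (SOME u. reduced_expression n w u)"
  using ex_reduced_expression by (rule someI_ex)

lemma Tp_fcarrier [intro]: "w permutes {1..n} \<Longrightarrow> Tp n w \<in> fcarrier n"
  unfolding Tp_def by (rule wp_fcarrier[OF reduced_expression_set[OF some_reduced_expression]])

lemma T_word_eq: "set u \<subseteq> {1..<n} \<Longrightarrow> T_word n q u = hclass n q (wp u)"
proof (induction u)
  case Nil
  then show ?case by (simp add: T_word_def hclass_one)
next
  case (Cons i u)
  then have "i \<in> {1..<n}" by simp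
  then show ?case using Cons
    by (simp add: T_word_def wp_Cons hclass_mult gen_fcarrier wp_fcarrier)
qed

lemma T_eq: "w permutes {1..n} \<Longrightarrow> T n q w = hclass n q (Tp n w)"
  using some_reduced_expression[of w n]
  by (simp add: T_def Tp_def T_word_eq reduced_expression_iff)

text \<open>Reads \<open>matsumoto\<close> in the quotient: the class of a word is compatible with
  prefixing letters, and the commutation and braid relators lie in the ideal.\<close>

lemma wp_reduced_cong:
  assumes "reduced_expression n w u" "reduced_expression n w v"
  shows "hcong n q (wp u) (wp v)"
proof -
  have "hclass n q (wp u) = hclass n q (wp v)"
  proof (rule matsumoto[where f = "\<lambda>u. hclass n q (wp u)", OF _ _ _ assms])
    fix i u v assume "i \<in> {1..<n}" "set u \<subseteq> {1..<n}" "set v \<subseteq> {1..<n}"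
      "hclass n q (wp u) = hclass n q (wp v)"
    then show "hclass n q (wp (i # u)) = hclass n q (wp (i # v))"
      by (simp add: wp_Cons hclass_mult gen_fcarrier wp_fcarrier)
  next
    fix i j u assume *: "i \<in> {1..<n}" "j \<in> {1..<n}" "i + 2 \<le> j" "set u \<subseteq> {1..<n}"
    have "gen i * gen j - gen j * gen i \<in> hecke_relators n q"
      using * by (auto simp: hecke_relators_def)
    then have "hcong n q (gen i * gen j * wp u) (gen j * gen i * wp u)"
      using * by (intro hcong_mult_right hecke_relator_cong) auto
    then show "hclass n q (wp (i # j # u)) = hclass n q (wp (j # i # u))"
      using * by (subst hclass_eq_iff) (auto simp: wp_Cons mult.assoc intro!: mult_fcarrier)
  next
    fix i u assume *: "i \<in> {1..<n}" "Suc i \<in> {1..<n}" "set u \<subseteq> {1..<n}"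
    have "gen i * gen (Suc i) * gen i - gen (Suc i) * gen i * gen (Suc i) \<in> hecke_relators n q"
      using * by (auto simp: hecke_relators_def simp flip: Suc_eq_plus1)
    then have "hcong n q (gen i * gen (Suc i) * gen i * wp u) (gen (Suc i) * gen i * gen (Suc i) * wp u)"
      using * by (intro hcong_mult_right hecke_relator_cong) auto
    then show "hclass n q (wp (i # Suc i # i # u)) = hclass n q (wp (Suc i # i # Suc i # u))"
      using * by (subst hclass_eq_iff) (auto simp: wp_Cons mult.assoc intro!: mult_fcarrier)
  qed
  then show ?thesis using assms by (simp add: hclass_eq_iff wp_fcarrier reduced_expression_iff)
qed

lemma Tp_cong_wp: "reduced_expression n w u \<Longrightarrow> hcong n q (Tp n w) (wp u)"
  unfolding Tp_def by (rule wp_reduced_cong[OF someI])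

text \<open>
  The weight \<open>e = 1\<close> gives \<open>x\<^sub>\<lambda>\<close> and \<open>e = - 1 / q\<close> gives \<open>y\<^sub>\<lambda>\<close>, so that both are treated at once.
\<close>

definition Te :: "nat \<Rightarrow> 'a::field \<Rightarrow> (nat \<Rightarrow> nat) \<Rightarrow> (word \<Rightarrow>\<^sub>0 'a)" where
  "Te n e w = const (e ^ card (invs w)) * Tp n w"

lemma Te_fcarrier [intro]: "w permutes {1..n} \<Longrightarrow> Te n e w \<in> fcarrier n"
  unfolding Te_def by auto

lemma Te_1: "Te n 1 w = Tp n w"
  by (simp add: Te_def)

text \<open>When lengths add, concatenated reduced words are reduced and the weights multiply. The
  factors are reversed because the left factor of a product is the permutation applied
  first.\<close>

lemma Te_mult:
  assumes d: "d permutes {1..n}" and z: "z permutes {1..n}"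
    and mono: "\<And>x y. (x, y) \<in> invs z \<Longrightarrow> pinv d x < pinv d y"
  shows "hcong n q (Te n e (z \<circ> d)) (Te n e d * Te n e z)"
proof -
  define u v where "u = (SOME u. reduced_expression n d u)" and "v = (SOME v. reduced_expression n z v)"
  have uv: "reduced_expression n d u" "reduced_expression n z v"
    using some_reduced_expression[OF d] some_reduced_expression[OF z] by (auto simp: u_def v_def)
  have len: "card (invs (z \<circ> d)) = card (invs d) + card (invs z)"
    by (rule card_invs_comp[OF d z mono])
  have "reduced_expression n (z \<circ> d) (u @ v)"
    using uv len by (simp add: reduced_expression_iff perm_of_word_append)
  then have "hcong n q (Tp n (z \<circ> d)) (wp (u @ v))" by (rule Tp_cong_wp)
  then have cong: "hcong n q (const (e ^ card (invs (z \<circ> d))) * Tp n (z \<circ> d))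
      (const (e ^ card (invs (z \<circ> d))) * (Tp n d * Tp n z))"
    by (intro hcong_mult_left) (auto simp: wp_append Tp_def u_def v_def)
  have "const (e ^ card (invs z)) * (Tp n d * Tp n z) = Tp n d * (const (e ^ card (invs z)) * Tp n z)"
    by (simp only: const_commute[of _ "Tp n d"] flip: mult.assoc)
  then have eq: "const (e ^ card (invs (z \<circ> d))) * (Tp n d * Tp n z) = Te n e d * Te n e z"
    unfolding len Te_def power_add const_mult mult.assoc by simp
  show ?thesis using cong unfolding eq unfolding Te_def .
qed

lemma Te_right:
  assumes "convex_col n c" "z \<in> col_group n c" "d permutes {1..n}" "col_increasing n c (pinv d)"
  shows "hcong n q (Te n e (z \<circ> d)) (Te n e d * Te n e z)"
  by (rule Te_mult[OF assms(3) col_group_permutes[OF assms(2)]]) (rule col_group_invs_right[OF assms(1,2,4)])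

lemma Te_left:
  assumes "convex_col n c" "z \<in> col_group n c" "d permutes {1..n}" "col_increasing n c d"
  shows "hcong n q (Te n e (d \<circ> z)) (Te n e z * Te n e d)"
  by (rule Te_mult[OF col_group_permutes[OF assms(2)] assms(3)]) (rule col_group_invs_left[OF assms])

definition Tsum :: "nat \<Rightarrow> 'a::field \<Rightarrow> (nat \<Rightarrow> nat) set \<Rightarrow> (word \<Rightarrow>\<^sub>0 'a)" where
  "Tsum n e D = (\<Sum>w\<in>D. Te n e w)"

lemma Tsum_fcarrier [intro]: "(\<And>w. w \<in> D \<Longrightarrow> w permutes {1..n}) \<Longrightarrow> Tsum n e D \<in> fcarrier n"
  unfolding Tsum_def by auto

lemma Tsum_col_group_fcarrier [intro]: "Tsum n e (col_group n c) \<in> fcarrier n"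
  by (intro Tsum_fcarrier col_group_permutes)

text \<open>\<open>D\<close> is a union of cosets of the colour group, each element is uniquely
  \<open>d \<circ> z\<close> with \<open>d\<close> a shortest representative, and lengths add. The
  lemma serves twice: it places the image of x_mu inside \<open>perm_module n q \<nu>\<close>, and
  it extracts a subgroup sum from \<open>yp\<close>.\<close>

lemma Tsum_left:
  assumes c: "convex_col n c" and perm: "\<And>w. w \<in> D \<Longrightarrow> w permutes {1..n}"
    and closed: "\<And>w z. w \<in> D \<Longrightarrow> z \<in> col_group n c \<Longrightarrow> w \<circ> z \<in> D"
  shows "\<exists>h\<in>fcarrier n. hcong n q (Tsum n e D) (Tsum n e (col_group n c) * h)"
proof -
  define E where "E = {d \<in> D. col_increasing n c d}"
  let ?f = "\<lambda>(z, d). d \<circ> z"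
  have inj: "inj_on ?f (col_group n c \<times> E)"
  proof (rule inj_onI, clarify)
    fix z d z' d' assume *: "z \<in> col_group n c" "d \<in> E" "z' \<in> col_group n c" "d' \<in> E" "d \<circ> z = d' \<circ> z'"
    then have "d permutes {1..n}" "d' permutes {1..n}" "col_increasing n c d" "col_increasing n c d'"
      by (auto simp: E_def intro: perm)
    from col_increasing_unique[OF c this *(1,3,5)] show "z = z' \<and> d = d'" by simp
  qed
  have img: "?f ` (col_group n c \<times> E) = D"
  proof (intro subset_antisym subsetI)
    fix w assume w: "w \<in> D"
    obtain d z where dz: "d permutes {1..n}" "col_increasing n c d" "z \<in> col_group n c" "w = d \<circ> z"
      using ex_col_increasing[OF c perm[OF w]] .
    have "d = w \<circ> pinv z"
      using dz(4) permutes_inv_o(1)[OF col_group_permutes[OF dz(3)]] by (simp add: comp_assoc)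
    then have "d \<in> E" using closed[OF w inv_col_group[OF dz(3)]] dz(2) by (simp add: E_def)
    then show "w \<in> ?f ` (col_group n c \<times> E)" using dz by (intro image_eqI[of _ _ "(z, d)"]) auto
  qed (auto simp: E_def intro: closed)
  have "Tsum n e D = (\<Sum>(z, d)\<in>col_group n c \<times> E. Te n e (d \<circ> z))"
    unfolding Tsum_def img[symmetric] by (subst sum.reindex[OF inj]) (simp add: case_prod_unfold)
  also have "hcong n q \<dots> (\<Sum>(z, d)\<in>col_group n c \<times> E. Te n e z * Te n e d)"
    by (intro hcong_sum) (auto simp: E_def intro!: Te_left[OF c] perm)
  also have "(\<Sum>(z, d)\<in>col_group n c \<times> E. Te n e z * Te n e d) = Tsum n e (col_group n c) * Tsum n e E"
    by (simp add: Tsum_def sum_product sum.cartesian_product)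
  finally show ?thesis
    by (intro bexI[of _ "Tsum n e E"]) (auto simp: E_def intro: perm)
qed

text \<open>\<open>Z\<close> may be any part of the colour group: for a block of rows it will be a
  set of permutations with prescribed row intersections, in general not a subgroup.\<close>

lemma Tsum_right_subset:
  assumes c: "convex_col n c" and Z: "Z \<subseteq> col_group n c"
    and E: "\<And>d. d \<in> E \<Longrightarrow> d permutes {1..n} \<and> col_increasing n c (pinv d)"
  shows "hcong n q (Tsum n e {z \<circ> d | z d. z \<in> Z \<and> d \<in> E}) (Tsum n e E * Tsum n e Z)"
proof -
  let ?f = "\<lambda>(d, z). z \<circ> d"
  have "inj_on ?f (E \<times> Z)"
  proof (rule inj_onI, clarify)
    fix d z d' z' assume *: "d \<in> E" "z \<in> Z" "d' \<in> E" "z' \<in> Z" "z \<circ> d = z' \<circ> d'"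
    have zp: "z permutes {1..n}" "z' permutes {1..n}" "d permutes {1..n}" "d' permutes {1..n}"
      using * Z E col_group_permutes by blast+
    \<comment> \<open>Inversion turns these products into those to which
      \<open>col_increasing_unique\<close> applies.\<close>
    have eq: "pinv d \<circ> pinv z = pinv d' \<circ> pinv z'"
      using *(5) zp by (metis o_inv_distrib permutes_bij)
    have "pinv d = pinv d' \<and> pinv z = pinv z'"
      using col_increasing_unique[OF c permutes_inv[OF zp(3)] permutes_inv[OF zp(4)] _ _
          inv_col_group inv_col_group eq] * Z E by blast
    then show "d = d' \<and> z = z'" by (metis zp permutes_inv_inv)
  qed
  moreover have "{z \<circ> d | z d. z \<in> Z \<and> d \<in> E} = ?f ` (E \<times> Z)" by force
  ultimately have "Tsum n e {z \<circ> d | z d. z \<in> Z \<and> d \<in> E} = (\<Sum>(d, z)\<in>E \<times> Z. Te n e (z \<circ> d))"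
    unfolding Tsum_def by (simp add: sum.reindex case_prod_unfold)
  also have "hcong n q \<dots> (\<Sum>(d, z)\<in>E \<times> Z. Te n e d * Te n e z)"
    using Z E by (intro hcong_sum) (auto intro!: Te_right[OF c])
  also have "(\<Sum>(d, z)\<in>E \<times> Z. Te n e d * Te n e z) = Tsum n e E * Tsum n e Z"
    by (simp add: Tsum_def sum_product sum.cartesian_product)
  finally show ?thesis .
qed

lemma ex_col_increasing_right:
  assumes c: "convex_col n c" and w: "w permutes {1..n}"
  obtains d z where "d permutes {1..n}" "col_increasing n c (pinv d)" "z \<in> col_group n c" "w = z \<circ> d"
proof -
  obtain d z where dz: "d permutes {1..n}" "col_increasing n c d" "z \<in> col_group n c" "pinv w = d \<circ> z"
    using ex_col_increasing[OF c permutes_inv[OF w]] .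
  have "w = pinv z \<circ> pinv d"
    using dz(4) by (metis w col_group_permutes dz(1,3) o_inv_distrib permutes_bij permutes_inv_inv)
  then show ?thesis
    using that[of "pinv d" "pinv z"] dz inv_col_group permutes_inv permutes_inv_inv by metis
qed

text \<open>The mirror image of \<open>Tsum_left\<close>; it exhibits the sum over a double coset as
  a left multiple of x_mu, from which the homomorphism is constructed.\<close>

lemma Tsum_right:
  assumes c: "convex_col n c" and perm: "\<And>w. w \<in> D \<Longrightarrow> w permutes {1..n}"
    and closed: "\<And>w z. w \<in> D \<Longrightarrow> z \<in> col_group n c \<Longrightarrow> z \<circ> w \<in> D"
  shows "\<exists>h\<in>fcarrier n. hcong n q (Tsum n e D) (h * Tsum n e (col_group n c))"
proof -
  define E where "E = {d \<in> D. col_increasing n c (pinv d)}"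
  have "{z \<circ> d | z d. z \<in> col_group n c \<and> d \<in> E} = D"
  proof (intro subset_antisym subsetI)
    fix w assume w: "w \<in> D"
    obtain d z where dz: "d permutes {1..n}" "col_increasing n c (pinv d)" "z \<in> col_group n c" "w = z \<circ> d"
      using ex_col_increasing_right[OF c perm[OF w]] .
    have "d = pinv z \<circ> w"
      using dz(4) permutes_inv_o(2)[OF col_group_permutes[OF dz(3)]] by (simp flip: comp_assoc)
    then have "d \<in> E" using closed[OF w inv_col_group[OF dz(3)]] dz(2) by (simp add: E_def)
    then show "w \<in> {z \<circ> d | z d. z \<in> col_group n c \<and> d \<in> E}" using dz by auto
  qed (auto simp: E_def intro: closed)
  with Tsum_right_subset[OF c subset_refl, of E q e] show ?thesis
    by (intro bexI[of _ "Tsum n e E"]) (auto simp: E_def intro: perm)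
qed

section \<open>Shifting the generators\<close>

definition shift_word :: "nat \<Rightarrow> word \<Rightarrow> word" where
  "shift_word a u = Word (map (\<lambda>i. a + i) (letters u))"

definition shift :: "nat \<Rightarrow> (word \<Rightarrow>\<^sub>0 'a::field) \<Rightarrow> (word \<Rightarrow>\<^sub>0 'a)" where
  "shift a p = (\<Sum>u\<in>Poly_Mapping.keys p. Poly_Mapping.single (shift_word a u) (Poly_Mapping.lookup p u))"

lemma shift_word_add: "shift_word a (u + v) = shift_word a u + shift_word a v"
  by (simp add: shift_word_def plus_word_def)

lemma shift_superset:
  assumes "finite S" "Poly_Mapping.keys p \<subseteq> S"
  shows "shift a p = (\<Sum>u\<in>S. Poly_Mapping.single (shift_word a u) (Poly_Mapping.lookup p u))"
  unfolding shift_def using assms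
  by (intro sum.mono_neutral_left) (auto simp: in_keys_iff)

lemma shift_add: "shift a (p + p') = shift a p + shift a p'"
  using Poly_Mapping.keys_add[of p p']
  by (simp add: shift_superset[of "Poly_Mapping.keys p \<union> Poly_Mapping.keys p'"] lookup_add single_add sum.distrib)

lemma shift_single: "shift a (Poly_Mapping.single u c) = Poly_Mapping.single (shift_word a u) c"
  by (simp add: shift_superset[of "{u}"])

lemma shift_zero [simp]: "shift a 0 = 0"
  by (simp add: shift_def)

lemma shift_uminus: "shift a (- p) = - shift a p"
  using shift_add[of a p "- p"] by (simp add: eq_neg_iff_add_eq_0 add.commute)

lemma shift_diff: "shift a (p - p') = shift a p - shift a p'"
  using shift_add[of a p "- p'"] by (simp add: shift_uminus)

lemma shift_sum: "shift a (sum f S) = (\<Sum>i\<in>S. shift a (f i))"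
  by (induction S rule: infinite_finite_induct) (simp_all add: shift_add)

lemma shift_mult: "shift a (p * p') = shift a p * shift a p'"
proof (induction p rule: poly_mapping_add_induct)
  case (single k v)
  show ?case
  proof (induction p' rule: poly_mapping_add_induct)
    case (single k' v')
    then show ?case by (simp add: mult_single shift_single shift_word_add)
  qed (simp add: shift_add algebra_simps)
qed (simp add: shift_add algebra_simps)

lemma shift_const [simp]: "shift a (const c) = const c"
  by (simp add: const_def shift_single shift_word_def zero_word_def)

lemma shift_one [simp]: "shift a 1 = 1"
  using shift_const[of a 1] by simp

lemma shift_wp: "shift a (wp u) = wp (map (\<lambda>i. a + i) u)"
  by (simp add: wp_def shift_single shift_word_def)

lemma shift_gen: "shift a (gen i) = gen (a + i)"
  by (simp add: gen_def shift_single shift_word_def)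

lemma shift_fcarrier [intro]:
  assumes "p \<in> fcarrier k" "a + k \<le> n"
  shows "shift a p \<in> fcarrier n"
  unfolding shift_def
proof (rule sum_fcarrier)
  fix u assume "u \<in> Poly_Mapping.keys p"
  then have "set (letters u) \<subseteq> {1..<k}" using assms(1) by (auto simp: free_algebra_def)
  then show "Poly_Mapping.single (shift_word a u) (Poly_Mapping.lookup p u) \<in> fcarrier n"
    using assms(2) by (auto simp: free_algebra_def shift_word_def split: if_splits)
qed

text \<open>The preimage of an ideal under the shift is an ideal, and it contains the relators
  because adding \<open>a\<close> to the indices turns each relator into one of the same kind;
  \<open>a + k \<le> n\<close> keeps the indices in range.\<close>

lemma shift_ideal:
  assumes "a + k \<le> n" "p \<in> hecke_ideal k q"
  shows "shift a p \<in> hecke_ideal n q"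
proof -
  interpret h: ring_hom_ring "free_algebra k" "free_algebra n" "shift a"
    by (rule ring_hom_ringI[OF ring_free_algebra ring_free_algebra])
       (use assms(1) in \<open>auto simp: free_algebra_ops shift_add shift_mult\<close>)
  have "ideal {r \<in> fcarrier k. shift a r \<in> hecke_ideal n q} (free_algebra k)"
    by (rule h.ideal_vimage[OF ideal_hecke_ideal])
  moreover have "shift a r \<in> hecke_relators n q" if "r \<in> hecke_relators k q" for r
    using that assms(1) unfolding hecke_relators_def
  proof (elim UnE CollectE exE conjE, goal_cases)
    case (1 i)
    then have "shift a r = (gen (a + i) - const q) * (gen (a + i) + 1) \<and> 1 \<le> a + i \<and> a + i < n"
      by (simp add: shift_mult shift_add shift_diff shift_gen)
    then show ?case by blast
  next
    case (2 i j)
    then have "shift a r = gen (a + i) * gen (a + j) - gen (a + j) * gen (a + i)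
        \<and> 1 \<le> a + i \<and> a + i + 2 \<le> a + j \<and> a + j < n"
      by (simp add: shift_mult shift_add shift_diff shift_gen)
    then show ?case by blast
  next
    case (3 i)
    then have "shift a r = gen (a + i) * gen (a + i + 1) * gen (a + i)
          - gen (a + i + 1) * gen (a + i) * gen (a + i + 1) \<and> 1 \<le> a + i \<and> a + i + 1 < n"
      by (simp add: shift_mult shift_add shift_diff shift_gen add.assoc)
    then show ?case by blast
  qed
  then have "hecke_relators k q \<subseteq> {r \<in> fcarrier k. shift a r \<in> hecke_ideal n q}"
    using hecke_relators_carrier[of k q]
      ring.genideal_self[OF ring_free_algebra hecke_relators_carrier, of n q]
    unfolding hecke_ideal_def by blast
  ultimately have "hecke_ideal k q \<subseteq> {r \<in> fcarrier k. shift a r \<in> hecke_ideal n q}"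
    unfolding hecke_ideal_def[of k] by (rule ring.genideal_minimal[OF ring_free_algebra])
  then show ?thesis using assms(2) by blast
qed

definition shift_perm :: "nat \<Rightarrow> nat \<Rightarrow> (nat \<Rightarrow> nat) \<Rightarrow> nat \<Rightarrow> nat" where
  "shift_perm a k w p = (if p \<in> {a + 1..a + k} then a + w (p - a) else p)"

lemma shift_perm_apply: "x \<in> {1..k} \<Longrightarrow> shift_perm a k w (a + x) = a + w x"
  by (simp add: shift_perm_def)

lemma shift_perm_outside: "p \<notin> {a + 1..a + k} \<Longrightarrow> shift_perm a k w p = p"
  by (simp only: shift_perm_def if_False)

lemma shift_interval: "(+) a ` {1..k} = {a + 1..a + (k::nat)}"
  by (simp add: image_add_atLeastAtMost)

lemma shift_perm_comp:
  assumes "w permutes {1..k}"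
  shows "shift_perm a k (v \<circ> w) = shift_perm a k v \<circ> shift_perm a k w"
proof
  fix p
  have "w (p - a) \<in> {1..k}" if "p \<in> {a + 1..a + k}"
    using that permutes_in_image[OF assms, of "p - a"] by auto
  then show "shift_perm a k (v \<circ> w) p = (shift_perm a k v \<circ> shift_perm a k w) p"
    by (auto simp: shift_perm_def)
qed

lemma shift_perm_id: "shift_perm a k id = id"
  by (auto simp: shift_perm_def)

lemma shift_perm_permutes:
  assumes "w permutes {1..k}" "a + k \<le> n"
  shows "shift_perm a k w permutes {a + 1..a + k}" "shift_perm a k w permutes {1..n}"
proof -
  have "bij (shift_perm a k w)"
  proof (rule o_bij)
    show "shift_perm a k (pinv w) \<circ> shift_perm a k w = id"
      using permutes_inv_o(2)[OF assms(1)] shift_perm_id by (metis assms(1) shift_perm_comp)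
    show "shift_perm a k w \<circ> shift_perm a k (pinv w) = id"
      using permutes_inv_o(1)[OF assms(1)] shift_perm_id
      by (metis assms(1) permutes_inv shift_perm_comp)
  qed
  then show m: "shift_perm a k w permutes {a + 1..a + k}"
    using shift_perm_outside by (auto simp: permutes_def bij_iff)
  show "shift_perm a k w permutes {1..n}"
    by (rule permutes_subset[OF m]) (use assms(2) in auto)
qed

lemma shift_perm_transpose:
  assumes "i \<in> {1..<k}"
  shows "shift_perm a k (transpose i (Suc i)) = transpose (a + i) (Suc (a + i))"
  using assms by (auto simp: shift_perm_def transpose_def fun_eq_iff)

lemma perm_of_word_shift:
  "set u \<subseteq> {1..<k} \<Longrightarrow> perm_of_word (map (\<lambda>i. a + i) u) = shift_perm a k (perm_of_word u)"
proof (induction u)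
  case (Cons i u)
  have i: "i \<in> {1..<k}" using Cons.prems by simp
  have "shift_perm a k (perm_of_word u \<circ> transpose i (Suc i)) =
      shift_perm a k (perm_of_word u) \<circ> transpose (a + i) (Suc (a + i))"
    unfolding shift_perm_comp[OF permutes_transpose_Suc[OF i]] shift_perm_transpose[OF i] ..
  moreover have "set u \<subseteq> {1..<k}" using Cons.prems by simp
  ultimately show ?case using Cons.IH by (simp only: list.map perm_of_word.simps Suc_eq_plus1)
qed (simp add: shift_perm_id)

lemma card_invs_shift_perm:
  assumes "w permutes {1..k}"
  shows "card (invs (shift_perm a k w)) = card (invs w)"
proof -
  have sp: "shift_perm a k w permutes {a + 1..a + k}"
    using shift_perm_permutes[OF assms, of a "a + k"] by simp
  have "invs (shift_perm a k w) = map_prod ((+) a) ((+) a) ` invs w"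
  proof (intro Set.set_eqI iffI)
    fix p assume p: "p \<in> invs (shift_perm a k w)"
    obtain i j where ij: "p = (i, j)" by force
    have "i \<in> {a + 1..a + k} \<and> j \<in> {a + 1..a + k}"
      using p permutes_in_image[OF sp, of i] permutes_in_image[OF sp, of j]
        shift_perm_outside[of i a k w] shift_perm_outside[of j a k w]
      unfolding ij invs_def by fastforce
    then obtain x y where xy: "x \<in> {1..k}" "y \<in> {1..k}" "i = a + x" "j = a + y"
      by (metis imageE shift_interval)
    then have "(x, y) \<in> invs w" using p by (auto simp: invs_def ij shift_perm_apply)
    then show "p \<in> map_prod ((+) a) ((+) a) ` invs w" using xy ij by force
  next
    fix p assume "p \<in> map_prod ((+) a) ((+) a) ` invs w"
    then obtain x y where xy: "(x, y) \<in> invs w" "p = (a + x, a + y)" by auto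
    then have "x \<in> {1..k}" "y \<in> {1..k}" using invs_subset[OF assms] by auto
    then show "p \<in> invs (shift_perm a k w)" using xy by (auto simp: invs_def shift_perm_apply)
  qed
  moreover have "inj_on (map_prod ((+) a) ((+) a)) (invs w)"
    by (auto simp: inj_on_def)
  ultimately show ?thesis by (simp add: card_image)
qed

text \<open>The shifted reduced word expresses the shifted permutation with as many letters. The
  inversion counts agree, so it is again reduced and carries the same weight.\<close>

lemma shift_Te:
  fixes q :: "'a::field"
  assumes w: "w permutes {1..k}" and an: "a + k \<le> n"
  shows "hcong n q (shift a (Te k e w)) (Te n e (shift_perm a k w))"
proof -
  obtain u where u: "reduced_expression k w u" "(Tp k w :: word \<Rightarrow>\<^sub>0 'a) = wp u"
    using some_reduced_expression[OF w] by (auto simp: Tp_def)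
  have "set u \<subseteq> {1..<k}" using u(1) by (simp add: reduced_expression_iff)
  then have "set (map (\<lambda>i. a + i) u) \<subseteq> {1..<n}" using an by auto
  then have "reduced_expression n (shift_perm a k w) (map (\<lambda>i. a + i) u)"
    using u(1) perm_of_word_shift[of u k a]
    by (simp add: reduced_expression_iff card_invs_shift_perm[OF w])
  then have "hcong n q (shift a (Tp k w)) (Tp n (shift_perm a k w))"
    unfolding u(2) shift_wp by (rule hcong_sym[OF Tp_cong_wp])
  then show ?thesis
    by (auto simp: Te_def shift_mult card_invs_shift_perm[OF w] intro: hcong_mult_left)
qed

lemma shift_Tsum:
  assumes D: "\<And>w. w \<in> D \<Longrightarrow> w permutes {1..k}" and an: "a + k \<le> n"
  shows "hcong n q (shift a (Tsum k e D)) (Tsum n e (shift_perm a k ` D))"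
proof -
  have inj: "inj_on (shift_perm a k) D"
  proof (rule inj_onI)
    fix v w assume *: "v \<in> D" "w \<in> D" "shift_perm a k v = shift_perm a k w"
    show "v = w"
    proof
      fix x
      show "v x = w x"
      proof (cases "x \<in> {1..k}")
        case True
        then show ?thesis using fun_cong[OF *(3), of "a + x"] by (simp add: shift_perm_apply)
      next
        case False
        then show ?thesis using permutes_not_in[OF D[OF *(1)]] permutes_not_in[OF D[OF *(2)]] by simp
      qed
    qed
  qed
  show ?thesis unfolding Tsum_def shift_sum sum.reindex[OF inj] o_def
    using D an by (intro hcong_sum shift_Te)
qed

section \<open>Rows and cells\<close>

definition psum :: "(nat \<Rightarrow> nat) \<Rightarrow> nat \<Rightarrow> nat" where
  "psum \<nu> i = (\<Sum>k = 1..<i. \<nu> k)"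

text \<open>\<open>psum \<nu> (Suc i)\<close> counts the entries in rows \<open>1\<close> to
  \<open>i\<close>. Taking the least \<open>i\<close> skips empty rows, and a positive
  \<open>p\<close> never gets row \<open>0\<close>, whose bound is \<open>0\<close>.\<close>

definition rowof :: "(nat \<Rightarrow> nat) \<Rightarrow> nat \<Rightarrow> nat" where
  "rowof \<nu> p = (LEAST i. p \<le> psum \<nu> (Suc i))"

definition cellof :: "(nat \<Rightarrow> nat) \<Rightarrow> nat \<Rightarrow> nat \<times> nat" where
  "cellof \<nu> p = (rowof \<nu> p, p - psum \<nu> (rowof \<nu> p))"

lemma psum_mono: "i \<le> k \<Longrightarrow> psum \<nu> i \<le> psum \<nu> k"
  unfolding psum_def by (rule sum_mono2) auto

lemma psum_Suc: "1 \<le> i \<Longrightarrow> psum \<nu> (Suc i) = psum \<nu> i + \<nu> i"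
  unfolding psum_def by (simp add: sum.atLeastLessThan_Suc)

lemma row_tableau_eq: "row_tableau \<nu> (i, j) = psum \<nu> i + j"
  by (simp add: row_tableau_def psum_def)

lemma psum_ends:
  assumes "composition n \<nu>"
  shows "psum \<nu> i \<le> n" "\<exists>i. psum \<nu> (Suc i) = n"
proof -
  have fin: "finite {i. \<nu> i \<noteq> 0}" and n: "(\<Sum>i | \<nu> i \<noteq> 0. \<nu> i) = n" and z: "\<nu> 0 = 0"
    using assms by (auto simp: composition_def comp_size_def)
  obtain N where N: "\<And>i. \<nu> i \<noteq> 0 \<Longrightarrow> i \<le> N"
    using fin unfolding finite_nat_set_iff_bounded_le by blast
  have large: "psum \<nu> (Suc M) = n" if "M \<ge> N" for M
  proof -
    have "\<nu> i \<noteq> 0 \<Longrightarrow> 1 \<le> i" for i using z by (cases i) auto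
    moreover have "\<nu> i \<noteq> 0 \<Longrightarrow> i < Suc M" for i using N[of i] that by auto
    ultimately have "(\<Sum>k\<in>{1..<Suc M}. \<nu> k) = (\<Sum>i | \<nu> i \<noteq> 0. \<nu> i)"
      by (intro sum.mono_neutral_right) auto
    then show ?thesis using n by (simp add: psum_def)
  qed
  then show "\<exists>i. psum \<nu> (Suc i) = n" by blast
  show "psum \<nu> i \<le> n" using large[of "max N i"] psum_mono[of i "Suc (max N i)" \<nu>] by auto
qed

lemma rowof_eqI:
  assumes "1 \<le> i" "psum \<nu> i < p" "p \<le> psum \<nu> (Suc i)"
  shows "rowof \<nu> p = i"
  unfolding rowof_def
proof (rule Least_equality)
  fix k assume "p \<le> psum \<nu> (Suc k)"
  then show "i \<le> k" using assms(2) psum_mono[of "Suc k" i \<nu>] by (cases "i \<le> k") auto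
qed (rule assms(3))

lemma rowof_row_tableau:
  assumes "(i, j) \<in> diagram \<nu>"
  shows "rowof \<nu> (row_tableau \<nu> (i, j)) = i"
  using assms by (intro rowof_eqI) (auto simp: diagram_def row_tableau_eq psum_Suc)

lemma cellof_row_tableau: "x \<in> diagram \<nu> \<Longrightarrow> cellof \<nu> (row_tableau \<nu> x) = x"
  using rowof_row_tableau[of "fst x" "snd x"] by (cases x) (simp add: cellof_def row_tableau_eq)

lemma rowof_bounds:
  assumes "composition n \<nu>" "p \<in> {1..n}"
  shows "1 \<le> rowof \<nu> p" "psum \<nu> (rowof \<nu> p) < p" "p \<le> psum \<nu> (Suc (rowof \<nu> p))"
proof -
  have "\<exists>i. p \<le> psum \<nu> (Suc i)" using psum_ends(2)[OF assms(1)] assms(2) by auto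
  then show le: "p \<le> psum \<nu> (Suc (rowof \<nu> p))" unfolding rowof_def by (rule LeastI_ex)
  show r: "1 \<le> rowof \<nu> p"
  proof (rule ccontr)
    assume "\<not> 1 \<le> rowof \<nu> p"
    then show False using le assms(2) by (simp add: psum_def One_nat_def)
  qed
  show "psum \<nu> (rowof \<nu> p) < p"
  proof (rule ccontr)
    assume "\<not> psum \<nu> (rowof \<nu> p) < p"
    then have "p \<le> psum \<nu> (Suc (rowof \<nu> p - 1))" using r by simp
    then have "rowof \<nu> p \<le> rowof \<nu> p - 1" unfolding rowof_def by (rule Least_le)
    then show False using r by simp
  qed
qed

lemma cellof_diagram:
  assumes "composition n \<nu>" "p \<in> {1..n}"
  shows "cellof \<nu> p \<in> diagram \<nu>" "row_tableau \<nu> (cellof \<nu> p) = p"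
  using rowof_bounds[OF assms] psum_Suc[of "rowof \<nu> p" \<nu>]
  by (auto simp: cellof_def diagram_def row_tableau_eq)

lemma row_tableau_mem:
  assumes "composition n \<nu>" "x \<in> diagram \<nu>"
  shows "row_tableau \<nu> x \<in> {1..n}"
proof -
  obtain i j where x: "x = (i, j)" "1 \<le> i" "1 \<le> j" "j \<le> \<nu> i"
    using assms(2) by (cases x) (auto simp: diagram_def)
  then have "psum \<nu> i + j \<le> psum \<nu> (Suc i)" by (simp add: psum_Suc)
  also have "\<dots> \<le> n" by (rule psum_ends[OF assms(1)])
  finally show ?thesis using x by (simp add: row_tableau_eq)
qed

lemma bij_row_tableau:
  assumes "composition n \<nu>"
  shows "bij_betw (row_tableau \<nu>) (diagram \<nu>) {1..n}"
  using cellof_diagram[OF assms] row_tableau_mem[OF assms] cellof_row_tableau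
  by (intro bij_betw_byWitness[where f' = "cellof \<nu>"]) auto

lemma finite_diagram: "composition n \<nu> \<Longrightarrow> finite (diagram \<nu>)"
  using bij_betw_finite[OF bij_row_tableau] by blast

lemma card_cells:
  assumes "composition n \<nu>"
  shows "card {p \<in> {1..n}. Q (cellof \<nu> p)} = card {x \<in> diagram \<nu>. Q x}"
proof -
  have "bij_betw (row_tableau \<nu>) {x \<in> diagram \<nu>. Q x} {p \<in> {1..n}. Q (cellof \<nu> p)}"
    using cellof_diagram[OF assms] row_tableau_mem[OF assms] cellof_row_tableau
    by (intro bij_betw_byWitness[where f' = "cellof \<nu>"]) auto
  then show ?thesis by (rule bij_betw_same_card[symmetric])
qed

lemma fst_cellof [simp]: "fst (cellof \<nu> p) = rowof \<nu> p"
  by (simp add: cellof_def)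

lemma rowof_mono:
  assumes "composition n \<nu>" "p' \<in> {1..n}" "p \<le> p'"
  shows "rowof \<nu> p \<le> rowof \<nu> p'"
proof -
  have "p \<le> psum \<nu> (Suc (rowof \<nu> p'))" using rowof_bounds(3)[OF assms(1,2)] assms(3) by simp
  then show ?thesis unfolding rowof_def[of \<nu> p] by (rule Least_le)
qed

lemma convex_rowof:
  assumes "composition n \<nu>"
  shows "convex_col n (rowof \<nu>)"
  unfolding convex_col_def by (metis assms le_antisym rowof_mono)

lemma card_rowof:
  assumes "composition n \<nu>"
  shows "card {p \<in> {1..n}. rowof \<nu> p = r} = \<nu> r"
proof -
  have "card {p \<in> {1..n}. rowof \<nu> p = r} = card {x \<in> diagram \<nu>. fst x = r}"
    using card_cells[OF assms, of "\<lambda>x. fst x = r"] by simp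
  also have "{x \<in> diagram \<nu>. fst x = r} = Pair r ` {j. 1 \<le> r \<and> 1 \<le> j \<and> j \<le> \<nu> r}"
    by (auto simp: diagram_def)
  also have "card \<dots> = card {j. 1 \<le> r \<and> 1 \<le> j \<and> j \<le> \<nu> r}"
    by (intro card_image) (auto simp: inj_on_def)
  also have "\<dots> = \<nu> r"
  proof (cases "r = 0")
    case True
    then show ?thesis using assms by (simp add: composition_def)
  next
    case False
    then have "{j. 1 \<le> r \<and> 1 \<le> j \<and> j \<le> \<nu> r} = {1..\<nu> r}" by auto
    then show ?thesis by simp
  qed
  finally show ?thesis .
qed

lemma row_set_eq:
  assumes "composition n \<nu>"
  shows "row_tableau \<nu> ` {(i, j) | j. (i, j) \<in> diagram \<nu>} = {p \<in> {1..n}. rowof \<nu> p = i}"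
proof (intro Set.set_eqI iffI)
  fix p assume "p \<in> row_tableau \<nu> ` {(i, j) | j. (i, j) \<in> diagram \<nu>}"
  then show "p \<in> {p \<in> {1..n}. rowof \<nu> p = i}"
    using row_tableau_mem[OF assms] rowof_row_tableau by auto
next
  fix p assume p: "p \<in> {p \<in> {1..n}. rowof \<nu> p = i}"
  then have "cellof \<nu> p \<in> diagram \<nu>" "row_tableau \<nu> (cellof \<nu> p) = p" "fst (cellof \<nu> p) = i"
    using cellof_diagram[OF assms] by auto
  then show "p \<in> row_tableau \<nu> ` {(i, j) | j. (i, j) \<in> diagram \<nu>}"
    by (metis (mono_tags, lifting) imageI mem_Collect_eq prod.collapse)
qed

text \<open>Rephrases the stabilizer of all rows as a colour group, so that the coset decompositions
  apply; the colours are convex because rows hold consecutive numbers.\<close>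

lemma young_subgroup_eq:
  assumes "composition n \<nu>"
  shows "young_subgroup n \<nu> = col_group n (rowof \<nu>)"
proof -
  have "(\<forall>i\<ge>1. w ` {p \<in> {1..n}. rowof \<nu> p = i} = {p \<in> {1..n}. rowof \<nu> p = i}) \<longleftrightarrow>
      (\<forall>p\<in>{1..n}. rowof \<nu> (w p) = rowof \<nu> p)" (is "?l \<longleftrightarrow> ?r") if w: "w permutes {1..n}" for w
  proof
    assume l: ?l
    show ?r
    proof
      fix p assume p: "p \<in> {1..n}"
      then have "w p \<in> w ` {p' \<in> {1..n}. rowof \<nu> p' = rowof \<nu> p}" by auto
      then show "rowof \<nu> (w p) = rowof \<nu> p" using l rowof_bounds(1)[OF assms p] by auto
    qed
  next
    assume r: ?r
    show ?l
    proof (intro allI impI)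
      fix i
      show "w ` {p \<in> {1..n}. rowof \<nu> p = i} = {p \<in> {1..n}. rowof \<nu> p = i}"
      proof (rule endo_inj_surj)
        show "w ` {p \<in> {1..n}. rowof \<nu> p = i} \<subseteq> {p \<in> {1..n}. rowof \<nu> p = i}"
          using r permutes_in_image[OF w] by auto
        show "inj_on w {p \<in> {1..n}. rowof \<nu> p = i}" by (rule permutes_inj_on[OF w])
      qed auto
    qed
  qed
  then show ?thesis
    unfolding young_subgroup_def col_group_def row_set_eq[OF assms] by blast
qed

section \<open>Conjugate partitions\<close>

lemma partition_antimono:
  assumes "is_partition n \<mu>" "1 \<le> i" "i \<le> k"
  shows "\<mu> k \<le> \<mu> i"
  using assms(3)
proof (induction rule: dec_induct)
  case (step b)
  then have "\<mu> (Suc b) \<le> \<mu> b" using assms(1,2) by (auto simp: is_partition_def simp flip: Suc_eq_plus1)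
  then show ?case using step by simp
qed simp

text \<open>Since the parts weakly decrease, the rows of length at least \<open>j\<close> form an
  initial segment, and the conjugate part is its length.\<close>

lemma le_conjugate_iff:
  assumes "is_partition n \<mu>" "1 \<le> i" "1 \<le> j"
  shows "i \<le> conjugate \<mu> j \<longleftrightarrow> j \<le> \<mu> i"
proof -
  define S where "S = {i. 1 \<le> i \<and> j \<le> \<mu> i}"
  have "finite S"
    by (rule finite_subset[of _ "{i. \<mu> i \<noteq> 0}"])
      (use assms in \<open>auto simp: S_def is_partition_def composition_def\<close>)
  have down: "i \<in> S" if "k \<in> S" "1 \<le> i" "i \<le> k" for i k
    using that partition_antimono[OF assms(1), of i k] by (auto simp: S_def)
  have "S = {1..card S}"
  proof (cases "S = {}")
    case False
    then have "S = {1..Max S}"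
      using down[OF Max_in[OF \<open>finite S\<close> False]] \<open>finite S\<close> by (auto simp: S_def)
    then show ?thesis by (metis card_atLeastAtMost diff_Suc_1' One_nat_def)
  qed simp
  then have "i \<in> S \<longleftrightarrow> i \<le> card S" using assms(2) by (metis atLeastAtMost_iff)
  moreover have "conjugate \<mu> j = card S" using assms(3) by (simp add: conjugate_def S_def)
  ultimately show ?thesis using assms(2) by (simp add: S_def)
qed

lemma diagram_conjugate:
  assumes "is_partition n \<mu>"
  shows "(j, i) \<in> diagram (conjugate \<mu>) \<longleftrightarrow> (i, j) \<in> diagram \<mu>"
  using le_conjugate_iff[OF assms, of i j] by (auto simp: diagram_def)

lemma comp_size_diagram:
  assumes "\<nu> 0 = 0" "finite {i. \<nu> i \<noteq> 0}"
  shows "comp_size \<nu> = card (diagram \<nu>)"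
proof -
  have "i \<ge> 1" if "\<nu> i \<noteq> 0" for i using that assms(1) by (cases i) auto
  then have "diagram \<nu> = Sigma {i. \<nu> i \<noteq> 0} (\<lambda>i. {1..\<nu> i})"
    by (force simp: diagram_def)
  then show ?thesis using assms(2) by (simp add: comp_size_def)
qed

lemma is_partition_composition: "is_partition n \<mu> \<Longrightarrow> composition n \<mu>"
  by (simp add: is_partition_def)

lemma composition_diagram:
  "composition n \<nu> \<longleftrightarrow> \<nu> 0 = 0 \<and> finite {i. \<nu> i \<noteq> 0} \<and> card (diagram \<nu>) = n"
  using comp_size_diagram[of \<nu>] by (auto simp: composition_def)

lemma composition_conjugate:
  assumes "is_partition n \<mu>"
  shows "composition n (conjugate \<mu>)"
  unfolding composition_diagram
proof (intro conjI)
  show "conjugate \<mu> 0 = 0" by (simp add: conjugate_def)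
  have "{j. conjugate \<mu> j \<noteq> 0} \<subseteq> {1..\<mu> 1}"
  proof clarify
    fix j assume j: "0 < conjugate \<mu> j"
    then have "1 \<le> j" by (cases j) (auto simp: conjugate_def)
    then show "j \<in> {1..\<mu> 1}" using le_conjugate_iff[OF assms, of 1 j] j by auto
  qed
  then show "finite {j. conjugate \<mu> j \<noteq> 0}" by (rule finite_subset) simp
  have "diagram (conjugate \<mu>) = prod.swap ` diagram \<mu>"
    using diagram_conjugate[OF assms] by (force simp: image_iff)
  then have "card (diagram (conjugate \<mu>)) = card (diagram \<mu>)" by (simp add: card_image)
  then show "card (diagram (conjugate \<mu>)) = n"
    using is_partition_composition[OF assms] by (simp add: composition_diagram)
qed

lemma column_tableau_eq: "column_tableau \<mu> (i, j) = row_tableau (conjugate \<mu>) (j, i)"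
  by (simp add: column_tableau_def row_tableau_def)

text \<open>The comparison involves only the relative position of the two cells, not the other rows.
  This will make \<open>W'\<close> increasing on a block of rows.\<close>

lemma column_tableau_less_iff:
  assumes "is_partition n \<mu>" "(i, j) \<in> diagram \<mu>" "(i', j') \<in> diagram \<mu>"
  shows "column_tableau \<mu> (i, j) < column_tableau \<mu> (i', j') \<longleftrightarrow> j < j' \<or> j = j' \<and> i < i'"
proof -
  note c = composition_conjugate[OF assms(1)]
  have d: "(j, i) \<in> diagram (conjugate \<mu>)" "(j', i') \<in> diagram (conjugate \<mu>)"
    using assms diagram_conjugate by auto
  have imp: "row_tableau (conjugate \<mu>) (a, b) < row_tableau (conjugate \<mu>) (a', b')"
    if "(a, b) \<in> diagram (conjugate \<mu>)" "(a', b') \<in> diagram (conjugate \<mu>)" "a < a'" for a b a' b'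
    using rowof_mono[OF c row_tableau_mem[OF c that(1)], of "row_tableau (conjugate \<mu>) (a', b')"]
      rowof_row_tableau[OF that(1)] rowof_row_tableau[OF that(2)] that(3) by linarith
  show ?thesis
    using imp[OF d] imp[OF d(2,1)]
    by (cases j j' rule: linorder_cases) (auto simp: column_tableau_eq row_tableau_eq)
qed

text \<open>Discharges the definite description: both tableaux are bijective fillings, which gives
  existence, and every number in \<open>{1..n}\<close> occurs in a cell, which gives
  uniqueness.\<close>

lemma perm_w_props:
  assumes "is_partition n \<mu>"
  shows "perm_w n \<mu> permutes {1..n}"
    "x \<in> diagram \<mu> \<Longrightarrow> perm_w n \<mu> (row_tableau \<mu> x) = column_tableau \<mu> x"
proof -
  note c = is_partition_composition[OF assms] and c' = composition_conjugate[OF assms]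
  let ?P = "\<lambda>w. w permutes {1..n} \<and> (\<forall>x\<in>diagram \<mu>. w (row_tableau \<mu> x) = column_tableau \<mu> x)"
  have sw: "bij_betw prod.swap (diagram \<mu>) (diagram (conjugate \<mu>))"
    using diagram_conjugate[OF assms] by (intro bij_betw_byWitness[where f' = prod.swap]) auto
  have col: "column_tableau \<mu> x = (row_tableau (conjugate \<mu>) \<circ> prod.swap) x" for x
    by (cases x) (simp add: column_tableau_eq)
  have bc: "bij_betw (column_tableau \<mu>) (diagram \<mu>) {1..n}"
    using bij_betw_trans[OF sw bij_row_tableau[OF c']] by (simp add: col cong: bij_betw_cong)
  have "bij_betw (cellof \<mu>) {1..n} (diagram \<mu>)"
    using cellof_diagram[OF c] row_tableau_mem[OF c] cellof_row_tableau
    by (intro bij_betw_byWitness[where f' = "row_tableau \<mu>"]) auto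
  from bij_betw_trans[OF this bc]
  have "bij_betw (\<lambda>p. if p \<in> {1..n} then column_tableau \<mu> (cellof \<mu> p) else p) {1..n} {1..n}"
    by (rule iffD1[OF bij_betw_cong, rotated]) auto
  then have "(\<lambda>p. if p \<in> {1..n} then column_tableau \<mu> (cellof \<mu> p) else p) permutes {1..n}"
    by (rule bij_imp_permutes) auto
  then have ex: "?P (\<lambda>p. if p \<in> {1..n} then column_tableau \<mu> (cellof \<mu> p) else p)"
    using row_tableau_mem[OF c] cellof_row_tableau by auto
  have "\<exists>!w. ?P w"
  proof (rule ex1I)
    show "?P (\<lambda>p. if p \<in> {1..n} then column_tableau \<mu> (cellof \<mu> p) else p)" by (rule ex)
  next
    fix w assume w: "?P w"
    show "w = (\<lambda>p. if p \<in> {1..n} then column_tableau \<mu> (cellof \<mu> p) else p)"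
    proof
      fix p
      show "w p = (if p \<in> {1..n} then column_tableau \<mu> (cellof \<mu> p) else p)"
      proof (cases "p \<in> {1..n}")
        case True
        then have "w (row_tableau \<mu> (cellof \<mu> p)) = column_tableau \<mu> (cellof \<mu> p)"
          using w cellof_diagram(1)[OF c True] by blast
        then show ?thesis using True cellof_diagram(2)[OF c True] by simp
      next
        case False
        then show ?thesis using w permutes_not_in[of w "{1..n}" p] by auto
      qed
    qed
  qed
  from theI'[OF this] have "?P (perm_w n \<mu>)" unfolding perm_w_def .
  then show "perm_w n \<mu> permutes {1..n}"
    "x \<in> diagram \<mu> \<Longrightarrow> perm_w n \<mu> (row_tableau \<mu> x) = column_tableau \<mu> x" by blast+
qed

section \<open>The double coset of a tableau\<close>

text \<open>Each \<open>r\<close> occurs \<open>\<nu> r\<close> times on both sides. The value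
  \<open>0\<close> is treated apart, since the type prescribes multiplicities only for positive
  \<open>r\<close>: it is neither an entry of \<open>A\<close> nor the index of a nonempty
  row.\<close>

lemma tableau_mset_eq:
  assumes "composition n \<mu>" "composition n \<nu>" "tableau_of_type \<mu> \<nu> A"
  shows "image_mset (rowof \<nu>) (mset_set {1..n}) = image_mset (\<lambda>p. A (cellof \<mu> p)) (mset_set {1..n})"
proof (rule multiset_eqI)
  fix r
  have "card {x \<in> diagram \<mu>. A x = r} = \<nu> r"
  proof (cases "r = 0")
    case True
    then have "{x \<in> diagram \<mu>. A x = r} = {}" using assms(3) by (force simp: tableau_of_type_def)
    then show ?thesis using True assms(2) by (simp only: card.empty composition_def)
  next
    case False
    then show ?thesis using assms(3) by (auto simp: tableau_of_type_def content_def)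
  qed
  then show "count (image_mset (rowof \<nu>) (mset_set {1..n})) r =
      count (image_mset (\<lambda>p. A (cellof \<mu> p)) (mset_set {1..n})) r"
    using card_rowof[OF assms(2), of r] card_cells[OF assms(1), of "\<lambda>x. A x = r"]
    by (simp add: count_image_mset_eq_card_vimage)
qed

lemma pinv_mem: "w permutes {1..n} \<Longrightarrow> p \<in> {1..n} \<Longrightarrow> pinv w p \<in> {1..n}"
  using permutes_in_image[OF permutes_inv[of w "{1..n}"], of p] by simp

lemma pinv_comp:
  assumes "v permutes {1..n}" "w permutes {1..n}"
  shows "pinv (v \<circ> w) = pinv w \<circ> pinv v"
  using assms by (simp add: o_inv_distrib permutes_bij)

text \<open>In terms of \<open>rowof\<close> the definition asks for a shortest coset representative
  whose inverse sends each entry to the row prescribed by \<open>A\<close>. Uniqueness is then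
  uniqueness of such representatives.\<close>

lemma perm_1_props:
  assumes cm: "composition n \<mu>" and cn: "composition n \<nu>" and type: "tableau_of_type \<mu> \<nu> A"
  shows "perm_1 n \<mu> \<nu> A permutes {1..n}"
    "\<And>p. p \<in> {1..n} \<Longrightarrow> rowof \<nu> (pinv (perm_1 n \<mu> \<nu> A) p) = A (cellof \<mu> p)"
proof -
  let ?c = "rowof \<nu>"
  let ?P = "\<lambda>w. w permutes {1..n} \<and>
     (\<forall>i j k. (i, j) \<in> diagram \<nu> \<and> (i, k) \<in> diagram \<nu> \<and> j < k \<longrightarrow>
        w (row_tableau \<nu> (i, j)) < w (row_tableau \<nu> (i, k))) \<and>
     (\<forall>x\<in>diagram \<mu>. \<exists>j. (A x, j) \<in> diagram \<nu> \<and> w (row_tableau \<nu> (A x, j)) = row_tableau \<mu> x)"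
  let ?Q = "\<lambda>w. w permutes {1..n} \<and> col_increasing n ?c w \<and>
     (\<forall>p\<in>{1..n}. ?c (pinv w p) = A (cellof \<mu> p))"
  have PQ: "?P w \<longleftrightarrow> ?Q w" for w
  proof
    assume P: "?P w"
    then have w: "w permutes {1..n}" by blast
    have "col_increasing n ?c w"
      unfolding col_increasing_def
    proof (intro ballI impI)
      fix x y assume xy: "x \<in> {1..n}" "y \<in> {1..n}" "x < y \<and> ?c x = ?c y"
      note cx = cellof_diagram[OF cn xy(1)] and cy = cellof_diagram[OF cn xy(2)]
      have "x - psum \<nu> (?c x) < y - psum \<nu> (?c x)"
        using xy rowof_bounds(2)[OF cn xy(1)] by auto
      then show "w x < w y" using P cx cy xy(3) unfolding cellof_def by metis
    qed
    moreover have "?c (pinv w p) = A (cellof \<mu> p)" if p: "p \<in> {1..n}" for p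
    proof -
      obtain j where "(A (cellof \<mu> p), j) \<in> diagram \<nu>" "w (row_tableau \<nu> (A (cellof \<mu> p), j)) = p"
        using P cellof_diagram[OF cm p] by metis
      then show ?thesis using rowof_row_tableau permutes_inv_eq[OF w] by metis
    qed
    ultimately show "?Q w" using w by blast
  next
    assume Q: "?Q w"
    then have w: "w permutes {1..n}" by blast
    have "w (row_tableau \<nu> (i, j)) < w (row_tableau \<nu> (i, k))"
      if "(i, j) \<in> diagram \<nu>" "(i, k) \<in> diagram \<nu>" "j < k" for i j k
      using Q row_tableau_mem[OF cn that(1)] row_tableau_mem[OF cn that(2)] that(3)
        rowof_row_tableau[OF that(1)] rowof_row_tableau[OF that(2)]
      unfolding col_increasing_def by (auto simp: row_tableau_eq)
    moreover have "\<exists>j. (A x, j) \<in> diagram \<nu> \<and> w (row_tableau \<nu> (A x, j)) = row_tableau \<mu> x"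
      if x: "x \<in> diagram \<mu>" for x
    proof -
      let ?p = "row_tableau \<mu> x"
      have p: "?p \<in> {1..n}" by (rule row_tableau_mem[OF cm x])
      note c = cellof_diagram[OF cn pinv_mem[OF w p]]
      have "A x = ?c (pinv w ?p)" using Q p cellof_row_tableau[OF x] by simp
      then show ?thesis using c permutes_inverses(1)[OF w, of ?p] unfolding cellof_def by metis
    qed
    ultimately show "?P w" using w by blast
  qed
  have uniq: "w = w'" if "?Q w" "?Q w'" for w w'
  proof -
    have w: "w permutes {1..n}" "w' permutes {1..n}" using that by auto
    have "?c (pinv w' (w p)) = ?c p" if p: "p \<in> {1..n}" for p
    proof -
      have wp: "w p \<in> {1..n}" using p permutes_in_image[OF w(1)] by simp
      have "?c (pinv w' (w p)) = ?c (pinv w (w p))" using \<open>?Q w\<close> \<open>?Q w'\<close> wp by auto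
      then show ?thesis by (simp add: permutes_inverses[OF w(1)])
    qed
    then have "pinv w' \<circ> w \<in> col_group n ?c"
      using permutes_compose[OF w(1) permutes_inv[OF w(2)]] by (auto simp: col_group_def)
    moreover have "w \<circ> id = w' \<circ> (pinv w' \<circ> w)"
      using permutes_inv_o(1)[OF w(2)] by (simp flip: comp_assoc)
    ultimately show ?thesis
      using col_increasing_unique(1)[OF convex_rowof[OF cn] w _ _ id_col_group] that by blast
  qed
  \<comment> \<open>Equality of multisets yields some permutation with the prescribed rows; passing
    to its coset representative makes it increasing along rows.\<close>
  obtain w0 where w0: "w0 permutes {1..n}" "\<forall>x\<in>{1..n}. ?c x = A (cellof \<mu> (w0 x))"
    using image_mset_eq_implies_permutes[OF _ tableau_mset_eq[OF assms]] by blast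
  obtain d z where dz: "d permutes {1..n}" "col_increasing n ?c d" "z \<in> col_group n ?c" "w0 = d \<circ> z"
    using ex_col_increasing[OF convex_rowof[OF cn] w0(1)] .
  have "?c (pinv d p) = A (cellof \<mu> p)" if p: "p \<in> {1..n}" for p
  proof -
    have z: "z permutes {1..n}" by (rule col_group_permutes[OF dz(3)])
    have "?c (pinv d p) = ?c (pinv z (pinv d p))"
      using col_group_col[OF inv_col_group[OF dz(3)] pinv_mem[OF dz(1) p]] by simp
    also have "pinv z (pinv d p) = pinv w0 p" unfolding dz(4) pinv_comp[OF dz(1) z] by simp
    also have "?c (pinv w0 p) = A (cellof \<mu> p)"
      using w0 pinv_mem[OF w0(1) p] permutes_inverses(1)[OF w0(1), of p] by simp
    finally show ?thesis .
  qed
  then have Qd: "?Q d" using dz(1,2) by blast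
  have "\<exists>!w. ?P w"
  proof (rule ex1I)
    show "?P d" by (rule iffD2[OF PQ Qd])
  next
    fix w assume "?P w"
    then have "?Q w" by (rule iffD1[OF PQ])
    then show "w = d" using Qd by (rule uniq)
  qed
  from theI'[OF this] have "?P (perm_1 n \<mu> \<nu> A)" unfolding perm_1_def .
  then have "?Q (perm_1 n \<mu> \<nu> A)" by (rule iffD1[OF PQ])
  then show "perm_1 n \<mu> \<nu> A permutes {1..n}"
    "\<And>p. p \<in> {1..n} \<Longrightarrow> rowof \<nu> (pinv (perm_1 n \<mu> \<nu> A) p) = A (cellof \<mu> p)" by blast+
qed

text \<open>A double coset of Young subgroups is recorded by its table of row intersections. In this
  form membership is one condition for every row \<open>i\<close> of \<mu>, so the conditions can be
  divided between the rows of a block and the others.\<close>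

definition contset :: "nat \<Rightarrow> (nat \<Rightarrow> nat) \<Rightarrow> (nat \<Rightarrow> nat) \<Rightarrow> (nat \<times> nat \<Rightarrow> nat) \<Rightarrow> (nat \<Rightarrow> nat) set"
  where "contset n \<mu> \<nu> A = {w. w permutes {1..n} \<and>
     (\<forall>i r. card {p \<in> {1..n}. rowof \<mu> p = i \<and> rowof \<nu> (pinv w p) = r} =
       card {j. (i, j) \<in> diagram \<mu> \<and> A (i, j) = r})}"

lemma card_row_cells:
  assumes "composition n \<mu>"
  shows "card {p \<in> {1..n}. rowof \<mu> p = i \<and> A (cellof \<mu> p) = r} =
    card {j. (i, j) \<in> diagram \<mu> \<and> A (i, j) = r}"
proof -
  have "card {p \<in> {1..n}. rowof \<mu> p = i \<and> A (cellof \<mu> p) = r} =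
      card {x \<in> diagram \<mu>. fst x = i \<and> A x = r}"
    using card_cells[OF assms, of "\<lambda>x. fst x = i \<and> A x = r"] by simp
  also have "{x \<in> diagram \<mu>. fst x = i \<and> A x = r} = Pair i ` {j. (i, j) \<in> diagram \<mu> \<and> A (i, j) = r}"
    by auto
  also have "card \<dots> = card {j. (i, j) \<in> diagram \<mu> \<and> A (i, j) = r}"
    by (intro card_image) (auto simp: inj_on_def)
  finally show ?thesis .
qed

text \<open>Row-preserving permutations on either side do not change the table. Conversely, equal
  tables match the entries within each row of \<mu> by some \<open>v\<close>, and the remaining
  discrepancy \<open>u\<close> preserves the rows of \<nu>.\<close>

lemma double_coset_eq_contset:
  assumes cm: "composition n \<mu>" and cn: "composition n \<nu>" and type: "tableau_of_type \<mu> \<nu> A"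
  shows "double_coset n \<nu> (perm_1 n \<mu> \<nu> A) \<mu> = contset n \<mu> \<nu> A"
proof (intro Set.set_eqI iffI)
  let ?d = "perm_1 n \<mu> \<nu> A"
  note d = perm_1_props[OF assms]
  {
    fix w assume "w \<in> double_coset n \<nu> ?d \<mu>"
    then obtain u v where uv: "u \<in> col_group n (rowof \<nu>)" "v \<in> col_group n (rowof \<mu>)" "w = v \<circ> ?d \<circ> u"
      unfolding double_coset_def young_subgroup_eq[OF cm] young_subgroup_eq[OF cn] by blast
    note perms = col_group_permutes[OF uv(1)] col_group_permutes[OF uv(2)] d(1)
    have w: "w permutes {1..n}" unfolding uv(3) by (intro permutes_compose perms)
    have col: "rowof \<nu> (pinv w p) = A (cellof \<mu> (pinv v p))" if p: "p \<in> {1..n}" for p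
    proof -
      have vp: "pinv v p \<in> {1..n}" by (rule pinv_mem[OF perms(2) p])
      have "pinv w p = pinv u (pinv ?d (pinv v p))"
        unfolding uv(3) pinv_comp[OF permutes_compose[OF perms(3,2)] perms(1)] pinv_comp[OF perms(2,3)]
        by simp
      then show ?thesis
        using col_group_col[OF inv_col_group[OF uv(1)] pinv_mem[OF perms(3) vp]] d(2)[OF vp] by simp
    qed
    have "card {p \<in> {1..n}. rowof \<mu> p = i \<and> rowof \<nu> (pinv w p) = r} =
        card {p \<in> {1..n}. rowof \<mu> p = i \<and> A (cellof \<mu> p) = r}" for i r
    proof (rule bij_betw_same_card)
      show "bij_betw (pinv v) {p \<in> {1..n}. rowof \<mu> p = i \<and> rowof \<nu> (pinv w p) = r}
          {p \<in> {1..n}. rowof \<mu> p = i \<and> A (cellof \<mu> p) = r}"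
      proof (rule bij_betw_byWitness[where f' = v])
        have vmem: "v p \<in> {1..n}" if "p \<in> {1..n}" for p using permutes_in_image[OF perms(2)] that by blast
        show "v ` {p \<in> {1..n}. rowof \<mu> p = i \<and> A (cellof \<mu> p) = r} \<subseteq>
          {p \<in> {1..n}. rowof \<mu> p = i \<and> rowof \<nu> (pinv w p) = r}"
          using vmem col_group_col[OF uv(2)] col by (auto simp: permutes_inverses[OF perms(2)])
        show "pinv v ` {p \<in> {1..n}. rowof \<mu> p = i \<and> rowof \<nu> (pinv w p) = r} \<subseteq>
          {p \<in> {1..n}. rowof \<mu> p = i \<and> A (cellof \<mu> p) = r}"
          using pinv_mem[OF perms(2)] col_group_col[OF inv_col_group[OF uv(2)]] col by auto
      qed (auto simp: permutes_inverses[OF perms(2)])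
    qed
    then show "w \<in> contset n \<mu> \<nu> A" using w unfolding contset_def card_row_cells[OF cm] by blast
  next
    fix w assume wc: "w \<in> contset n \<mu> \<nu> A"
    then have w: "w permutes {1..n}" by (simp add: contset_def)
    \<comment> \<open>The table counts pairs of rows, so equal tables say that these multisets of
      pairs coincide.\<close>
    have "image_mset (\<lambda>p. (rowof \<mu> p, A (cellof \<mu> p))) (mset_set {1..n}) =
        image_mset (\<lambda>p. (rowof \<mu> p, rowof \<nu> (pinv w p))) (mset_set {1..n})"
    proof (rule multiset_eqI)
      fix ir :: "nat \<times> nat"
      obtain i r where ir: "ir = (i, r)" by force
      have "card {p \<in> {1..n}. rowof \<mu> p = i \<and> rowof \<nu> (pinv w p) = r} =
          card {p \<in> {1..n}. rowof \<mu> p = i \<and> A (cellof \<mu> p) = r}"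
        using wc unfolding contset_def card_row_cells[OF cm] by blast
      then show "count (image_mset (\<lambda>p. (rowof \<mu> p, A (cellof \<mu> p))) (mset_set {1..n})) ir =
          count (image_mset (\<lambda>p. (rowof \<mu> p, rowof \<nu> (pinv w p))) (mset_set {1..n})) ir"
        by (simp add: count_image_mset_eq_card_vimage ir)
    qed
    from image_mset_eq_implies_permutes[OF _ this] obtain v where v: "v permutes {1..n}"
        "\<And>p. p \<in> {1..n} \<Longrightarrow> rowof \<mu> (v p) = rowof \<mu> p \<and> rowof \<nu> (pinv w (v p)) = A (cellof \<mu> p)"
      by (metis finite_atLeastAtMost prod.inject)
    have vg: "v \<in> col_group n (rowof \<mu>)" using v by (simp add: col_group_def)
    define u where "u = pinv w \<circ> (v \<circ> ?d)"
    have u: "u permutes {1..n}"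
      unfolding u_def by (intro permutes_compose permutes_inv w v(1) d(1))
    have "rowof \<nu> (u p) = rowof \<nu> p" if p: "p \<in> {1..n}" for p
    proof -
      have dp: "?d p \<in> {1..n}" using p permutes_in_image[OF d(1)] by blast
      show ?thesis using v(2)[OF dp] d(2)[OF dp] by (simp add: u_def permutes_inverses[OF d(1)])
    qed
    then have ug: "pinv u \<in> col_group n (rowof \<nu>)" using u by (intro inv_col_group) (simp add: col_group_def)
    have "w \<circ> u = v \<circ> ?d" unfolding u_def using permutes_inv_o(1)[OF w] by (simp flip: comp_assoc)
    then have "w = v \<circ> ?d \<circ> pinv u" using permutes_inv_o(1)[OF u] by (metis comp_assoc comp_id)
    then show "w \<in> double_coset n \<nu> ?d \<mu>"
      unfolding double_coset_def young_subgroup_eq[OF cm] young_subgroup_eq[OF cn] using ug vg by blast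
  }
qed

lemma contset_permutes: "w \<in> contset n \<mu> \<nu> A \<Longrightarrow> w permutes {1..n}"
  by (simp add: contset_def)

lemma contset_closed:
  assumes "composition n \<mu>" "composition n \<nu>" "tableau_of_type \<mu> \<nu> A" "w \<in> contset n \<mu> \<nu> A"
  shows "z \<in> col_group n (rowof \<mu>) \<Longrightarrow> z \<circ> w \<in> contset n \<mu> \<nu> A"
    and "z \<in> col_group n (rowof \<nu>) \<Longrightarrow> w \<circ> z \<in> contset n \<mu> \<nu> A"
proof -
  let ?d = "perm_1 n \<mu> \<nu> A"
  note eq = double_coset_eq_contset[OF assms(1-3), symmetric]
  note def = double_coset_def young_subgroup_eq[OF assms(1)] young_subgroup_eq[OF assms(2)]
  obtain u v where uv: "u \<in> col_group n (rowof \<nu>)" "v \<in> col_group n (rowof \<mu>)" "w = v \<circ> ?d \<circ> u"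
    using assms(4) unfolding eq def by blast
  show "z \<circ> w \<in> contset n \<mu> \<nu> A" if z: "z \<in> col_group n (rowof \<mu>)"
  proof -
    have "z \<circ> w = (z \<circ> v) \<circ> ?d \<circ> u" by (simp add: uv(3) comp_assoc)
    then show ?thesis using comp_col_group[OF z uv(2)] uv(1) unfolding eq def by blast
  qed
  show "w \<circ> z \<in> contset n \<mu> \<nu> A" if z: "z \<in> col_group n (rowof \<nu>)"
  proof -
    have "w \<circ> z = v \<circ> ?d \<circ> (u \<circ> z)" by (simp add: uv(3) comp_assoc)
    then show ?thesis using comp_col_group[OF uv(1) z] uv(2) unfolding eq def by blast
  qed
qed

section \<open>The homomorphisms\<close>

definition xp :: "nat \<Rightarrow> (nat \<Rightarrow> nat) \<Rightarrow> (word \<Rightarrow>\<^sub>0 'a::field)" where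
  "xp n \<nu> = Tsum n 1 (col_group n (rowof \<nu>))"

definition yp :: "nat \<Rightarrow> 'a::field \<Rightarrow> (nat \<Rightarrow> nat) \<Rightarrow> (word \<Rightarrow>\<^sub>0 'a)" where
  "yp n q \<nu> = Tsum n (inverse (- q)) (col_group n (rowof \<nu>))"

lemma xp_fcarrier [intro]: "xp n \<nu> \<in> fcarrier n"
  unfolding xp_def by auto

lemma yp_fcarrier [intro]: "yp n q \<nu> \<in> fcarrier n"
  unfolding yp_def by auto

lemma finsum_T:
  assumes "\<And>w. w \<in> D \<Longrightarrow> w permutes {1..n}"
  shows "(\<Oplus>\<^bsub>hecke n q\<^esub> w \<in> D. T n q w) = hclass n q (Tsum n 1 D)"
proof -
  interpret R: ring "hecke n q" by (rule ring_hecke)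
  have "hclass n q (Tsum n 1 D) = (\<Oplus>\<^bsub>hecke n q\<^esub> w \<in> D. hclass n q (Te n 1 w))"
    unfolding Tsum_def using assms by (intro hclass_sum) auto
  also have "\<dots> = (\<Oplus>\<^bsub>hecke n q\<^esub> w \<in> D. T n q w)"
    using assms by (intro R.finsum_cong') (auto simp: T_eq Te_1 assms intro!: hclass_carrier Tp_fcarrier)
  finally show ?thesis by simp
qed

lemma x_elt_eq: "composition n \<nu> \<Longrightarrow> x_elt n q \<nu> = hclass n q (xp n \<nu>)"
  unfolding x_elt_def xp_def young_subgroup_eq by (intro finsum_T col_group_permutes)

lemma y_elt_eq:
  assumes "composition n \<nu>"
  shows "y_elt n q \<nu> = hclass n q (yp n q \<nu>)"
proof -
  interpret R: ring "hecke n q" by (rule ring_hecke)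
  let ?G = "col_group n (rowof \<nu>)"
  have "hclass n q (yp n q \<nu>) = (\<Oplus>\<^bsub>hecke n q\<^esub> w \<in> ?G. hclass n q (Te n (inverse (- q)) w))"
    unfolding Tsum_def yp_def by (intro hclass_sum) (auto intro: col_group_permutes)
  also have "\<dots> = (\<Oplus>\<^bsub>hecke n q\<^esub> w \<in> ?G.
     hscale n q ((- q) powi (- int (coxeter_length n w))) (T n q w))"
  proof (rule R.finsum_cong', goal_cases)
    case 2
    show ?case by (auto simp: hscale_hclass T_eq Tp_fcarrier intro!: hclass_carrier mult_fcarrier dest!: col_group_permutes)
  next
    case (3 w)
    then have w: "w permutes {1..n}" by (rule col_group_permutes)
    have "(- q) powi (- int (card (invs w))) = inverse (- q) ^ card (invs w)"
      by (simp only: power_int_minus power_int_of_nat power_inverse)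
    then show ?case
      by (simp only: T_eq[OF w] hscale_hclass[OF Tp_fcarrier[OF w]] Te_def coxeter_length_eq[OF w])
  qed simp
  finally show ?thesis by (simp add: y_elt_def young_subgroup_eq[OF assms])
qed

lemma right_ideal_iff:
  assumes s: "s \<in> fcarrier n"
  shows "x \<in> hclass n q s <#\<^bsub>hecke n q\<^esub> carrier (hecke n q) \<longleftrightarrow>
    (\<exists>k\<in>fcarrier n. x = hclass n q (s * k))"
proof
  assume "x \<in> hclass n q s <#\<^bsub>hecke n q\<^esub> carrier (hecke n q)"
  then obtain y where y: "y \<in> carrier (hecke n q)" "x = hclass n q s \<otimes>\<^bsub>hecke n q\<^esub> y"
    unfolding l_coset_def by auto
  obtain k where "k \<in> fcarrier n" "y = hclass n q k" using hecke_carrierE[OF y(1)] .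
  then show "\<exists>k\<in>fcarrier n. x = hclass n q (s * k)"
    using y(2) s by (intro bexI[of _ k]) (simp_all add: hclass_mult)
next
  assume "\<exists>k\<in>fcarrier n. x = hclass n q (s * k)"
  then obtain k where "k \<in> fcarrier n" "x = hclass n q s \<otimes>\<^bsub>hecke n q\<^esub> hclass n q k"
    using s by (auto simp: hclass_mult)
  then show "x \<in> hclass n q s <#\<^bsub>hecke n q\<^esub> carrier (hecke n q)"
    unfolding l_coset_def using hclass_carrier[of k n q] by auto
qed

lemma perm_module_iff:
  assumes "composition n \<nu>"
  shows "x \<in> perm_module n q \<nu> \<longleftrightarrow> (\<exists>k\<in>fcarrier n. x = hclass n q (xp n \<nu> * k))"
  unfolding perm_module_def x_elt_eq[OF assms] by (rule right_ideal_iff[OF xp_fcarrier])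

text \<open>Left multiplication by \<open>h\<close>, where the double coset sum is \<open>h\<close>
  times x_mu, is a homomorphism with the required value at x_mu; it maps into
  \<open>perm_module n q \<nu>\<close> because the sum is also a right multiple of x_nu. Uniqueness
  holds because x_mu generates the module.\<close>

lemma phi_apply:
  fixes q :: "'a::field"
  assumes cm: "composition n \<mu>" and cn: "composition n \<nu>" and type: "tableau_of_type \<mu> \<nu> A"
    and k: "k \<in> fcarrier n"
  shows "phi n q \<mu> \<nu> A (hclass n q (xp n \<mu> * k)) = hclass n q (Tsum n 1 (contset n \<mu> \<nu> A) * k)"
proof -
  interpret R: ring "hecke n q" by (rule ring_hecke)
  let ?D = "contset n \<mu> \<nu> A" and ?M = "perm_module n q \<mu>" and ?N = "perm_module n q \<nu>"
  define s where "s = Tsum n (1::'a) ?D"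
  have s: "s \<in> fcarrier n" unfolding s_def by (intro Tsum_fcarrier contset_permutes)
  obtain h where h: "h \<in> fcarrier n" "hcong n q s (h * xp n \<mu>)"
    using Tsum_right[OF convex_rowof[OF cm], of ?D q 1] contset_permutes contset_closed(1)[OF cm cn type]
    unfolding s_def xp_def by blast
  obtain g where g: "g \<in> fcarrier n" "hcong n q s (xp n \<nu> * g)"
    using Tsum_left[OF convex_rowof[OF cn], of ?D q 1] contset_permutes contset_closed(2)[OF cm cn type]
    unfolding s_def xp_def by blast
  have sD: "(\<Oplus>\<^bsub>hecke n q\<^esub> w \<in> double_coset n \<nu> (perm_1 n \<mu> \<nu> A) \<mu>. T n q w) = hclass n q s"
    unfolding double_coset_eq_contset[OF cm cn type] s_def by (intro finsum_T contset_permutes)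
  note M = perm_module_iff[OF cm, of _ q]
  have xM: "x_elt n q \<mu> \<in> ?M"
    unfolding M x_elt_eq[OF cm] by (rule bexI[of _ 1]) auto
  have MH: "x \<in> carrier (hecke n q)" if "x \<in> ?M" for x using that unfolding M by auto
  \<comment> \<open>The restriction makes \<open>f\<close> undefined off the module, as the
    extensional function space in \<open>right_hom\<close> demands.\<close>
  define f where "f = restrict (\<lambda>x. hclass n q h \<otimes>\<^bsub>hecke n q\<^esub> x) ?M"
  have hc: "hclass n q h \<in> carrier (hecke n q)" using h by auto
  have f_eq: "f (hclass n q (xp n \<mu> * k)) = hclass n q (s * k)" if k: "k \<in> fcarrier n" for k
  proof -
    have "hclass n q (xp n \<mu> * k) \<in> ?M" unfolding M using k by blast
    then have "f (hclass n q (xp n \<mu> * k)) = hclass n q (h * (xp n \<mu> * k))"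
      using k h by (simp add: f_def hclass_mult xp_fcarrier mult_fcarrier)
    also have "\<dots> = hclass n q (s * k)"
      using k h s hcong_sym[OF hcong_mult_right[OF h(2) k]]
      by (subst hclass_eq_iff) (auto simp: mult.assoc)
    finally show ?thesis .
  qed
  have Madd: "x \<oplus>\<^bsub>hecke n q\<^esub> y \<in> ?M" if xy: "x \<in> ?M" "y \<in> ?M" for x y
  proof -
    obtain a where a: "a \<in> fcarrier n" "x = hclass n q (xp n \<mu> * a)" using iffD1[OF M xy(1)] by (rule bexE)
    obtain b where b: "b \<in> fcarrier n" "y = hclass n q (xp n \<mu> * b)" using iffD1[OF M xy(2)] by (rule bexE)
    have "x \<oplus>\<^bsub>hecke n q\<^esub> y = hclass n q (xp n \<mu> * (a + b))"
      using a b by (simp add: distrib_left hclass_add xp_fcarrier mult_fcarrier)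
    moreover have "a + b \<in> fcarrier n" using a b by auto
    ultimately show ?thesis unfolding M by blast
  qed
  have Mmult: "x \<otimes>\<^bsub>hecke n q\<^esub> y \<in> ?M" if xy: "x \<in> ?M" "y \<in> carrier (hecke n q)" for x y
  proof -
    obtain a where ab: "a \<in> fcarrier n" "x = hclass n q (xp n \<mu> * a)" using iffD1[OF M xy(1)] by (rule bexE)
    obtain b where b: "b \<in> fcarrier n" "y = hclass n q b" using hecke_carrierE[OF xy(2)] .
    have "x \<otimes>\<^bsub>hecke n q\<^esub> y = hclass n q (xp n \<mu> * (a * b))"
      using ab b by (simp add: hclass_mult xp_fcarrier mult_fcarrier mult.assoc[symmetric])
    moreover have "a * b \<in> fcarrier n" using ab b by auto
    ultimately show ?thesis unfolding M by blast
  qed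
  let ?P = "\<lambda>f. f \<in> right_hom n q ?M ?N \<and> f (x_elt n q \<mu>) = hclass n q s"
  have "f \<in> ?M \<rightarrow>\<^sub>E ?N"
  proof
    fix x assume "x \<in> ?M"
    then obtain a where a: "a \<in> fcarrier n" "x = hclass n q (xp n \<mu> * a)"
      unfolding M by (rule bexE)
    then have "f x = hclass n q (s * a)" using f_eq by simp
    also have "\<dots> = hclass n q (xp n \<nu> * (g * a))"
      using a s g hcong_mult_right[OF g(2) a(1)] by (subst hclass_eq_iff) (auto simp: mult.assoc)
    finally show "f x \<in> ?N" unfolding perm_module_iff[OF cn] using a g by (intro bexI[of _ "g * a"]) auto
  qed (simp add: f_def)
  moreover have "f (x \<oplus>\<^bsub>hecke n q\<^esub> y) = f x \<oplus>\<^bsub>hecke n q\<^esub> f y" if "x \<in> ?M" "y \<in> ?M" for x y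
    using that MH hc Madd by (simp add: f_def R.r_distr)
  moreover have "f (x \<otimes>\<^bsub>hecke n q\<^esub> y) = f x \<otimes>\<^bsub>hecke n q\<^esub> y"
    if "x \<in> ?M" "y \<in> carrier (hecke n q)" for x y
    using that MH hc Mmult by (simp add: f_def R.m_assoc)
  moreover have "f (x_elt n q \<mu>) = hclass n q s"
    using f_eq[of 1] by (simp add: x_elt_eq[OF cm])
  ultimately have fP: "?P f" unfolding right_hom_def by blast
  have "f' = f" if P: "?P f'" for f'
  proof
    fix x
    show "f' x = f x"
    proof (cases "x \<in> ?M")
      case True
      then obtain a where a: "a \<in> fcarrier n" "x = hclass n q (xp n \<mu> * a)"
      unfolding M by (rule bexE)
      then have x: "x = x_elt n q \<mu> \<otimes>\<^bsub>hecke n q\<^esub> hclass n q a"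
        by (simp add: hclass_mult xp_fcarrier x_elt_eq[OF cm])
      then have "f' x = f' (x_elt n q \<mu>) \<otimes>\<^bsub>hecke n q\<^esub> hclass n q a"
        using P xM hclass_carrier[OF a(1)] unfolding right_hom_def by blast
      also have "\<dots> = f (x_elt n q \<mu>) \<otimes>\<^bsub>hecke n q\<^esub> hclass n q a" using P fP by simp
      also have "\<dots> = f x"
        using x fP xM hclass_carrier[OF a(1)] unfolding right_hom_def by blast
      finally show ?thesis .
    next
      case False
      then show ?thesis using P fP unfolding right_hom_def by (auto simp: PiE_def extensional_def)
    qed
  qed
  then have "phi n q \<mu> \<nu> A = f" unfolding phi_def sD using fP by (intro the_equality) blast+
  then show ?thesis using f_eq[OF k] by (simp add: s_def)
qed

section \<open>A block of consecutive rows\<close>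

text \<open>The colour \<open>0\<close> is free for the block because entries start at
  \<open>1\<close>. All other classes are singletons, so the colour group is the symmetric group on
  the block.\<close>

definition block_col :: "nat \<Rightarrow> nat \<Rightarrow> nat \<Rightarrow> nat" where
  "block_col a k p = (if p \<in> {a + 1..a + k} then 0 else p)"

lemma convex_block_col: "convex_col n (block_col a k)"
  by (auto simp: convex_col_def block_col_def split: if_splits)

lemma block_memE:
  fixes a k p :: nat
  assumes "p \<in> {a + 1..a + k}"
  obtains x where "x \<in> {1..k}" "p = a + x"
  using assms by (intro that[of "p - a"]) auto

lemma permutes_block:
  assumes "z permutes {a + 1..a + k}"
  obtains w where "w permutes {1..k}" "z = shift_perm a k w"
proof -
  define w where "w x = (if x \<in> {1..k} then z (a + x) - a else x)" for x
  have zm: "z p \<in> {a + 1..a + k}" if "p \<in> {a + 1..a + k}" for p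
    using that permutes_in_image[OF assms] by blast
  have "inj_on w {1..k}"
  proof (rule inj_onI)
    fix x y assume xy: "x \<in> {1..k}" "y \<in> {1..k}" "w x = w y"
    then have "z (a + x) = z (a + y)"
      using zm[of "a + x"] zm[of "a + y"] by (simp add: w_def eq_diff_iff)
    then show "x = y" using permutes_inj[OF assms] by (simp add: inj_eq)
  qed
  moreover have "w ` {1..k} \<subseteq> {1..k}"
  proof clarify
    fix x assume "x \<in> {1..k}"
    then show "w x \<in> {1..k}" using zm[of "a + x"] by (auto simp: w_def)
  qed
  ultimately have "bij_betw w {1..k} {1..k}"
    using endo_inj_surj[of "{1..k}" w] by (simp add: bij_betw_def)
  then have "w permutes {1..k}"
    by (rule bij_imp_permutes) (simp only: w_def if_False)
  moreover have "z p = shift_perm a k w p" for p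
  proof (cases "p \<in> {a + 1..a + k}")
    case True
    then obtain x where "x \<in> {1..k}" "p = a + x" by (rule block_memE)
    then show ?thesis using zm[OF True] by (simp add: shift_perm_apply w_def)
  next
    case False
    then show ?thesis using permutes_not_in[OF assms False] shift_perm_outside[OF False] by simp
  qed
  ultimately show ?thesis using that by blast
qed

lemma col_group_fixing_block:
  assumes "z \<in> col_group n c" "\<And>p. p \<in> {1..n} \<Longrightarrow> p \<notin> {a + 1..a + k} \<Longrightarrow> z p = p"
  obtains w where "w permutes {1..k}" "z = shift_perm a k w"
proof -
  have "z permutes {a + 1..a + k}"
    by (rule permutes_superset[OF col_group_permutes[OF assms(1)]]) (use assms(2) in blast)
  then show ?thesis using that by (elim permutes_block)
qed

lemma col_group_block_col:
  assumes "z \<in> col_group n (block_col a k)"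
  obtains w where "w permutes {1..k}" "z = shift_perm a k w"
proof (rule col_group_fixing_block[OF assms])
  fix p assume p: "p \<in> {1..n}" "p \<notin> {a + 1..a + k}"
  then have "block_col a k (z p) = p" using col_group_col[OF assms p(1)] by (simp add: block_col_def)
  then show "z p = p" using p(1) by (auto simp: block_col_def split: if_splits)
qed (rule that)

lemma shift_perm_block_col:
  assumes "w permutes {1..k}" "a + k \<le> n"
  shows "shift_perm a k w \<in> col_group n (block_col a k)"
proof -
  have "block_col a k (shift_perm a k w p) = block_col a k p" for p
  proof (cases "p \<in> {a + 1..a + k}")
    case True
    then have "shift_perm a k w p \<in> {a + 1..a + k}"
      using permutes_in_image[OF shift_perm_permutes(1)[OF assms]] by blast
    then show ?thesis using True by (simp only: block_col_def if_True)
  next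
    case False
    then show ?thesis by (simp only: shift_perm_outside[OF False])
  qed
  then show ?thesis using shift_perm_permutes(2)[OF assms] by (simp add: col_group_def)
qed

lemma pinv_shift_perm:
  assumes "w permutes {1..k}" "a + k \<le> n"
  shows "x \<in> {1..k} \<Longrightarrow> pinv (shift_perm a k w) (a + x) = a + pinv w x"
    and "p \<notin> {a + 1..a + k} \<Longrightarrow> pinv (shift_perm a k w) p = p"
proof -
  note s = shift_perm_permutes(2)[OF assms]
  show "pinv (shift_perm a k w) (a + x) = a + pinv w x" if "x \<in> {1..k}"
    using pinv_mem[OF assms(1) that] permutes_inverses(1)[OF assms(1), of x]
    by (simp add: permutes_inv_eq[OF s] shift_perm_apply)
  show "pinv (shift_perm a k w) p = p" if "p \<notin> {a + 1..a + k}"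
    using shift_perm_outside[OF that] by (simp add: permutes_inv_eq[OF s])
qed

text \<open>A weakly increasing function on \<open>{1..k}\<close> is a sorted list, and a sorted
  list is determined by its multiset of elements.\<close>

lemma mono_mset_eq_imp_eq:
  fixes f g :: "nat \<Rightarrow> nat"
  assumes "\<And>x y. x \<in> {1..k} \<Longrightarrow> y \<in> {1..k} \<Longrightarrow> x \<le> y \<Longrightarrow> f x \<le> f y"
    and "\<And>x y. x \<in> {1..k} \<Longrightarrow> y \<in> {1..k} \<Longrightarrow> x \<le> y \<Longrightarrow> g x \<le> g y"
    and "image_mset f (mset_set {1..k}) = image_mset g (mset_set {1..k})" "x \<in> {1..k}"
  shows "f x = g x"
proof -
  have sorted: "sorted (map h [1..<Suc k])"
    if "\<And>x y. x \<in> {1..k} \<Longrightarrow> y \<in> {1..k} \<Longrightarrow> x \<le> y \<Longrightarrow> h x \<le> h y" for h :: "nat \<Rightarrow> nat"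
    by (auto simp: sorted_iff_nth_mono nth_append intro!: that simp del: upt_Suc)
  have mset: "mset (map h [1..<Suc k]) = image_mset h (mset_set {1..k})" for h :: "nat \<Rightarrow> nat"
    by (simp add: atLeastLessThanSuc_atLeastAtMost flip: mset_set_upto_eq_mset_upto del: upt_Suc)
  have "map f [1..<Suc k] = map g [1..<Suc k]"
  proof -
    have "sorted (map f [1..<Suc k])" "sorted (map g [1..<Suc k])"
      by (rule sorted, erule (2) assms(1), rule sorted, erule (2) assms(2))
    moreover have "mset (map f [1..<Suc k]) = mset (map g [1..<Suc k])" unfolding mset by (rule assms(3))
    ultimately show ?thesis by (metis properties_for_sort)
  qed
  then show ?thesis using assms(4) by (auto simp del: upt_Suc)
qed

locale row_block =
  fixes n l m :: nat and \<mu> :: "nat \<Rightarrow> nat"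
  assumes part: "is_partition n \<mu>" and l: "1 \<le> l" and lm: "l \<le> m"
begin

definition "\<mu>t = rows_from_to l m \<mu>"
definition "nt = comp_size \<mu>t"
text \<open>Rows \<open>l\<close> to \<open>m\<close> of the row tableau hold exactly the entries
  from \<open>start + 1\<close> to \<open>start + nt\<close>.\<close>

definition "start = psum \<mu> l"

lemma comp: "composition n \<mu>"
  by (rule is_partition_composition[OF part])

lemma mut_eq: "1 \<le> i \<Longrightarrow> l + i \<le> Suc m \<Longrightarrow> \<mu>t i = \<mu> (l + i - 1)"
  "\<not> (1 \<le> i \<and> l + i \<le> Suc m) \<Longrightarrow> \<mu>t i = 0"
  by (auto simp: \<mu>t_def rows_from_to_def)

lemma mut_diagram:
  "(i, j) \<in> diagram \<mu>t \<longleftrightarrow> 1 \<le> i \<and> l + i \<le> Suc m \<and> (l + i - 1, j) \<in> diagram \<mu>"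
  using l mut_eq[of i] by (cases "1 \<le> i \<and> l + i \<le> Suc m") (auto simp: diagram_def)

lemma part_mut: "is_partition nt \<mu>t"
proof -
  have "i \<in> {1..Suc m}" if "\<mu>t i \<noteq> 0" for i
    using that mut_eq(2)[of i] by (cases "1 \<le> i \<and> l + i \<le> Suc m") auto
  then have "{i. \<mu>t i \<noteq> 0} \<subseteq> {1..Suc m}" by blast
  then have "finite {i. \<mu>t i \<noteq> 0}" by (rule finite_subset) simp
  then have "composition nt \<mu>t" using mut_eq(2)[of 0] by (simp add: composition_def nt_def)
  moreover have "\<mu>t (i + 1) \<le> \<mu>t i" if "1 \<le> i" for i
    using that mut_eq[of i] mut_eq[of "i + 1"] partition_antimono[OF part, of "l + i - 1" "l + i"] l
    by (cases "l + i \<le> m") auto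
  ultimately show ?thesis by (simp add: is_partition_def)
qed

lemma comp_mut: "composition nt \<mu>t"
  by (rule is_partition_composition[OF part_mut])

lemma psum_mut:
  assumes "1 \<le> i" "l + i \<le> Suc (Suc m)"
  shows "psum \<mu> (l + i - 1) = start + psum \<mu>t i"
  using assms
proof (induction i rule: dec_induct)
  case base
  then show ?case by (simp add: start_def psum_def)
next
  case (step i)
  have "psum \<mu> (l + Suc i - 1) = psum \<mu> (Suc (l + i - 1))" using l by (simp add: One_nat_def)
  also have "\<dots> = psum \<mu> (l + i - 1) + \<mu> (l + i - 1)" using l step by (intro psum_Suc) auto
  also have "\<dots> = start + psum \<mu>t i + \<mu>t i" using step mut_eq(1)[of i] by auto
  also have "\<dots> = start + psum \<mu>t (Suc i)" using step by (simp add: psum_Suc)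
  finally show ?case .
qed

lemma psum_mut_large:
  assumes "Suc (Suc m) \<le> l + i"
  shows "psum \<mu>t i = nt"
proof -
  obtain N where N: "psum \<mu>t (Suc N) = nt" using psum_ends(2)[OF comp_mut] by blast
  have eq: "psum \<mu>t (i + d) = psum \<mu>t i" for d
  proof (induction d)
    case (Suc d)
    have "psum \<mu>t (Suc (i + d)) = psum \<mu>t (i + d) + \<mu>t (i + d)"
      using assms lm by (intro psum_Suc) auto
    then show ?case using Suc mut_eq(2)[of "i + d"] assms by simp
  qed simp
  have "nt \<le> psum \<mu>t (i + Suc N)" using psum_mono[of "Suc N" "i + Suc N" \<mu>t] N by simp
  then show ?thesis using eq psum_ends(1)[OF comp_mut, of i] by (metis le_antisym)
qed

lemma start_nt: "start + nt = psum \<mu> (Suc m)" "start + nt \<le> n"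
proof -
  show "start + nt = psum \<mu> (Suc m)"
    using psum_mut[of "Suc (Suc m) - l"] psum_mut_large[of "Suc (Suc m) - l"] lm by simp
  then show "start + nt \<le> n" using psum_ends(1)[OF comp, of "Suc m"] by simp
qed

lemma rowof_mut:
  assumes "k \<in> {1..nt}"
  shows "1 \<le> rowof \<mu>t k" "l + rowof \<mu>t k \<le> Suc m"
    "rowof \<mu> (start + k) = l + rowof \<mu>t k - 1"
    "cellof \<mu> (start + k) = (l + rowof \<mu>t k - 1, snd (cellof \<mu>t k))"
proof -
  note b = rowof_bounds[OF comp_mut assms]
  show b1: "1 \<le> rowof \<mu>t k" by (rule b)
  show b2: "l + rowof \<mu>t k \<le> Suc m"
    using psum_mut_large[of "rowof \<mu>t k"] b(2) assms by (cases "l + rowof \<mu>t k \<le> Suc m") auto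
  have p1: "psum \<mu> (l + rowof \<mu>t k - 1) = start + psum \<mu>t (rowof \<mu>t k)"
    using b1 b2 by (intro psum_mut) auto
  have p2: "psum \<mu> (l + Suc (rowof \<mu>t k) - 1) = start + psum \<mu>t (Suc (rowof \<mu>t k))"
    using b1 b2 by (intro psum_mut) auto
  have "l + Suc (rowof \<mu>t k) - 1 = Suc (l + rowof \<mu>t k - 1)" using l by simp
  then show r: "rowof \<mu> (start + k) = l + rowof \<mu>t k - 1"
    using p1 p2 b l by (intro rowof_eqI) auto
  show "cellof \<mu> (start + k) = (l + rowof \<mu>t k - 1, snd (cellof \<mu>t k))"
    unfolding cellof_def r using p1 by simp
qed

lemma block_iff:
  assumes "p \<in> {1..n}"
  shows "p \<in> {start + 1..start + nt} \<longleftrightarrow> rowof \<mu> p \<in> {l..m}"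
proof
  assume "p \<in> {start + 1..start + nt}"
  then obtain k where "k \<in> {1..nt}" "p = start + k" by (rule block_memE)
  then show "rowof \<mu> p \<in> {l..m}" using rowof_mut[of k] by auto
next
  assume r: "rowof \<mu> p \<in> {l..m}"
  note b = rowof_bounds[OF comp assms]
  have "psum \<mu> l \<le> psum \<mu> (rowof \<mu> p)" "psum \<mu> (Suc (rowof \<mu> p)) \<le> psum \<mu> (Suc m)"
    using r by (auto intro: psum_mono)
  then show "p \<in> {start + 1..start + nt}" using b start_nt by (auto simp: start_def)
qed

lemma block_mem: "k \<in> {1..nt} \<Longrightarrow> start + k \<in> {1..n}"
  using start_nt(2) by auto

abbreviation bcol :: "nat \<Rightarrow> nat" where "bcol \<equiv> block_col start nt"

abbreviation sh :: "(nat \<Rightarrow> nat) \<Rightarrow> nat \<Rightarrow> nat" where "sh \<equiv> shift_perm start nt"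

lemma sh_permutes: "z permutes {1..nt} \<Longrightarrow> sh z permutes {1..n}"
  using shift_perm_permutes(2) start_nt(2) by blast

subsection \<open>Factorization of the double coset\<close>

text \<open>Translation by \<open>start\<close> carries row \<open>Suc i - l\<close> of the
  shortened row tableau onto row \<open>i\<close> and intertwines \<open>z\<close> with
  \<open>sh z\<close>; what remains is \<open>c\<close> seen through \<open>pinv d\<close>.\<close>

lemma card_rows_block:
  assumes z: "z permutes {1..nt}" and d: "d permutes {1..n}" and i: "i \<in> {l..m}"
  shows "card {p \<in> {1..n}. rowof \<mu> p = i \<and> c (pinv (sh z \<circ> d) p) = r} =
    card {k \<in> {1..nt}. rowof \<mu>t k = Suc i - l \<and> c (pinv d (start + pinv z k)) = r}"
proof -
  have s: "sh z permutes {1..n}" by (rule sh_permutes[OF z])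
  have "{p \<in> {1..n}. rowof \<mu> p = i \<and> c (pinv (sh z \<circ> d) p) = r} =
      (+) start ` {k \<in> {1..nt}. rowof \<mu>t k = Suc i - l \<and> c (pinv d (start + pinv z k)) = r}" (is "?L = ?R")
  proof (intro Set.set_eqI iffI)
    fix p assume p: "p \<in> ?L"
    then have "p \<in> {start + 1..start + nt}" using i block_iff[of p] by simp
    then obtain k where k: "k \<in> {1..nt}" "p = start + k" by (rule block_memE)
    have "rowof \<mu>t k = Suc i - l" using p rowof_mut[OF k(1)] k(2) l by auto
    moreover have "c (pinv d (start + pinv z k)) = r"
      using p k pinv_shift_perm(1)[OF z start_nt(2) k(1)] by (simp add: pinv_comp[OF s d])
    ultimately show "p \<in> ?R" using k by blast
  next
    fix p assume "p \<in> ?R"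
    then obtain k where k: "k \<in> {1..nt}" "p = start + k" "rowof \<mu>t k = Suc i - l"
      "c (pinv d (start + pinv z k)) = r" by blast
    have "rowof \<mu> p = i" using rowof_mut(3)[OF k(1)] k i by auto
    then show "p \<in> ?L"
      using k block_mem[OF k(1)] pinv_shift_perm(1)[OF z start_nt(2) k(1)] by (simp add: pinv_comp[OF s d])
  qed
  then show ?thesis by (simp add: card_image)
qed

lemma card_rows_outside:
  assumes z: "z permutes {1..nt}" and d: "d permutes {1..n}" and i: "i \<notin> {l..m}"
  shows "{p \<in> {1..n}. rowof \<mu> p = i \<and> c (pinv (sh z \<circ> d) p) = r} =
    {p \<in> {1..n}. rowof \<mu> p = i \<and> c (pinv d p) = r}"
proof -
  have "pinv (sh z \<circ> d) p = pinv d p" if "p \<in> {1..n}" "rowof \<mu> p = i" for p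
  proof -
    have "p \<notin> {start + 1..start + nt}" using that i block_iff by blast
    then show ?thesis
      using pinv_shift_perm(2)[OF z start_nt(2)] by (simp add: pinv_comp[OF sh_permutes[OF z] d])
  qed
  then show ?thesis by auto
qed

text \<open>
  The third condition records that, \<open>pinv d\<close> being increasing on the block, the rows of \<open>\<nu>\<close> met
  there form a weakly increasing sequence whose content is that of the shortened tableau.
\<close>

definition outer_reps ::
  "(nat \<Rightarrow> nat) \<Rightarrow> (nat \<Rightarrow> nat) \<Rightarrow> (nat \<times> nat \<Rightarrow> nat) \<Rightarrow> (nat \<Rightarrow> nat) set" where
  "outer_reps \<nu> \<nu>t A = {d. d permutes {1..n} \<and> col_increasing n bcol (pinv d) \<and>
     (\<forall>k\<in>{1..nt}. rowof \<nu> (pinv d (start + k)) = rowof \<nu>t k) \<and>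
     (\<forall>i r. i \<notin> {l..m} \<longrightarrow> card {p \<in> {1..n}. rowof \<mu> p = i \<and> rowof \<nu> (pinv d p) = r} =
       card {j. (i, j) \<in> diagram \<mu> \<and> A (i, j) = r})}"

text \<open>Write \<open>w = sh z \<circ> d\<close> with \<open>pinv d\<close> increasing on the
  block. The outer rows see \<open>d\<close> alone. On the block the rows met through
  \<open>d\<close> form a weakly increasing sequence with the same multiset as the entries of
  \<open>At\<close>, so this sequence is \<open>rowof \<nu>t\<close>; substituting it turns the
  remaining conditions into the table of \<open>z\<close> for \<open>At\<close>.\<close>

lemma contset_factor:
  assumes cn: "composition n \<nu>" and ct: "composition nt \<nu>t" and type: "tableau_of_type \<mu>t \<nu>t At"
    and At: "At = tableau_from_row l A"
  shows "contset n \<mu> \<nu> A = {z \<circ> d | z d. z \<in> sh ` contset nt \<mu>t \<nu>t At \<and> d \<in> outer_reps \<nu> \<nu>t A}"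
proof (intro Set.set_eqI iffI)
  have cells: "{j. (i, j) \<in> diagram \<mu> \<and> A (i, j) = r} =
      {j. (Suc i - l, j) \<in> diagram \<mu>t \<and> At (Suc i - l, j) = r}" if "i \<in> {l..m}" for i r
    using that by (auto simp: mut_diagram At tableau_from_row_def)
  {
    fix w assume wc: "w \<in> contset n \<mu> \<nu> A"
    have w: "w permutes {1..n}" by (rule contset_permutes[OF wc])
    have counts: "card {p \<in> {1..n}. rowof \<mu> p = i \<and> rowof \<nu> (pinv w p) = r} =
        card {j. (i, j) \<in> diagram \<mu> \<and> A (i, j) = r}" for i r
      using wc unfolding contset_def by blast
    obtain d z' where dz': "d permutes {1..n}" "col_increasing n bcol (pinv d)" "z' \<in> col_group n bcol"
        "w = z' \<circ> d"
      using ex_col_increasing_right[OF convex_block_col w] .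
    obtain z where z: "z permutes {1..nt}" "z' = sh z" using col_group_block_col[OF dz'(3)] .
    note d = dz'(1,2) and wz = dz'(4)[unfolded z(2)]
    \<comment> \<open>\<open>c\<close> lists the rows of \<nu> that the block meets through
      \<open>d\<close>; the aim is to identify it with \<open>rowof \<nu>t\<close>, whatever
      \<open>w\<close> was.\<close>
    define c where "c k = rowof \<nu> (pinv d (start + k))" for k
    have tcounts: "card {k \<in> {1..nt}. rowof \<mu>t k = i \<and> c (pinv z k) = r} =
        card {k \<in> {1..nt}. rowof \<mu>t k = i \<and> At (cellof \<mu>t k) = r}" for i r
    proof (cases "1 \<le> i \<and> l + i \<le> Suc m")
      case True
      have im: "l + i - 1 \<in> {l..m}" using True by auto
      have iS: "Suc (l + i - 1) - l = i" using True l by auto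
      show ?thesis
        using counts[of "l + i - 1" r] card_rows_block[OF z(1) d(1) im, of "rowof \<nu>" r]
        unfolding wz c_def cells[OF im] iS card_row_cells[OF comp_mut] by simp
    next
      case False
      \<comment> \<open>Such an \<open>i\<close> is not a row of the truncated diagram, so both sets
        are empty.\<close>
      then show ?thesis using rowof_mut(1,2) by (intro arg_cong[of _ _ card]) auto
    qed
    have pz: "pinv z permutes {1..nt}" by (rule permutes_inv[OF z(1)])
    have eq: "image_mset (\<lambda>k. (rowof \<mu>t k, c (pinv z k))) (mset_set {1..nt}) =
        image_mset (\<lambda>k. (rowof \<mu>t k, At (cellof \<mu>t k))) (mset_set {1..nt})"
    proof (rule multiset_eqI)
      fix ir :: "nat \<times> nat"
      obtain i r where ir: "ir = (i, r)" by force
      show "count (image_mset (\<lambda>k. (rowof \<mu>t k, c (pinv z k))) (mset_set {1..nt})) ir =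
        count (image_mset (\<lambda>k. (rowof \<mu>t k, At (cellof \<mu>t k))) (mset_set {1..nt})) ir"
        using tcounts[of i r] by (simp add: count_image_mset_eq_card_vimage ir)
    qed
    \<comment> \<open>Permuting the arguments by \<open>pinv z\<close> does not change the multiset,
      and forgetting the row indices in \<open>eq\<close> leaves the entries of
      \<open>At\<close>.\<close>
    have "image_mset c (mset_set {1..nt}) = image_mset c (image_mset (pinv z) (mset_set {1..nt}))"
      by (simp add: permutes_image[OF pz] image_mset_mset_set permutes_inj_on[OF pz])
    also have "\<dots> = image_mset snd (image_mset (\<lambda>k. (rowof \<mu>t k, c (pinv z k))) (mset_set {1..nt}))"
      by (simp add: multiset.map_comp o_def)
    also have "\<dots> = image_mset (\<lambda>k. At (cellof \<mu>t k)) (mset_set {1..nt})"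
      unfolding eq by (simp add: multiset.map_comp o_def)
    also have "\<dots> = image_mset (rowof \<nu>t) (mset_set {1..nt})"
      by (rule tableau_mset_eq[OF comp_mut ct type, symmetric])
    finally have mset: "image_mset c (mset_set {1..nt}) = image_mset (rowof \<nu>t) (mset_set {1..nt})" .
    have c: "c k = rowof \<nu>t k" if k: "k \<in> {1..nt}" for k
    proof (rule mono_mset_eq_imp_eq[OF _ _ mset k])
      fix x y assume xy: "x \<in> {1..nt}" "y \<in> {1..nt}" "x \<le> y"
      show "rowof \<nu>t x \<le> rowof \<nu>t y" by (rule rowof_mono[OF ct xy(2,3)])
      have "pinv d (start + x) \<le> pinv d (start + y)"
      proof (cases "x = y")
        case False
        then have "start + x < start + y" "bcol (start + x) = bcol (start + y)"
          using xy by (auto simp: block_col_def)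
        then show ?thesis using d(2) block_mem[OF xy(1)] block_mem[OF xy(2)]
          unfolding col_increasing_def by (metis less_imp_le)
      qed simp
      then show "c x \<le> c y"
        unfolding c_def by (rule rowof_mono[OF cn pinv_mem[OF d(1) block_mem[OF xy(2)]]])
    qed
    have "z \<in> contset nt \<mu>t \<nu>t At"
    proof -
      have "{k \<in> {1..nt}. rowof \<mu>t k = i \<and> rowof \<nu>t (pinv z k) = r} =
          {k \<in> {1..nt}. rowof \<mu>t k = i \<and> c (pinv z k) = r}" for i r
        using c pinv_mem[OF z(1)] by auto
      then show ?thesis
        using tcounts z(1) unfolding contset_def card_row_cells[OF comp_mut] by simp
    qed
    moreover have "d \<in> outer_reps \<nu> \<nu>t A"
    proof -
      have "card {p \<in> {1..n}. rowof \<mu> p = i \<and> rowof \<nu> (pinv d p) = r} =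
          card {j. (i, j) \<in> diagram \<mu> \<and> A (i, j) = r}" if "i \<notin> {l..m}" for i r
        using counts[of i r] card_rows_outside[OF z(1) d(1) that, of "rowof \<nu>" r] unfolding wz by simp
      then show ?thesis using d c unfolding outer_reps_def c_def by blast
    qed
    ultimately show "w \<in> {z \<circ> d | z d. z \<in> sh ` contset nt \<mu>t \<nu>t At \<and> d \<in> outer_reps \<nu> \<nu>t A}"
      using wz by blast
  next
    fix w assume "w \<in> {z \<circ> d | z d. z \<in> sh ` contset nt \<mu>t \<nu>t At \<and> d \<in> outer_reps \<nu> \<nu>t A}"
    then obtain z d where zd: "z \<in> contset nt \<mu>t \<nu>t At" "d \<in> outer_reps \<nu> \<nu>t A" "w = sh z \<circ> d" by blast
    have z: "z permutes {1..nt}" by (rule contset_permutes[OF zd(1)])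
    have d: "d permutes {1..n}" and c: "\<And>k. k \<in> {1..nt} \<Longrightarrow> rowof \<nu> (pinv d (start + k)) = rowof \<nu>t k"
      and out: "\<And>i r. i \<notin> {l..m} \<Longrightarrow> card {p \<in> {1..n}. rowof \<mu> p = i \<and> rowof \<nu> (pinv d p) = r} =
       card {j. (i, j) \<in> diagram \<mu> \<and> A (i, j) = r}"
      using zd(2) unfolding outer_reps_def by blast+
    have "w permutes {1..n}" unfolding zd(3) by (rule permutes_compose[OF d sh_permutes[OF z]])
    moreover have "card {p \<in> {1..n}. rowof \<mu> p = i \<and> rowof \<nu> (pinv w p) = r} =
        card {j. (i, j) \<in> diagram \<mu> \<and> A (i, j) = r}" for i r
    proof (cases "i \<in> {l..m}")
      case True
      have "{k \<in> {1..nt}. rowof \<mu>t k = Suc i - l \<and> rowof \<nu> (pinv d (start + pinv z k)) = r} =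
          {k \<in> {1..nt}. rowof \<mu>t k = Suc i - l \<and> rowof \<nu>t (pinv z k) = r}"
        using c pinv_mem[OF z] by auto
      moreover have "card {k \<in> {1..nt}. rowof \<mu>t k = Suc i - l \<and> rowof \<nu>t (pinv z k) = r} =
          card {j. (Suc i - l, j) \<in> diagram \<mu>t \<and> At (Suc i - l, j) = r}"
        using zd(1) unfolding contset_def by blast
      ultimately show ?thesis
        using card_rows_block[OF z d True, of "rowof \<nu>" r] unfolding zd(3) cells[OF True] by simp
    next
      case False
      show ?thesis
        using card_rows_outside[OF z d False, of "rowof \<nu>" r] out[OF False] unfolding zd(3) by simp
    qed
    ultimately show "w \<in> contset n \<mu> \<nu> A" unfolding contset_def by blast
  }
qed

lemma Tsum_contset_factor:
  assumes "composition n \<nu>" "composition nt \<nu>t" "tableau_of_type \<mu>t \<nu>t At" "At = tableau_from_row l A"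
  shows "hcong n q (Tsum n 1 (contset n \<mu> \<nu> A))
    (Tsum n 1 (outer_reps \<nu> \<nu>t A) * shift start (Tsum nt 1 (contset nt \<mu>t \<nu>t At)))"
proof -
  have "sh ` contset nt \<mu>t \<nu>t At \<subseteq> col_group n bcol"
    using shift_perm_block_col[OF _ start_nt(2)] contset_permutes by blast
  then have "hcong n q (Tsum n 1 (contset n \<mu> \<nu> A))
      (Tsum n 1 (outer_reps \<nu> \<nu>t A) * Tsum n 1 (sh ` contset nt \<mu>t \<nu>t At))"
    unfolding contset_factor[OF assms]
    by (intro Tsum_right_subset[OF convex_block_col]) (auto simp: outer_reps_def)
  also have "hcong n q \<dots> (Tsum n 1 (outer_reps \<nu> \<nu>t A) * shift start (Tsum nt 1 (contset nt \<mu>t \<nu>t At)))"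
    using start_nt(2) contset_permutes
    by (intro hcong_mult_left hcong_sym[OF shift_Tsum] Tsum_fcarrier) (auto simp: outer_reps_def)
  finally show ?thesis .
qed

subsection \<open>Factorization of the generator of the Specht module\<close>

definition "W = perm_w n \<mu>"
definition "Wt = perm_w nt \<mu>t"
text \<open>What is left of \<open>W\<close> once the block has been renumbered from row order to
  column order; \<open>sh Wt\<close> is applied first.\<close>

definition "W' = W \<circ> pinv (sh Wt)"

section \<open>Data shared by the tableaux that agree outside the block\<close>

lemma content_mut:
  "content \<mu>t (tableau_from_row l A) s = card {x \<in> diagram \<mu>. fst x \<in> {l..m} \<and> A x = s}"
  unfolding content_def
proof (rule bij_betw_same_card)
  show "bij_betw (\<lambda>(i, j). (l + i - 1, j)) {x \<in> diagram \<mu>t. tableau_from_row l A x = s}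
      {x \<in> diagram \<mu>. fst x \<in> {l..m} \<and> A x = s}"
    by (rule bij_betw_byWitness[where f' = "\<lambda>(i, j). (Suc i - l, j)"])
      (use l in \<open>auto simp: mut_diagram tableau_from_row_def\<close>)
qed

text \<open>The second summand is the same for all the given tableaux, so the shortened ones share a
  type.\<close>

lemma content_split:
  "content \<mu> A s = content \<mu>t (tableau_from_row l A) s +
    card {x \<in> diagram \<mu>. fst x \<notin> {l..m} \<and> A x = s}"
proof -
  let ?B = "{x \<in> diagram \<mu>. fst x \<in> {l..m} \<and> A x = s}"
  let ?C = "{x \<in> diagram \<mu>. fst x \<notin> {l..m} \<and> A x = s}"
  have "card (?B \<union> ?C) = card ?B + card ?C"
    using finite_diagram[OF comp] by (intro card_Un_disjoint) auto
  moreover have "?B \<union> ?C = {x \<in> diagram \<mu>. A x = s}" by auto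
  ultimately show ?thesis unfolding content_mut content_def[of \<mu>] by simp
qed

text \<open>Makes the left factor \<Theta> independent of the tableau: besides
  \<open>\<nu>t\<close>, only rows outside the block enter its definition.\<close>

lemma outer_reps_cong:
  assumes "\<And>i j. (i, j) \<in> diagram \<mu> \<Longrightarrow> i \<notin> {l..m} \<Longrightarrow> A (i, j) = B (i, j)"
  shows "outer_reps \<nu> \<nu>t A = outer_reps \<nu> \<nu>t B"
proof -
  have "{j. (i, j) \<in> diagram \<mu> \<and> A (i, j) = r} = {j. (i, j) \<in> diagram \<mu> \<and> B (i, j) = r}"
    if "i \<notin> {l..m}" for i r using assms that by auto
  then show ?thesis unfolding outer_reps_def by simp
qed

section \<open>The part of the column permutation that remains outside the block factor\<close>

lemma W: "W permutes {1..n}" and Wt: "Wt permutes {1..nt}" and W': "W' permutes {1..n}"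
proof -
  show 1: "W permutes {1..n}" unfolding W_def by (rule perm_w_props(1)[OF part])
  show 2: "Wt permutes {1..nt}" unfolding Wt_def by (rule perm_w_props(1)[OF part_mut])
  show "W' permutes {1..n}" unfolding W'_def
    by (rule permutes_compose[OF permutes_inv[OF sh_permutes[OF 2]] 1])
qed

lemma W_eq: "W = W' \<circ> sh Wt"
  unfolding W'_def using permutes_inv_o(2)[OF sh_permutes[OF Wt]] by (simp add: comp_assoc)

abbreviation "colrow \<equiv> cellof (conjugate \<mu>)"
abbreviation "colrow_t \<equiv> cellof (conjugate \<mu>t)"

lemma colrow_column_tableau: "(i, j) \<in> diagram \<mu> \<Longrightarrow> colrow (column_tableau \<mu> (i, j)) = (j, i)"
  using cellof_row_tableau[of "(j, i)" "conjugate \<mu>"] diagram_conjugate[OF part]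
  by (simp add: column_tableau_eq)

lemma colrow_t_mem:
  assumes "k \<in> {1..nt}" "colrow_t k = (j, i)"
  shows "(i, j) \<in> diagram \<mu>t" "k = column_tableau \<mu>t (i, j)"
    "(l + i - 1, j) \<in> diagram \<mu>" "l + i - 1 \<in> {l..m}"
proof -
  note c = cellof_diagram[OF composition_conjugate[OF part_mut] assms(1)]
  show "(i, j) \<in> diagram \<mu>t" using c(1) assms(2) diagram_conjugate[OF part_mut] by simp
  then show "(l + i - 1, j) \<in> diagram \<mu>" "l + i - 1 \<in> {l..m}" by (auto simp: mut_diagram)
  show "k = column_tableau \<mu>t (i, j)" using c(2) assms(2) by (simp add: column_tableau_eq)
qed

text \<open>Follow the cell: \<open>pinv Wt\<close> takes its column entry to its row entry in the
  shortened tableau, translation gives the row entry of the corresponding cell of \<mu>, and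
  \<open>W\<close> makes this the column entry.\<close>

lemma W'_block:
  assumes k: "k \<in> {1..nt}" and ji: "colrow_t k = (j, i)"
  shows "W' (start + k) = column_tableau \<mu> (l + i - 1, j)"
proof -
  note c = colrow_t_mem[OF k ji]
  let ?x = "row_tableau \<mu>t (i, j)"
  have xm: "?x \<in> {1..nt}" by (rule row_tableau_mem[OF comp_mut c(1)])
  have "Wt ?x = k" unfolding Wt_def using perm_w_props(2)[OF part_mut c(1)] c(2) by simp
  then have "pinv Wt k = ?x" by (simp add: permutes_inv_eq[OF Wt])
  then have "W' (start + k) = W (start + ?x)" 
    using pinv_shift_perm(1)[OF Wt start_nt(2) k] by (simp add: W'_def)
  also have "start + ?x = row_tableau \<mu> (l + i - 1, j)"
    using c(1) psum_mut[of i] by (simp add: row_tableau_eq mut_diagram)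
  also have "W \<dots> = column_tableau \<mu> (l + i - 1, j)"
    unfolding W_def by (rule perm_w_props(2)[OF part c(3)])
  finally show ?thesis .
qed

text \<open>Both orders are lexicographic on cells, by column and then by row, and deleting rows
  changes the row numbers by a constant only.\<close>

lemma W'_block_less:
  assumes "k \<in> {1..nt}" "k' \<in> {1..nt}"
  shows "W' (start + k) < W' (start + k') \<longleftrightarrow> k < k'"
proof -
  obtain j i j' i' where ji: "colrow_t k = (j, i)" "colrow_t k' = (j', i')" by force
  note c = colrow_t_mem[OF assms(1) ji(1)] and c' = colrow_t_mem[OF assms(2) ji(2)]
  have "i \<ge> 1" "i' \<ge> 1" using c(1) c'(1) by (auto simp: diagram_def)
  then have "l + i - 1 < l + i' - 1 \<longleftrightarrow> i < i'" using l by auto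
  then show ?thesis
    using column_tableau_less_iff[OF part c(3) c'(3)] column_tableau_less_iff[OF part_mut c(1) c'(1)]
      c(2) c'(2) W'_block[OF assms(1) ji(1)] W'_block[OF assms(2) ji(2)] by simp
qed

lemma W'_outside:
  assumes "p \<in> {1..n}" "p \<notin> {start + 1..start + nt}"
  shows "snd (colrow (W' p)) \<notin> {l..m}"
proof -
  note c = cellof_diagram[OF comp assms(1)]
  have "W' p = W p" using pinv_shift_perm(2)[OF Wt start_nt(2) assms(2)] by (simp add: W'_def)
  also have "W p = column_tableau \<mu> (cellof \<mu> p)"
    unfolding W_def using perm_w_props(2)[OF part c(1)] c(2) by simp
  finally have "colrow (W' p) = (snd (cellof \<mu> p), rowof \<mu> p)"
    using colrow_column_tableau[of "rowof \<mu> p" "snd (cellof \<mu> p)"] c(1)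
    by (metis fst_cellof prod.collapse)
  then show ?thesis using assms(2) unfolding block_iff[OF assms(1)] by simp
qed

text \<open>
  The colour classes are the parts of the columns that lie in rows \<open>l, \<dots>, m\<close>, and singletons; the
  two kinds of colours differ because columns and entries are numbered from \<open>1\<close>.
\<close>

definition colcol :: "nat \<Rightarrow> nat \<times> nat" where
  "colcol p = (if snd (colrow p) \<in> {l..m} then (fst (colrow p), 0) else (0, p))"

lemma colcol_W'_block:
  assumes "k \<in> {1..nt}"
  shows "colcol (W' (start + k)) = (rowof (conjugate \<mu>t) k, 0)"
proof -
  obtain j i where ji: "colrow_t k = (j, i)" by force
  note c = colrow_t_mem[OF assms ji]
  have "rowof (conjugate \<mu>t) k = j" using ji by (metis fst_cellof fst_conv)
  then show ?thesis
    using c(4) colrow_column_tableau[OF c(3)] W'_block[OF assms ji] by (simp add: colcol_def)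
qed

lemma colcol_W'_outside:
  assumes "p \<in> {1..n}" "p \<notin> {start + 1..start + nt}"
  shows "colcol (W' p) = (0, W' p)"
  using W'_outside[OF assms] by (simp only: colcol_def if_False)

lemma W'_mem: "p \<in> {1..n} \<Longrightarrow> W' p \<in> {1..n}"
  using permutes_in_image[OF W'] by blast

text \<open>On the block the colours have second component \<open>0\<close>; outside it the second
  component is the point \<open>W' p\<close> itself, which is positive. So different points share a
  colour only within the block.\<close>

lemma colcol_W'_eq:
  assumes "p \<in> {1..n}" "p' \<in> {1..n}" "colcol (W' p) = colcol (W' p')" "p \<noteq> p'"
  shows "p \<in> {start + 1..start + nt}" "p' \<in> {start + 1..start + nt}"
proof -
  have ne: "W' p \<noteq> W' p'" using assms(4) permutes_inj[OF W'] by (simp add: inj_eq)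
  have pos: "W' p \<noteq> 0" "W' p' \<noteq> 0" using W'_mem assms(1,2) by force+
  have *: "(p \<in> {start + 1..start + nt} \<longrightarrow> snd (colcol (W' p)) = 0) \<and>
      (p \<notin> {start + 1..start + nt} \<longrightarrow> colcol (W' p) = (0, W' p))" if "p \<in> {1..n}" for p
  proof (intro conjI impI)
    assume "p \<in> {start + 1..start + nt}"
    then obtain k where "k \<in> {1..nt}" "p = start + k" by (rule block_memE)
    then show "snd (colcol (W' p)) = 0" using colcol_W'_block by simp
  qed (rule colcol_W'_outside[OF that])
  show "p \<in> {start + 1..start + nt}" "p' \<in> {start + 1..start + nt}"
    using *[OF assms(1)] *[OF assms(2)] assms(3) ne pos by (metis snd_conv)+
qed

lemma ex_W'_preimage:
  assumes "x \<in> {1..n}"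
  obtains p where "p \<in> {1..n}" "x = W' p"
  using pinv_mem[OF W' assms] permutes_inverses(1)[OF W'] by metis

text \<open>Within a column the entries in rows \<open>l\<close> to \<open>m\<close> are
  consecutive, and a colour of the other kind belongs to a single point.\<close>

lemma convex_colcol: "convex_col n colcol"
  unfolding convex_col_def
proof (intro ballI impI)
  fix x y z assume mem: "x \<in> {1..n}" "y \<in> {1..n}" "z \<in> {1..n}"
    and le: "x \<le> y \<and> y \<le> z \<and> colcol x = colcol z"
  note cc = composition_conjugate[OF part]
  show "colcol y = colcol x"
  proof (cases "snd (colrow x) \<in> {l..m} \<and> snd (colrow z) \<in> {l..m}")
    case False
    have "x \<noteq> 0" "z \<noteq> 0" using mem by auto
    then have "x = z" using False le by (auto simp: colcol_def split: if_splits)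
    then have "y = x" using le by simp
    then show ?thesis by simp
  next
    case True
    let ?r = "rowof (conjugate \<mu>)"
    have "?r x = ?r z" using True le by (simp add: colcol_def)
    moreover have "?r x \<le> ?r y" "?r y \<le> ?r z" using le mem by (auto intro: rowof_mono[OF cc])
    ultimately have r: "?r y = ?r x" "?r z = ?r x" by auto
    then have "snd (colrow y) \<in> {l..m}"
      using True le by (auto simp: cellof_def)
    then show ?thesis using True r by (simp add: colcol_def)
  qed
qed

text \<open>A colour shared by different points lives on the block, which is an interval on which
  \<open>W'\<close> is increasing; so convexity of \<open>colcol\<close> can be pulled back.\<close>

lemma convex_colcol_W': "convex_col n (colcol \<circ> W')"
  unfolding convex_col_def
proof (intro ballI impI)
  fix x y z assume mem: "x \<in> {1..n}" "y \<in> {1..n}" "z \<in> {1..n}"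
    and le: "x \<le> y \<and> y \<le> z \<and> (colcol \<circ> W') x = (colcol \<circ> W') z"
  show "(colcol \<circ> W') y = (colcol \<circ> W') x"
  proof (cases "x = z")
    case False
    have xz: "x \<in> {start + 1..start + nt}" "z \<in> {start + 1..start + nt}"
      using colcol_W'_eq[OF mem(1,3) _ False] le by auto
    obtain k1 where k1: "k1 \<in> {1..nt}" "x = start + k1" using xz(1) by (rule block_memE)
    obtain k3 where k3: "k3 \<in> {1..nt}" "z = start + k3" using xz(2) by (rule block_memE)
    define k2 where "k2 = y - start"
    have k2: "k2 \<in> {1..nt}" "y = start + k2" using le k1 k3 by (auto simp: k2_def)
    have "W' x \<le> W' y" "W' y \<le> W' z"
      using W'_block_less[OF k2(1) k1(1)] W'_block_less[OF k3(1) k2(1)] le k1 k2 k3 by auto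
    then show ?thesis
      using convex_colcol le W'_mem[OF mem(1)] W'_mem[OF mem(2)] W'_mem[OF mem(3)]
      unfolding convex_col_def o_def by blast
  qed (use le in auto)
qed

text \<open>Gives additivity of lengths in \<open>W = W' \<circ> sh Wt\<close>. The two variants
  below serve the products of \<open>W'\<close> with stabilizers of truncated columns, on either
  side.\<close>

lemma col_increasing_W'_block: "col_increasing n bcol W'"
  unfolding col_increasing_def
proof (intro ballI impI)
  fix x y assume xy: "x \<in> {1..n}" "y \<in> {1..n}" "x < y \<and> bcol x = bcol y"
  then have b: "x \<in> {start + 1..start + nt}" "y \<in> {start + 1..start + nt}" by (auto simp: block_col_def split: if_splits)
  obtain k where k: "k \<in> {1..nt}" "x = start + k" using b(1) by (rule block_memE)
  obtain k' where k': "k' \<in> {1..nt}" "y = start + k'" using b(2) by (rule block_memE)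
  show "W' x < W' y" using W'_block_less[OF k(1) k'(1)] xy k k' by simp
qed

lemma col_increasing_W': "col_increasing n (colcol \<circ> W') W'"
  unfolding col_increasing_def
proof (intro ballI impI)
  fix x y assume xy: "x \<in> {1..n}" "y \<in> {1..n}" "x < y \<and> (colcol \<circ> W') x = (colcol \<circ> W') y"
  then have "x \<in> {start + 1..start + nt}" "y \<in> {start + 1..start + nt}" using colcol_W'_eq[of x y] by auto
  then have "bcol x = bcol y" by (simp add: block_col_def)
  then show "W' x < W' y" using col_increasing_W'_block xy unfolding col_increasing_def by blast
qed

lemma col_increasing_pinv_W': "col_increasing n colcol (pinv W')"
  unfolding col_increasing_def
proof (intro ballI impI)
  fix x y assume xy: "x \<in> {1..n}" "y \<in> {1..n}" "x < y \<and> colcol x = colcol y"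
  obtain p where p: "p \<in> {1..n}" "x = W' p" using xy(1) by (rule ex_W'_preimage)
  obtain p' where p': "p' \<in> {1..n}" "y = W' p'" using xy(2) by (rule ex_W'_preimage)
  have "p \<noteq> p'" using xy p p' by auto
  then have b: "p \<in> {start + 1..start + nt}" "p' \<in> {start + 1..start + nt}"
    using colcol_W'_eq[OF p(1) p'(1)] xy p p' by auto
  obtain k where k: "k \<in> {1..nt}" "p = start + k" using b(1) by (rule block_memE)
  obtain k' where k': "k' \<in> {1..nt}" "p' = start + k'" using b(2) by (rule block_memE)
  have "p < p'" using W'_block_less[OF k(1) k'(1)] xy p p' k k' by simp
  then show "pinv W' x < pinv W' y" using p p' by (simp add: permutes_inverses[OF W'])
qed

text \<open>A piece of a column lies in that column, and singletons are fixed. Hence the column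
  group is a union of cosets of the smaller group, whose sum can be split off from
  \<open>yp\<close>.\<close>

lemma col_group_colcol_subset: "col_group n colcol \<subseteq> col_group n (rowof (conjugate \<mu>))"
proof
  fix z assume z: "z \<in> col_group n colcol"
  have zp: "z permutes {1..n}" by (rule col_group_permutes[OF z])
  have "rowof (conjugate \<mu>) (z p) = rowof (conjugate \<mu>) p" if p: "p \<in> {1..n}" for p
  proof -
    have e: "colcol (z p) = colcol p" by (rule col_group_col[OF z p])
    have "z p \<in> {1..n}" using p permutes_in_image[OF zp] by blast
    then have "p \<noteq> 0" "z p \<noteq> 0" using p by auto
    then show ?thesis using e by (auto simp: colcol_def split: if_splits)
  qed
  then show "z \<in> col_group n (rowof (conjugate \<mu>))" using zp by (simp add: col_group_def)
qed

lemma bij_conj_W':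
  "bij_betw (\<lambda>z. W' \<circ> z \<circ> pinv W') (col_group n (colcol \<circ> W')) (col_group n colcol)"
proof (rule bij_betw_byWitness[where f' = "\<lambda>z. pinv W' \<circ> z \<circ> W'"])
  note i1 = permutes_inv_o[OF W'] and i2 = permutes_inverses[OF W']
  show "\<forall>z\<in>col_group n (colcol \<circ> W'). pinv W' \<circ> (W' \<circ> z \<circ> pinv W') \<circ> W' = z"
    "\<forall>z\<in>col_group n colcol. W' \<circ> (pinv W' \<circ> z \<circ> W') \<circ> pinv W' = z"
    by (auto simp: fun_eq_iff i2)
  show "(\<lambda>z. W' \<circ> z \<circ> pinv W') ` col_group n (colcol \<circ> W') \<subseteq> col_group n colcol"
  proof clarify
    fix z assume z: "z \<in> col_group n (colcol \<circ> W')"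
    have "W' \<circ> z \<circ> pinv W' permutes {1..n}"
      by (intro permutes_compose permutes_inv W' col_group_permutes[OF z])
    moreover have "colcol (W' (z (pinv W' p))) = colcol p" if "p \<in> {1..n}" for p
      using col_group_col[OF z pinv_mem[OF W' that]] by (simp add: i2)
    ultimately show "W' \<circ> z \<circ> pinv W' \<in> col_group n colcol" by (simp add: col_group_def)
  qed
  show "(\<lambda>z. pinv W' \<circ> z \<circ> W') ` col_group n colcol \<subseteq> col_group n (colcol \<circ> W')"
  proof clarify
    fix z assume z: "z \<in> col_group n colcol"
    have "pinv W' \<circ> z \<circ> W' permutes {1..n}"
      by (intro permutes_compose permutes_inv W' col_group_permutes[OF z])
    moreover have "colcol (z (W' p)) = colcol (W' p)" if "p \<in> {1..n}" for p
      using col_group_col[OF z W'_mem[OF that]] .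
    ultimately show "pinv W' \<circ> z \<circ> W' \<in> col_group n (colcol \<circ> W')" by (simp add: col_group_def i2)
  qed
qed

text \<open>Through \<open>W'\<close> the colours become the columns of the shortened diagram on the
  block and singletons elsewhere, so that nothing outside the block moves.\<close>

lemma col_group_colcol_W':
  "col_group n (colcol \<circ> W') = sh ` col_group nt (rowof (conjugate \<mu>t))"
proof (intro Set.set_eqI iffI)
  fix z assume z: "z \<in> col_group n (colcol \<circ> W')"
  have "z p = p" if p: "p \<in> {1..n}" "p \<notin> {start + 1..start + nt}" for p
  proof -
    have "z p \<in> {1..n}" using p permutes_in_image[OF col_group_permutes[OF z]] by blast
    then show ?thesis using colcol_W'_eq(2)[of "z p" p] col_group_col[OF z p(1)] p by auto
  qed
  then obtain u where u: "u permutes {1..nt}" "z = sh u" using col_group_fixing_block[OF z] by blast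
  have "rowof (conjugate \<mu>t) (u k) = rowof (conjugate \<mu>t) k" if k: "k \<in> {1..nt}" for k
  proof -
    have "u k \<in> {1..nt}" using k permutes_in_image[OF u(1)] by blast
    then show ?thesis
      using col_group_col[OF z block_mem[OF k]] colcol_W'_block k u(2) by (simp add: shift_perm_apply)
  qed
  then show "z \<in> sh ` col_group nt (rowof (conjugate \<mu>t))" using u by (auto simp: col_group_def)
next
  fix z assume "z \<in> sh ` col_group nt (rowof (conjugate \<mu>t))"
  then obtain u where u: "u \<in> col_group nt (rowof (conjugate \<mu>t))" "z = sh u" by blast
  have up: "u permutes {1..nt}" by (rule col_group_permutes[OF u(1)])
  have "colcol (W' (z p)) = colcol (W' p)" if p: "p \<in> {1..n}" for p
  proof (cases "p \<in> {start + 1..start + nt}")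
    case True
    then obtain k where k: "k \<in> {1..nt}" "p = start + k" by (rule block_memE)
    have "u k \<in> {1..nt}" using k permutes_in_image[OF up] by blast
    then show ?thesis using k u col_group_col[OF u(1) k(1)] by (simp add: shift_perm_apply colcol_W'_block)
  next
    case False
    then show ?thesis using shift_perm_outside[OF False] u(2) by simp
  qed
  then show "z \<in> col_group n (colcol \<circ> W')" using sh_permutes[OF up] u(2) by (simp add: col_group_def)
qed

text \<open>For \<open>z\<close> in the pulled back group, \<open>W' \<circ> z\<close> is also the
  conjugate of \<open>z\<close> by \<open>W'\<close> followed after \<open>W'\<close>. Lengths add
  in both factorizations, so \<open>Te n e W'\<close> passes the sum term by term.\<close>

lemma Te_W'_Tsum:
  "hcong n q (Te n e W' * Tsum n e (col_group n colcol))
    (Tsum n e (col_group n (colcol \<circ> W')) * Te n e W')"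
proof -
  let ?G = "col_group n (colcol \<circ> W')" and ?f = "\<lambda>z. W' \<circ> z \<circ> pinv W'"
  have "Te n e W' * Tsum n e (col_group n colcol) = (\<Sum>z\<in>?G. Te n e W' * Te n e (?f z))"
    unfolding Tsum_def sum_distrib_left by (rule sum.reindex_bij_betw[OF bij_conj_W', symmetric])
  moreover have "hcong n q (\<Sum>z\<in>?G. Te n e W' * Te n e (?f z)) (\<Sum>z\<in>?G. Te n e z * Te n e W')"
  proof (rule hcong_sum)
    fix z assume z: "z \<in> ?G"
    have fz: "?f z \<in> col_group n colcol" using bij_betwE[OF bij_conj_W'] z by blast
    have "?f z \<circ> W' = W' \<circ> z" by (simp add: fun_eq_iff permutes_inverses[OF W'])
    then have "hcong n q (Te n e (W' \<circ> z)) (Te n e W' * Te n e (?f z))"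
      using Te_right[OF convex_colcol fz W' col_increasing_pinv_W', of q e] by metis
    then have "hcong n q (Te n e W' * Te n e (?f z)) (Te n e (W' \<circ> z))" by (rule hcong_sym)
    also have "hcong n q \<dots> (Te n e z * Te n e W')"
      by (rule Te_left[OF convex_colcol_W' z W' col_increasing_W'])
    finally show "hcong n q (Te n e W' * Te n e (?f z)) (Te n e z * Te n e W')" .
  qed
  moreover have "Tsum n e ?G * Te n e W' = (\<Sum>z\<in>?G. Te n e z * Te n e W')"
    unfolding Tsum_def by (rule sum_distrib_right)
  ultimately show ?thesis by (simp only:)
qed

lemma specht_generator_factor:
  fixes q :: "'a::field"
  assumes q: "q \<noteq> 0"
  shows "\<exists>g\<in>fcarrier n. hcong n q (Tp n (perm_w n \<mu>) * yp n q (conjugate \<mu>))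
    (shift start (Tp nt (perm_w nt \<mu>t) * yp nt q (conjugate \<mu>t)) * g)"
proof -
  define e where "e = inverse (- q)"
  have e: "e \<noteq> 0" using q by (simp add: e_def)
  \<comment> \<open>Cancels the weight that \<open>Te\<close> attaches to \<open>W'\<close>; the
    weighted form is the one that \<open>Te_W'_Tsum\<close> moves past the sum.\<close>
  define b where "b = const (inverse (e ^ card (invs W')))"
  have b: "b \<in> fcarrier n" by (simp add: b_def)
  have bW': "Tp n W' = b * Te n e W'"
  proof -
    have "b * Te n e W' = const (inverse (e ^ card (invs W')) * e ^ card (invs W')) * Tp n W'"
      unfolding b_def Te_def const_mult by (simp only: mult.assoc)
    then show ?thesis using e by simp
  qed
  define Y' Y'' where "Y' = Tsum n e (col_group n colcol)" and "Y'' = Tsum n e (col_group n (colcol \<circ> W'))"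
  have Y: "Y' \<in> fcarrier n" "Y'' \<in> fcarrier n" unfolding Y'_def Y''_def by auto
  have perm: "w permutes {1..n}" if "w \<in> col_group n (rowof (conjugate \<mu>))" for w
    using that by (rule col_group_permutes)
  have closed: "w \<circ> z \<in> col_group n (rowof (conjugate \<mu>))"
    if "w \<in> col_group n (rowof (conjugate \<mu>))" "z \<in> col_group n colcol" for w z
    using that(2) col_group_colcol_subset by (intro comp_col_group[OF that(1)]) blast
  have "\<exists>h\<in>fcarrier n. hcong n q (yp n q (conjugate \<mu>)) (Y' * h)"
    unfolding yp_def Y'_def e_def by (rule Tsum_left[OF convex_colcol perm closed])
  then obtain h where h: "h \<in> fcarrier n" "hcong n q (yp n q (conjugate \<mu>)) (Y' * h)"
    by (rule bexE)
  have shY: "hcong n q Y'' (shift start (yp nt q (conjugate \<mu>t)))"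
    unfolding Y''_def yp_def col_group_colcol_W' e_def
    by (rule hcong_sym[OF shift_Tsum[OF col_group_permutes start_nt(2)]])
  have Wts: "sh Wt \<in> col_group n bcol" by (rule shift_perm_block_col[OF Wt start_nt(2)])
  have carr: "Tp n W \<in> fcarrier n" "Tp n W' \<in> fcarrier n" "Te n e W' \<in> fcarrier n"
    "Tp n (sh Wt) \<in> fcarrier n" "shift start (Tp nt Wt) \<in> fcarrier n"
    "shift start (yp nt q (conjugate \<mu>t)) \<in> fcarrier n"
    using W W' sh_permutes[OF Wt] Wt start_nt(2) by auto
  have "hcong n q (Tp n W) (Tp n (sh Wt) * Tp n W')"
    using Te_left[OF convex_block_col Wts W' col_increasing_W'_block, of q 1]
    unfolding W_eq[symmetric] Te_1 .
  also have "hcong n q \<dots> (shift start (Tp nt Wt) * Tp n W')"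
    using hcong_sym[OF shift_Te[OF Wt start_nt(2), of q 1]] carr unfolding Te_1 by (intro hcong_mult_right)
  finally have TW: "hcong n q (Tp n W) (shift start (Tp nt Wt) * Tp n W')" .
  have "hcong n q (Tp n W * yp n q (conjugate \<mu>)) (shift start (Tp nt Wt) * Tp n W' * (Y' * h))"
    by (rule hcong_mult[OF TW h(2)]) (use carr in auto)
  also have "shift start (Tp nt Wt) * Tp n W' * (Y' * h) = (shift start (Tp nt Wt) * b) * (Te n e W' * Y') * h"
    unfolding bW' by (simp only: mult.assoc)
  also have "hcong n q \<dots> ((shift start (Tp nt Wt) * b) * (Y'' * Te n e W') * h)"
    using carr b h(1) unfolding Y'_def Y''_def
    by (intro hcong_mult_right hcong_mult_left Te_W'_Tsum) auto
  \<comment> \<open>Only the scalar \<open>b\<close> changes place.\<close>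
  also have "(shift start (Tp nt Wt) * b) * (Y'' * Te n e W') * h = shift start (Tp nt Wt) * Y'' * (b * Te n e W' * h)"
    using const_commute[of _ Y''] unfolding b_def by (simp add: mult.assoc[symmetric]) (simp add: mult.assoc)
  also have "hcong n q \<dots> (shift start (Tp nt Wt) * shift start (yp nt q (conjugate \<mu>t)) * (b * Te n e W' * h))"
    using carr b h(1) shY by (intro hcong_mult_right hcong_mult_left) auto
  finally show ?thesis
    unfolding W_def Wt_def shift_mult using carr b h(1) by (intro bexI[of _ "b * Te n e W' * h"]) auto
qed

end

section \<open>Evaluation on Specht modules and transfer of the relation\<close>

lemma specht_module_iff:
  assumes "is_partition n \<mu>"
  shows "v \<in> specht_module n q \<mu> \<longleftrightarrow>
    (\<exists>k\<in>fcarrier n. v = hclass n q (xp n \<mu> * (Tp n (perm_w n \<mu>) * yp n q (conjugate \<mu>)) * k))"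
proof -
  note c = is_partition_composition[OF assms] and cc = composition_conjugate[OF assms]
  note w = perm_w_props(1)[OF assms]
  have "x_elt n q \<mu> \<otimes>\<^bsub>hecke n q\<^esub> T n q (perm_w n \<mu>) \<otimes>\<^bsub>hecke n q\<^esub> y_elt n q (conjugate \<mu>) =
      hclass n q (xp n \<mu> * (Tp n (perm_w n \<mu>) * yp n q (conjugate \<mu>)))"
    by (simp add: x_elt_eq[OF c] y_elt_eq[OF cc] T_eq[OF w] hclass_mult xp_fcarrier yp_fcarrier
        Tp_fcarrier[OF w] mult_fcarrier flip: mult.assoc)
  then show ?thesis
    unfolding specht_module_def using Tp_fcarrier[OF w]
    by (simp only: right_ideal_iff[OF mult_fcarrier[OF xp_fcarrier mult_fcarrier[OF Tp_fcarrier[OF w] yp_fcarrier]]])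
qed

text \<open>The restricted map replaces x_mu by the double coset sum, and everything to the right of
  it is carried along.\<close>

lemma phi_hat_sum:
  fixes q :: "'a::field"
  assumes part: "is_partition n \<mu>" and k: "k \<in> fcarrier n"
    and v: "v = hclass n q (xp n \<mu> * (Tp n (perm_w n \<mu>) * yp n q (conjugate \<mu>)) * k)"
    and A: "\<And>i. i \<in> S \<Longrightarrow> composition n (\<nu> i) \<and> tableau_of_type \<mu> (\<nu> i) (A i)"
  shows "(\<Oplus>\<^bsub>hecke n q\<^esub> i \<in> S. hscale n q (c i) (phi_hat n q \<mu> (\<nu> i) (A i) v)) =
    hclass n q (\<Sum>i\<in>S. const (c i) * (Tsum n 1 (contset n \<mu> (\<nu> i) (A i)) *
      ((Tp n (perm_w n \<mu>) * yp n q (conjugate \<mu>)) * k)))"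
proof -
  interpret R: ring "hecke n q" by (rule ring_hecke)
  let ?t = "Tp n (perm_w n \<mu>) * yp n q (conjugate \<mu>)"
  note cm = is_partition_composition[OF part]
  have t: "?t \<in> fcarrier n" using perm_w_props(1)[OF part] by auto
  have s: "Tsum n (1::'a) (contset n \<mu> \<nu>' B) \<in> fcarrier n" for \<nu>' B
    by (intro Tsum_fcarrier contset_permutes)
  have vS: "v \<in> specht_module n q \<mu>" unfolding specht_module_iff[OF part] using v k by (intro bexI[of _ k])
  have e: "phi_hat n q \<mu> (\<nu> i) (A i) v = hclass n q (Tsum n 1 (contset n \<mu> (\<nu> i) (A i)) * (?t * k))"
    if "i \<in> S" for i
    using phi_apply[OF cm _ _ mult_fcarrier[OF t k], of "\<nu> i" "A i" q] A[OF that] vS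
    by (simp add: phi_hat_def v mult.assoc)
  have carr: "const (c i) * (Tsum n 1 (contset n \<mu> (\<nu> i) (A i)) * (?t * k)) \<in> fcarrier n" for i
    using s t k by auto
  have "hclass n q (\<Sum>i\<in>S. const (c i) * (Tsum n 1 (contset n \<mu> (\<nu> i) (A i)) * (?t * k))) =
      (\<Oplus>\<^bsub>hecke n q\<^esub> i \<in> S. hclass n q (const (c i) * (Tsum n 1 (contset n \<mu> (\<nu> i) (A i)) * (?t * k))))"
    by (rule hclass_sum) (rule carr)
  also have "\<dots> = (\<Oplus>\<^bsub>hecke n q\<^esub> i \<in> S. hscale n q (c i) (phi_hat n q \<mu> (\<nu> i) (A i) v))"
  proof (rule R.finsum_cong')
    have eq: "hscale n q (c i) (phi_hat n q \<mu> (\<nu> i) (A i) v) =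
        hclass n q (const (c i) * (Tsum n 1 (contset n \<mu> (\<nu> i) (A i)) * (?t * k)))" if "i \<in> S" for i
      unfolding e[OF that] by (rule hscale_hclass) (use s t k in auto)
    then show "(\<lambda>i. hscale n q (c i) (phi_hat n q \<mu> (\<nu> i) (A i) v)) \<in> S \<rightarrow> carrier (hecke n q)"
      using hclass_carrier[OF carr] by simp
    show "hclass n q (const (c i) * (Tsum n 1 (contset n \<mu> (\<nu> i) (A i)) * (?t * k))) =
      hscale n q (c i) (phi_hat n q \<mu> (\<nu> i) (A i) v)" if "i \<in> S" for i
      using eq[OF that] ..
  qed simp
  finally show ?thesis ..
qed

text \<open>A shortened tableau comes without a prescribed type, and its content serves as one.
  Positivity of the entries makes the content vanish at \<open>0\<close>.\<close>

lemma composition_content: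
  assumes "finite (diagram \<mu>)" "\<And>x. x \<in> diagram \<mu> \<Longrightarrow> 1 \<le> A x"
  shows "composition (card (diagram \<mu>)) (content \<mu> A)" "tableau_of_type \<mu> (content \<mu> A) A"
proof -
  have z: "content \<mu> A 0 = 0" using assms(2) by (force simp: content_def card_eq_0_iff)
  have supp: "{r. content \<mu> A r \<noteq> 0} = A ` diagram \<mu>"
    using assms(1) by (auto simp: content_def card_eq_0_iff)
  have "card (diagram \<mu>) = (\<Sum>r\<in>A ` diagram \<mu>. content \<mu> A r)"
    using sum.image_gen[OF assms(1), of "\<lambda>_. 1 :: nat" A] by (simp add: content_def)
  then show "composition (card (diagram \<mu>)) (content \<mu> A)"
    using z supp assms(1) by (simp add: composition_def comp_size_def)
  show "tableau_of_type \<mu> (content \<mu> A) A"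
    using assms(2) by (simp add: tableau_of_type_def)
qed

theorem theorem5p1:
  fixes q :: "'a::field" and n l m r nt :: nat and \<mu> la \<mu>t :: "nat \<Rightarrow> nat"
    and A At :: "nat \<Rightarrow> nat \<times> nat \<Rightarrow> nat" and c :: "nat \<Rightarrow> 'a"
  assumes "\<mu>t = rows_from_to l m \<mu>" and "nt = comp_size \<mu>t"
    and "At = (\<lambda>i. tableau_from_row l (A i))"
    and "q \<noteq> 0"
    and "is_partition n \<mu>" and "composition n la"
    and "1 \<le> l" and "l < m"
    and "\<And>i. i \<in> {1..r} \<Longrightarrow> tableau_of_type \<mu> la (A i) \<and> row_standard \<mu> (A i)"
    and "\<And>i k a b. i \<in> {1..r} \<Longrightarrow> k \<in> {1..r} \<Longrightarrow> (a, b) \<in> diagram \<mu> \<Longrightarrow> a \<notin> {l..m} \<Longrightarrow>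
           A i (a, b) = A k (a, b)"
    and "\<forall>v \<in> specht_module nt q \<mu>t.
           (\<Oplus>\<^bsub>hecke nt q\<^esub> i \<in> {1..r}. hscale nt q (c i) (phi_hat nt q \<mu>t (content \<mu>t (At i)) (At i) v))
             = \<zero>\<^bsub>hecke nt q\<^esub>"
  shows "\<forall>v \<in> specht_module n q \<mu>.
           (\<Oplus>\<^bsub>hecke n q\<^esub> i \<in> {1..r}. hscale n q (c i) (phi_hat n q \<mu> la (A i) v))
             = \<zero>\<^bsub>hecke n q\<^esub>"
proof
  fix v assume "v \<in> specht_module n q \<mu>"
  then obtain k where k: "k \<in> fcarrier n"
    and v: "v = hclass n q (xp n \<mu> * (Tp n (perm_w n \<mu>) * yp n q (conjugate \<mu>)) * k)"
    unfolding specht_module_iff[OF assms(5)] by (rule bexE)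
  interpret B: row_block n l m \<mu>
    using assms(5,7,8) by unfold_locales auto
  have mt: "\<mu>t = B.\<mu>t" and nt: "nt = B.nt"
    by (simp_all add: assms(1,2) B.\<mu>t_def B.nt_def)
  have At: "At i = tableau_from_row l (A i)" for i by (simp add: assms(3))
  have part_t: "is_partition nt \<mu>t" unfolding mt nt by (rule B.part_mut)
  note comp_t = is_partition_composition[OF part_t]
  define \<nu>t where "\<nu>t = content \<mu>t (At 1)"
  have entries: "1 \<le> At i x" if "i \<in> {1..r}" "x \<in> diagram \<mu>t" for i x
    using that assms(9)[OF that(1)] B.mut_diagram[of "fst x" "snd x"]
    by (auto simp: At mt tableau_from_row_def tableau_of_type_def split: prod.splits)
  have ct: "composition nt (content \<mu>t (At i))" "tableau_of_type \<mu>t (content \<mu>t (At i)) (At i)"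
    if "i \<in> {1..r}" for i
    using composition_content[OF finite_diagram[OF comp_t] entries[OF that]] comp_t
    by (auto simp: composition_diagram[of nt \<mu>t])
  have content_eq: "content \<mu>t (At i) = \<nu>t" if i: "i \<in> {1..r}" for i
  proof
    fix s
    have one: "1 \<in> {1..r}" using i by auto
    have split: "content \<mu> (A k) s = content \<mu>t (At k) s +
        card {x \<in> diagram \<mu>. fst x \<notin> {l..m} \<and> A k x = s}" for k
      unfolding mt At by (rule B.content_split)
    show "content \<mu>t (At i) s = \<nu>t s"
    proof (cases "s = 0")
      case True
      \<comment> \<open>Compositions vanish at \<open>0\<close>, where the type of
        \<open>A i\<close> gives no information.\<close>
      then show ?thesis using ct(1)[OF i] ct(1)[OF one] by (simp add: \<nu>t_def composition_def)
    next
      case False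
      have "{x \<in> diagram \<mu>. fst x \<notin> {l..m} \<and> A i x = s} = {x \<in> diagram \<mu>. fst x \<notin> {l..m} \<and> A 1 x = s}"
        using assms(10)[OF i one] by auto
      moreover have "content \<mu> (A i) s = content \<mu> (A 1) s"
        using assms(9)[OF i] assms(9)[OF one] False by (simp add: tableau_of_type_def)
      ultimately show ?thesis using split[of i] split[of 1] by (simp add: \<nu>t_def)
    qed
  qed
  have ct': "composition nt \<nu>t" "tableau_of_type \<mu>t \<nu>t (At i)" if "i \<in> {1..r}" for i
    using ct[OF that] unfolding content_eq[OF that] .
  define t where "t = Tp n (perm_w n \<mu>) * yp n q (conjugate \<mu>)"
  define tt where "tt = Tp nt (perm_w nt \<mu>t) * yp nt q (conjugate \<mu>t)"
  define s where "s i = Tsum n (1::'a) (contset n \<mu> la (A i))" for i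
  define st where "st i = Tsum nt (1::'a) (contset nt \<mu>t \<nu>t (At i))" for i
  define \<Theta> where "\<Theta> = Tsum n (1::'a) (B.outer_reps la \<nu>t (A 1))"
  define P where "P = (\<Sum>i\<in>{1..r}. const (c i) * (st i * tt))"
  let ?sh = "shift B.start"
  note an = B.start_nt(2)[folded nt]
  have t: "t \<in> fcarrier n" unfolding t_def using perm_w_props(1)[OF assms(5)] by auto
  have tt: "tt \<in> fcarrier nt" unfolding tt_def using perm_w_props(1)[OF part_t] by auto
  have s: "s i \<in> fcarrier n" and st: "st i \<in> fcarrier nt" for i
    unfolding s_def st_def by (intro Tsum_fcarrier contset_permutes; assumption)+
  have \<Theta>: "\<Theta> \<in> fcarrier n"
    unfolding \<Theta>_def by (intro Tsum_fcarrier) (simp add: B.outer_reps_def)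
  obtain g where g: "g \<in> fcarrier n" "hcong n q t (?sh tt * g)"
    using B.specht_generator_factor[OF assms(4)] unfolding t_def tt_def mt nt by (rule bexE)
  have s_factor: "hcong n q (s i) (\<Theta> * ?sh (st i))" if i: "i \<in> {1..r}" for i
  proof -
    have "1 \<in> {1..r}" using i by auto
    then have "B.outer_reps la \<nu>t (A i) = B.outer_reps la \<nu>t (A 1)"
      using assms(10)[OF i] by (intro B.outer_reps_cong)
    then show ?thesis
      using B.Tsum_contset_factor[OF assms(6) _ _ At, of \<nu>t i q] ct'[OF i]
      unfolding s_def st_def \<Theta>_def mt nt by simp
  qed
  have "P \<in> hecke_ideal nt q"
  proof -
    \<comment> \<open>The assumed relation is evaluated at the generator of the shortened Specht
      module, which already puts \<open>P\<close> into the ideal.\<close>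
    define vt where "vt = hclass nt q (xp nt \<mu>t * tt * 1)"
    have "vt \<in> specht_module nt q \<mu>t"
      unfolding specht_module_iff[OF part_t] vt_def tt_def by (rule bexI[of _ 1]) auto
    moreover have "(\<Oplus>\<^bsub>hecke nt q\<^esub> i \<in> {1..r}. hscale nt q (c i) (phi_hat nt q \<mu>t (content \<mu>t (At i)) (At i) vt)) =
        hclass nt q (\<Sum>i\<in>{1..r}. const (c i) * (Tsum nt 1 (contset nt \<mu>t (content \<mu>t (At i)) (At i)) * (tt * 1)))"
      unfolding tt_def
      by (rule phi_hat_sum[OF part_t one_fcarrier vt_def[unfolded tt_def]]) (use ct in blast)
    moreover have "(\<Sum>i\<in>{1..r}. const (c i) * (Tsum nt 1 (contset nt \<mu>t (content \<mu>t (At i)) (At i)) * (tt * 1))) = P"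
      unfolding P_def st_def by (intro sum.cong) (simp_all add: content_eq)
    ultimately have "hclass nt q P = hclass nt q 0" using assms(11) by (simp add: hclass_zero)
    moreover have "P \<in> fcarrier nt" unfolding P_def using st tt by auto
    ultimately show ?thesis by (simp add: hclass_eq_iff hcong_def)
  qed
  then have shP: "?sh P \<in> hecke_ideal n q" by (rule shift_ideal[OF an])
  have sh: "?sh (st i) \<in> fcarrier n" "?sh tt \<in> fcarrier n" for i
    using st tt an by auto
  \<comment> \<open>With both factorizations inserted and the scalar moved past \<Theta>, the
    summand of the shifted relation stands between factors that do not depend on
    \<open>i\<close>.\<close>
  have summand: "hcong n q (const (c i) * (s i * (t * k)))
      (\<Theta> * (const (c i) * (?sh (st i) * ?sh tt)) * (g * k))" if i: "i \<in> {1..r}" for i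
  proof -
    have "hcong n q (s i * (t * k)) ((\<Theta> * ?sh (st i)) * ((?sh tt * g) * k))"
      using s_factor[OF i] g(2) k t g(1) \<Theta> sh by (intro hcong_mult hcong_mult_right) auto
    then have "hcong n q (const (c i) * (s i * (t * k)))
        (const (c i) * ((\<Theta> * ?sh (st i)) * ((?sh tt * g) * k)))"
      by (intro hcong_mult_left) auto
    also have "const (c i) * ((\<Theta> * ?sh (st i)) * ((?sh tt * g) * k)) =
        const (c i) * \<Theta> * (?sh (st i) * ?sh tt) * (g * k)" by (simp only: mult.assoc)
    also have "\<dots> = \<Theta> * (const (c i) * (?sh (st i) * ?sh tt)) * (g * k)"
      unfolding const_commute[of _ \<Theta>] by (simp only: mult.assoc)
    finally show ?thesis .
  qed
  have "hcong n q (\<Sum>i\<in>{1..r}. const (c i) * (s i * (t * k)))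
      (\<Sum>i\<in>{1..r}. \<Theta> * (const (c i) * (?sh (st i) * ?sh tt)) * (g * k))"
    by (rule hcong_sum) (rule summand)
  moreover have "(\<Sum>i\<in>{1..r}. \<Theta> * (const (c i) * (?sh (st i) * ?sh tt)) * (g * k)) = \<Theta> * ?sh P * (g * k)"
    by (simp add: P_def shift_sum shift_mult sum_distrib_left sum_distrib_right)
  moreover have "\<Theta> * ?sh P * (g * k) \<in> hecke_ideal n q"
    using shP \<Theta> g(1) k by (intro hecke_ideal_props(4,5)) auto
  ultimately have "hcong n q (\<Sum>i\<in>{1..r}. const (c i) * (s i * (t * k))) 0"
    using hcong_trans[of n q _ "\<Theta> * ?sh P * (g * k)" 0] by (simp add: hcong_def)
  moreover have "(\<Sum>i\<in>{1..r}. const (c i) * (s i * (t * k))) \<in> fcarrier n"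
    using s t k by auto
  ultimately have "hclass n q (\<Sum>i\<in>{1..r}. const (c i) * (s i * (t * k))) = \<zero>\<^bsub>hecke n q\<^esub>"
    unfolding hclass_zero[symmetric] by (subst hclass_eq_iff) auto
  moreover have "(\<Oplus>\<^bsub>hecke n q\<^esub> i \<in> {1..r}. hscale n q (c i) (phi_hat n q \<mu> la (A i) v)) =
      hclass n q (\<Sum>i\<in>{1..r}. const (c i) * (s i * (t * k)))"
    unfolding s_def t_def
    by (rule phi_hat_sum[OF assms(5) k v]) (use assms(6,9) in blast)
  ultimately show "(\<Oplus>\<^bsub>hecke n q\<^esub> i \<in> {1..r}. hscale n q (c i) (phi_hat n q \<mu> la (A i) v)) =
      \<zero>\<^bsub>hecke n q\<^esub>" by simp
qed

end
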